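(* Let $T_n$ denote a $2$-dimensional determinantal hypertree on the vertex set $[n]$. Given a positive integer $h$, for all large enough $n$ (depending on $h$), we have \[\mathbb{P}(\dim H_1(T_n,\mathbb{F}_2)\ge h)\ge \frac{e^{-200h}}{(100h)^{5h}}.\] In particular, it is not the case that for all integers $k\ge 0$, \[\lim_{n\to\infty} \mathbb{P}(\dim H_1(T_n,\mathbb{F}_2)=k)=2^{-k^2} \prod_{j=1}^{k} \left(1-2^{-j}\right)^{-2} \prod_{j=1}^{\infty}\left(1-2^{-j}\right).\] Consequently, the following statement, asserted for every prime $p$, is false (it fails for $p=2$): for every finite abelian $p$-group $G$, the $p$-torsion (Sylow $p$-subgroup) $\Gamma_{n,p}$ of $H_1(T_n,\mathbb{Z})$ satisfies \[\lim_{n\to\infty} \mathbb{P}(\Gamma_{n,p}\cong G)=\frac{1}{|\mathrm{Aut}(G)|}\prod_{j=1}^{\infty}\left(1-p^{-j}\right).\]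
   Context: A $2$-dimensional simplicial complex $S$ on the vertex set $[n]=\{1,\dots,n\}$ is called a ($2$-dimensional) hypertree if (a) $S$ has complete $1$-skeleton (all vertices and all pairs from $[n]$ are faces); (b) the number of triangular faces of $S$ is $\binom{n-1}{2}$; (c) the homology group $H_1(S,\mathbb{Z})$ is finite. Let $\mathcal{C}(n,2)$ be the set of hypertrees on $[n]$. Kalai's formula states $\sum_{S\in\mathcal{C}(n,2)}|H_1(S,\mathbb{Z})|^2=n^{\binom{n-2}{2}}$. A determinantal hypertree $T_n$ is a random element of $\mathcal{C}(n,2)$ with distribution \[\mathbb{P}(T_n=S)=\frac{|H_1(S,\mathbb{Z})|^2}{n^{\binom{n-2}{2}}}\qquad (S\in\mathcal{C}(n,2)).\] *)

theory Defs
  imports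
    "HOL-Probability.Probability"
    "HOL-Number_Theory.Residues"
    "HOL-Algebra.IntRing"
    "HOL-Algebra.Bij"
    "Jordan_Normal_Form.Missing_VectorSpace"
begin

section \<open>Simplicial homology with coefficients\<close>

text \<open>A complex is the set of its nonempty simplices.\<close>

definition simplicial_complex_on :: "nat set \<Rightarrow> nat set set \<Rightarrow> bool" where
  "simplicial_complex_on V S \<longleftrightarrow>
     {} \<notin> S \<and> (\<forall>\<sigma>\<in>S. finite \<sigma> \<and> \<sigma> \<subseteq> V) \<and> (\<forall>v\<in>V. {v} \<in> S) \<and>
     (\<forall>\<sigma>\<in>S. \<forall>\<tau>. \<tau> \<subseteq> \<sigma> \<and> \<tau> \<noteq> {} \<longrightarrow> \<tau> \<in> S)"

definition faces :: "nat set set \<Rightarrow> nat \<Rightarrow> nat set set" where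
  "faces S k = {\<sigma> \<in> S. finite \<sigma> \<and> card \<sigma> = k + 1}"

text \<open>Simplices are oriented by the order of their vertices: for \<open>v\<^sub>0 < \<dots> < v\<^sub>k\<close> the coefficient
  of the face omitting \<open>v\<^sub>i\<close> in the boundary of \<open>{v\<^sub>0, \<dots>, v\<^sub>k}\<close> is \<open>(-1)^i\<close>.\<close>

definition incidence :: "nat set \<Rightarrow> nat set \<Rightarrow> int" where
  "incidence \<tau> \<sigma> = (\<Sum>v\<in>\<tau>. if \<sigma> = \<tau> - {v} then (-1) ^ card {u \<in> \<tau>. u < v} else 0)"

definition chains ::
  "('r, 'm) ring_scheme \<Rightarrow> nat set set \<Rightarrow> nat \<Rightarrow> ('r, nat set \<Rightarrow> 'r) module" where
  "chains R S k = ring.func_space R (faces S k)"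

text \<open>\<open>boundary R S k\<close> is the map from \<open>(k+1)\<close>-chains to \<open>k\<close>-chains.\<close>

definition boundary ::
  "('r, 'm) ring_scheme \<Rightarrow> nat set set \<Rightarrow> nat \<Rightarrow> (nat set \<Rightarrow> 'r) \<Rightarrow> nat set \<Rightarrow> 'r" where
  "boundary R S k f =
     (\<lambda>\<sigma>\<in>faces S k. \<Oplus>\<^bsub>R\<^esub>\<tau>\<in>faces S (Suc k). [incidence \<tau> \<sigma>] \<cdot>\<^bsub>R\<^esub> f \<tau>)"

definition cycles ::
  "('r, 'm) ring_scheme \<Rightarrow> nat set set \<Rightarrow> nat \<Rightarrow> ('r, nat set \<Rightarrow> 'r) module" where
  "cycles R S k = (chains R S k)\<lparr>carrier :=
     (case k of 0 \<Rightarrow> carrier (chains R S 0)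
      | Suc j \<Rightarrow> a_kernel (chains R S (Suc j)) (chains R S j) (boundary R S j))\<rparr>"

definition boundaries ::
  "('r, 'm) ring_scheme \<Rightarrow> nat set set \<Rightarrow> nat \<Rightarrow> (nat set \<Rightarrow> 'r) set" where
  "boundaries R S k = boundary R S k ` carrier (chains R S (Suc k))"

text \<open>The quotient of the module of cycles by the submodule of boundaries. The fields
  \<open>mult\<close> and \<open>one\<close> of a module record play no role and are filled in arbitrarily, as in the
  library's \<open>func_space\<close>.\<close>

definition homology ::
  "('r, 'm) ring_scheme \<Rightarrow> nat set set \<Rightarrow> nat \<Rightarrow> ('r, (nat set \<Rightarrow> 'r) set) module" where
  "homology R S k =
     \<lparr>carrier = a_rcosets\<^bsub>cycles R S k\<^esub> (boundaries R S k),
      mult = (\<lambda>X Y. boundaries R S k),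
      one = boundaries R S k,
      zero = boundaries R S k,
      add = (\<lambda>X Y. X <+>\<^bsub>cycles R S k\<^esub> Y),
      smult = (\<lambda>r X. \<Union>x\<in>X.
        boundaries R S k +>\<^bsub>cycles R S k\<^esub> (r \<odot>\<^bsub>cycles R S k\<^esub> x))\<rparr>"

abbreviation
  "H1_int S \<equiv> add_monoid (homology \<Z> S 1)"

definition dim_H1_F2 :: "nat set set \<Rightarrow> nat" where
  "dim_H1_F2 S = vectorspace.dim (residue_ring 2) (homology (residue_ring 2) S 1)"

section \<open>Determinantal hypertrees\<close>

definition hypertrees :: "nat \<Rightarrow> nat set set set" where
  "hypertrees n = {S.
     simplicial_complex_on {1..n} S \<and> (\<forall>\<sigma>\<in>S. card \<sigma> \<le> 3) \<and>
     (\<forall>\<sigma>. \<sigma> \<subseteq> {1..n} \<and> card \<sigma> \<in> {1, 2} \<longrightarrow> \<sigma> \<in> S) \<and>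
     card (faces S 2) = (n - 1) choose 2 \<and>
     finite (carrier (H1_int S))}"

definition determinantal_hypertree ::
  "'a measure \<Rightarrow> nat \<Rightarrow> ('a \<Rightarrow> nat set set) \<Rightarrow> bool" where
  "determinantal_hypertree M n T \<longleftrightarrow>
     prob_space M \<and> T \<in> M \<rightarrow>\<^sub>M count_space (hypertrees n) \<and>
     (\<forall>S\<in>hypertrees n.
        measure M {\<omega> \<in> space M. T \<omega> = S} =
          real (order (H1_int S)) ^ 2 / real n ^ ((n - 2) choose 2))"

section \<open>The Cohen--Lenstra limit law\<close>

definition p_torsion :: "nat \<Rightarrow> ('g, 'm) monoid_scheme \<Rightarrow> ('g, 'm) monoid_scheme" where
  "p_torsion p G = G\<lparr>carrier := {x \<in> carrier G. \<exists>m::nat. x [^]\<^bsub>G\<^esub> (p ^ m) = \<one>\<^bsub>G\<^esub>}\<rparr>"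

definition finite_abelian_p_group :: "nat \<Rightarrow> ('g, 'm) monoid_scheme \<Rightarrow> bool" where
  "finite_abelian_p_group p G \<longleftrightarrow>
     comm_group G \<and> finite (carrier G) \<and> (\<exists>m. order G = p ^ m)"

text \<open>Every finite group is isomorphic to one whose elements are natural numbers, so nothing is
  lost by letting \<open>G\<close> range over groups of type \<open>nat monoid\<close>.\<close>

definition cohen_lenstra_limit ::
  "(nat \<Rightarrow> 'a measure) \<Rightarrow> (nat \<Rightarrow> 'a \<Rightarrow> nat set set) \<Rightarrow> nat \<Rightarrow> bool" where
  "cohen_lenstra_limit M T p \<longleftrightarrow>
     (\<forall>G :: nat monoid. finite_abelian_p_group p G \<longrightarrow>
        (\<lambda>n. measure (M n) {\<omega> \<in> space (M n). p_torsion p (H1_int (T n \<omega>)) \<cong> G})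
          \<longlonglongrightarrow> 1 / real (card (auto G)) * prodinf (\<lambda>j. 1 - 1 / real p ^ Suc j))"

end

theory Submission
  imports Defs "Jordan_Normal_Form.Determinant" "HOL-Real_Asymp.Real_Asymp"
begin

text \<open>
  Root all chains at the vertex 1. Then \<open>|H\<^sub>1(S, \<int>)|\<close> is the absolute value of the determinant of
  the triangle-edge incidence matrix restricted to the edges avoiding 1, so \<open>T\<^sub>n\<close> is a determinantal
  process and the Cauchy-Binet formula evaluates the relevant sums of squared determinants.

  Lower bound: take \<open>h\<close> disjoint strips of five triangles \<open>{u\<^sub>i, u\<^sub>i\<^sub>+\<^sub>1, u\<^sub>i\<^sub>+\<^sub>2}\<close>, with
  indices modulo 5. If every triangle of \<open>T\<^sub>n\<close> containing an edge \<open>{u\<^sub>i, u\<^sub>i\<^sub>+\<^sub>1}\<close> belongs to a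
  strip, then for each strip the sum of the coefficients at these five edges vanishes modulo 2 on
  boundaries, as a triangle of a strip contains exactly two of them. As 5 is odd, the \<open>h\<close> sums take all
  values on cycles and \<open>dim H\<^sub>1(T\<^sub>n, \<bbbF>\<^sub>2) \<ge> h\<close>. Each such event has probability at least about
  \<open>n^(-5h) e^(-10h)\<close>, the events are almost mutually exclusive, and Bonferroni's inequality over
  \<open>(n / 100h)^(5h)\<close> placements of the strips gives the claim.

  This tail decays only like \<open>exp (- O(h log h))\<close>, whereas the limits in question have tails of order
  \<open>exp (- c h\<^sup>2)\<close>. For the Cohen-Lenstra law this is seen by a lower bound on the mass of
  the groups of rank below \<open>h\<close>, obtained by counting sublattices of \<open>\<int>\<^sup>m\<close> in Hermite normal form
  according to their quotient group.
\<close>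

section \<open>Determinants with rows and columns indexed by finite sets\<close>

text \<open>The difficulty is to compare the weight of the bases avoiding the bad triangles with the
  total weight, both being determinants of order \<open>card (edges_off n)\<close>. Both rest on one
  identity: on the edges avoiding 1, the Gram matrix of the triangles plus that of the vertices is
  \<open>n\<close> times the identity. The triangle part fixes the columns of the vertex incidence
  matrix, so its determinant times that of the identity plus the vertex part is a power of
  \<open>n\<close>. If bad triangles are forbidden, every basis of nonzero weight contains all strip
  triangles, so their vectors may be replaced by unit vectors after a change of basis whose
  determinant is a nonzero integer. With weight \<open>n\<close> on these unit vectors the identity
  persists up to one rank-one term for each triangle containing a strip edge. The remaining form
  stays bounded below by \<open>n - 8\<close>, so each such term changes the determinant by a factor
  of at most \<open>1 + 2 / (n - 8)\<close>. Giving extra weight \<open>1 + y\<close> to prescribed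
  triangles bounds the joint probabilities by the same method.\<close>

definition enum_of :: "'a set \<Rightarrow> nat \<Rightarrow> 'a" where
  "enum_of S = (SOME f. bij_betw f {0..<card S} S)"

lemma bij_enum_of: "finite S \<Longrightarrow> bij_betw (enum_of S) {0..<card S} S"
  unfolding enum_of_def by (rule someI_ex[OF ex_bij_betw_nat_finite])

text \<open>Meaningful only if \<open>card I = card S\<close>; the enumerations affect at most the sign.\<close>

definition fdet :: "'i set \<Rightarrow> 'k set \<Rightarrow> ('i \<Rightarrow> 'k \<Rightarrow> 'a :: comm_ring_1) \<Rightarrow> 'a" where
  "fdet I S a = det (mat (card I) (card I) (\<lambda>(i, j). a (enum_of I i) (enum_of S j)))"

lemma enum_of_mem: "finite S \<Longrightarrow> i < card S \<Longrightarrow> enum_of S i \<in> S"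
  using bij_enum_of[of S] by (auto simp: bij_betw_def)

lemma enum_of_inject: "finite S \<Longrightarrow> i < card S \<Longrightarrow> j < card S \<Longrightarrow> enum_of S i = enum_of S j \<longleftrightarrow> i = j"
  using bij_enum_of[of S] by (auto simp: bij_betw_def inj_on_def)

lemma fdet_cong:
  assumes "\<And>i k. i \<in> I \<Longrightarrow> k \<in> S \<Longrightarrow> a i k = b i k" "finite I" "finite S" "card S = card I"
  shows "fdet I S a = fdet I S b"
  unfolding fdet_def
  by (rule arg_cong[where f = det]) (rule eq_matI, auto intro!: assms(1) enum_of_mem assms simp: assms(4))

lemma det_mat_Leibniz:
  "det (mat n n (\<lambda>(i, j). a i j)) = (\<Sum>p | p permutes {0..<n}. signof p * (\<Prod>i<n. a i (p i)))"
proof -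
  have "p i < n" if "p permutes {0..<n}" "i < n" for p i
    using permutes_in_image[OF that(1), of i] that(2) by simp
  then show ?thesis
    by (subst det_def'[of _ n]) (auto intro!: sum.cong prod.cong simp: lessThan_atLeast0)
qed

lemma det_mat_Leibniz_rows:
  "det (mat n n (\<lambda>(i, j). a i j)) = (\<Sum>p | p permutes {0..<n}. signof p * (\<Prod>i<n. a (p i) i))"
proof -
  have "det (mat n n (\<lambda>(i, j). a i j)) = det (transpose_mat (mat n n (\<lambda>(i, j). a i j)))"
    by (rule det_transpose[symmetric, of _ n]) auto
  also have "transpose_mat (mat n n (\<lambda>(i, j). a i j)) = mat n n (\<lambda>(i, j). a j i)"
    by (rule eq_matI) auto
  finally show ?thesis by (simp add: det_mat_Leibniz)
qed

lemma det_mat_permute: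
  assumes "p permutes {0..<n}"
  shows "det (mat n n (\<lambda>(i, j). a (p i) j)) = signof p * det (mat n n (\<lambda>(i, j). a i j))"
proof -
  have "mat n n (\<lambda>(i, j). a (p i) j) = mat n n (\<lambda>(i, j). mat n n (\<lambda>(i, j). a i j) $$ (p i, j))"
    using permutes_in_image[OF assms] by (intro eq_matI) auto
  then show ?thesis using det_permute_rows[OF _ assms, of "mat n n (\<lambda>(i, j). a i j)"] by simp
qed

text \<open>Multiplying out the rows gives a sum over all maps \<open>f\<close> from row indices to
  \<open>K\<close>. Maps that are not injective vanish, since two rows of the remaining determinant
  agree; the injective ones are grouped by their image \<open>S\<close>.\<close>

lemma cauchy_binet_nat:
  fixes a b :: "nat \<Rightarrow> 'k \<Rightarrow> 'a :: comm_ring_1"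
  assumes K: "finite K"
  shows "det (mat n n (\<lambda>(i, j). \<Sum>k\<in>K. a i k * b j k)) =
    (\<Sum>S | S \<subseteq> K \<and> card S = n. det (mat n n (\<lambda>(i, j). a i (enum_of S j))) *
                                det (mat n n (\<lambda>(i, j). b i (enum_of S j))))"
proof -
  let ?F = "{0..<n} \<rightarrow>\<^sub>E K"
  let ?P = "{p. p permutes {0..<n}}"
  define g where "g f = (\<Prod>i<n. a i (f i)) * det (mat n n (\<lambda>(i, j). b j (f i)))" for f :: "nat \<Rightarrow> 'k"
  have finF: "finite ?F" using K by (simp add: finite_PiE)
  have "det (mat n n (\<lambda>(i, j). \<Sum>k\<in>K. a i k * b j k))
      = (\<Sum>p\<in>?P. signof p * (\<Sum>f\<in>?F. \<Prod>i<n. a i (f i) * b (p i) (f i)))"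
    unfolding det_mat_Leibniz
    by (intro sum.cong refl arg_cong2[where f = "(*)"])
       (simp add: lessThan_atLeast0 prod_sum_PiE K)
  also have "\<dots> = (\<Sum>f\<in>?F. \<Sum>p\<in>?P. signof p * (\<Prod>i<n. a i (f i) * b (p i) (f i)))"
    by (simp add: sum_distrib_left) (rule sum.swap)
  also have "\<dots> = (\<Sum>f\<in>?F. g f)"
    unfolding g_def det_mat_Leibniz sum_distrib_left prod.distrib
    by (intro sum.cong refl) (simp add: mult.left_commute)
  also have "\<dots> = (\<Sum>f\<in>{f\<in>?F. inj_on f {0..<n}}. g f)"
  proof (rule sum.mono_neutral_right[OF finF])
    show "\<forall>f\<in>?F - {f \<in> ?F. inj_on f {0..<n}}. g f = 0"
    proof
      fix f assume "f \<in> ?F - {f \<in> ?F. inj_on f {0..<n}}"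
      then obtain i j where ij: "i < n" "j < n" "i \<noteq> j" "f i = f j" by (auto simp: inj_on_def)
      have "det (mat n n (\<lambda>(i, j). b j (f i))) = 0"
        by (rule det_identical_rows[of _ n i j]) (use ij in auto)
      then show "g f = 0" by (simp add: g_def)
    qed
  qed auto
  also have "\<dots> = (\<Sum>S | S \<subseteq> K \<and> card S = n. \<Sum>f | f \<in> ?F \<and> inj_on f {0..<n} \<and> f ` {0..<n} = S. g f)"
    by (subst sum.group[symmetric, where g = "\<lambda>f. f ` {0..<n}" and T = "{S. S \<subseteq> K \<and> card S = n}"])
       (use finF K in \<open>auto simp: card_image intro!: sum.cong\<close>)
  also have "\<dots> = (\<Sum>S | S \<subseteq> K \<and> card S = n. det (mat n n (\<lambda>(i, j). a i (enum_of S j))) *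
                                det (mat n n (\<lambda>(i, j). b i (enum_of S j))))"
  proof (rule sum.cong[OF refl], clarsimp)
    fix S assume S: "S \<subseteq> K" and n: "n = card S"
    have e: "bij_betw (enum_of S) {0..<n} S"
      using bij_enum_of S K finite_subset unfolding n by blast
    let ?A = "{f. f \<in> ?F \<and> inj_on f {0..<n} \<and> f ` {0..<n} = S}"
    \<comment> \<open>The injections with image \<open>S\<close> are the enumeration of
      \<open>S\<close> after a permutation \<open>q\<close>. Reordering the rows of the second
      determinant yields the sign of \<open>q\<close>, and the sum over \<open>q\<close> becomes the
      Leibniz expansion of the first.\<close>
    define \<Phi> where "\<Phi> q = (\<lambda>i\<in>{0..<n}. enum_of S (q i))" for q :: "nat \<Rightarrow> nat"
    have "bij_betw \<Phi> ?P ?A"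
    proof (rule bij_betw_byWitness[where f' = "\<lambda>f i. if i < n then inv_into {0..<n} (enum_of S) (f i) else i"])
      have q: "q i < n" if "q permutes {0..<n}" "i < n" for q i
        using permutes_in_image[OF that(1), of i] that(2) by auto
      show "\<forall>q\<in>?P. (\<lambda>i. if i < n then inv_into {0..<n} (enum_of S) (\<Phi> q i) else i) = q"
        using q e by (auto simp: \<Phi>_def fun_eq_iff bij_betw_def permutes_def)
      show "\<forall>f\<in>?A. \<Phi> (\<lambda>i. if i < n then inv_into {0..<n} (enum_of S) (f i) else i) = f"
      proof safe
        fix f assume f: "f \<in> ?F" "S = f ` {0..<n}"
        show "\<Phi> (\<lambda>i. if i < n then inv_into {0..<n} (enum_of (f ` {0..<n})) (f i) else i) = f"
        proof
          fix i
          show "\<Phi> (\<lambda>i. if i < n then inv_into {0..<n} (enum_of (f ` {0..<n})) (f i) else i) i = f i"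
            using f e by (cases "i < n") (auto simp: \<Phi>_def bij_betw_def intro!: f_inv_into_f)
        qed
      qed
      show "\<Phi> ` ?P \<subseteq> ?A"
      proof (clarsimp)
        fix p assume p: "p permutes {0..<n}"
        have b: "bij_betw (enum_of S \<circ> p) {0..<n} S"
          by (rule bij_betw_trans[OF permutes_imp_bij[OF p] e])
        have "bij_betw (\<Phi> p) {0..<n} S"
          using b by (rule bij_betw_cong[THEN iffD1, rotated]) (auto simp: \<Phi>_def)
        then show "\<Phi> p \<in> ?F \<and> inj_on (\<Phi> p) {0..<n} \<and> \<Phi> p ` {0..<n} = S"
          using S by (auto simp: bij_betw_def \<Phi>_def)
      qed
      show "(\<lambda>f i. if i < n then inv_into {0..<n} (enum_of S) (f i) else i) ` ?A \<subseteq> ?P"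
      proof safe
        fix f assume f: "f \<in> ?F" "inj_on f {0..<n}" "S = f ` {0..<n}"
        have b: "bij_betw (\<lambda>i. inv_into {0..<n} (enum_of S) (f i)) {0..<n} {0..<n}"
          using bij_betw_trans[of f "{0..<n}" S, OF _ bij_betw_inv_into[OF e]] f
          by (auto simp: bij_betw_def o_def)
        then have "bij_betw (\<lambda>i. if i < n then inv_into {0..<n} (enum_of S) (f i) else i) {0..<n} {0..<n}"
          by (rule bij_betw_cong[THEN iffD1, rotated]) auto
        then show "(\<lambda>i. if i < n then inv_into {0..<n} (enum_of (f ` {0..<n})) (f i) else i) permutes {0..<n}"
          using f(3) by (intro bij_imp_permutes) auto
      qed
    qed
    then have "sum g ?A = (\<Sum>q\<in>?P. g (\<Phi> q))" by (rule sum.reindex_bij_betw[symmetric])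
    also have "\<dots> = (\<Sum>q\<in>?P. (signof q * (\<Prod>i<n. a i (enum_of S (q i)))) * det (mat n n (\<lambda>(i, j). b i (enum_of S j))))"
    proof (rule sum.cong[OF refl], clarsimp)
      fix q assume q: "q permutes {0..<n}"
      have "mat n n (\<lambda>(i, j). b j (\<Phi> q i)) = mat n n (\<lambda>(i, j). b j (enum_of S (q i)))"
        by (rule eq_matI) (auto simp: \<Phi>_def)
      then have "det (mat n n (\<lambda>(i, j). b j (\<Phi> q i))) = signof q * det (mat n n (\<lambda>(i, j). b j (enum_of S i)))"
        using det_mat_permute[OF q, of "\<lambda>i j. b j (enum_of S i)"] by simp
      also have "det (mat n n (\<lambda>(i, j). b j (enum_of S i))) = det (mat n n (\<lambda>(i, j). b i (enum_of S j)))"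
        by (simp only: det_mat_Leibniz_rows[of n "\<lambda>i j. b j (enum_of S i)"] det_mat_Leibniz[of n "\<lambda>i j. b i (enum_of S j)"])
      finally show "g (\<Phi> q) = signof q * (\<Prod>i<n. a i (enum_of S (q i))) * det (mat n n (\<lambda>(i, j). b i (enum_of S j)))"
        by (simp add: g_def \<Phi>_def mult_ac)
    qed
    also have "\<dots> = det (mat n n (\<lambda>(i, j). a i (enum_of S j))) * det (mat n n (\<lambda>(i, j). b i (enum_of S j)))"
      unfolding det_mat_Leibniz[of n "\<lambda>i j. a i (enum_of S j)"] sum_distrib_right ..
    finally show "sum g {f \<in> {0..<card S} \<rightarrow>\<^sub>E K. inj_on f {0..<card S} \<and> f ` {0..<card S} = S} =
       det (mat (card S) (card S) (\<lambda>(i, j). a i (enum_of S j))) *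
       det (mat (card S) (card S) (\<lambda>(i, j). b i (enum_of S j)))" unfolding n .
  qed
  finally show ?thesis .
qed

theorem cauchy_binet:
  assumes "finite K"
  shows "fdet I I (\<lambda>i j. \<Sum>k\<in>K. a i k * b j k) =
    (\<Sum>S | S \<subseteq> K \<and> card S = card I. fdet I S a * fdet I S b)"
  unfolding fdet_def by (rule cauchy_binet_nat[OF assms])

lemma fdet_mult:
  assumes I: "finite I" and S: "finite S" "card S = card I"
  shows "fdet I S (\<lambda>i k. \<Sum>l\<in>I. a i l * b l k) = fdet I I a * fdet I S b"
proof -
  let ?n = "card I"
  let ?A = "mat ?n ?n (\<lambda>(i, j). a (enum_of I i) (enum_of I j))"
  let ?B = "mat ?n ?n (\<lambda>(i, j). b (enum_of I i) (enum_of S j))"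
  have s: "(\<Sum>l\<in>I. a i l * b l k) = (\<Sum>l = 0..<?n. a i (enum_of I l) * b (enum_of I l) k)" for i k
    by (simp add: sum.reindex_bij_betw[OF bij_enum_of[OF I], of "\<lambda>l. a i l * b l k"])
  have "mat ?n ?n (\<lambda>(i, j). \<Sum>l\<in>I. a (enum_of I i) l * b l (enum_of S j)) = ?A * ?B"
    by (intro eq_matI) (simp_all add: scalar_prod_def s)
  then show ?thesis unfolding fdet_def by (simp add: det_mult[of _ ?n])
qed

lemma fdet_scale_columns:
  assumes "finite S" "card S = card I"
  shows "fdet I S (\<lambda>i k. c k * a i k) = (\<Prod>k\<in>S. c k) * fdet I S a"
proof -
  have c: "(\<Prod>i<card I. c (enum_of S i)) = (\<Prod>k\<in>S. c k)"
    using prod.reindex_bij_betw[OF bij_enum_of[OF assms(1)], of c] assms(2) by (simp add: lessThan_atLeast0)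
  show ?thesis
    unfolding fdet_def det_mat_Leibniz_rows prod.distrib c sum_distrib_left by (simp add: mult_ac)
qed

lemma fdet_diagonal:
  assumes "finite I"
  shows "fdet I I (\<lambda>i j. if i = j then c i else 0) = (\<Prod>i\<in>I. c i)"
proof -
  let ?M = "mat (card I) (card I) (\<lambda>(i, j). if enum_of I i = enum_of I j then c (enum_of I i) else 0)"
  have "det ?M = prod_list (diag_mat ?M)"
    by (intro Determinant.det_upper_triangular[of _ "card I"]) (auto simp: enum_of_inject[OF assms] upper_triangular_def)
  also have "\<dots> = (\<Prod>i=0..<card I. c (enum_of I i))"
    by (subst prod_list_diag_prod) auto
  also have "\<dots> = (\<Prod>i\<in>I. c i)"
    by (rule prod.reindex_bij_betw[OF bij_enum_of[OF assms]])
  finally show ?thesis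
    unfolding fdet_def .
qed

lemma fdet_of_int: "fdet I S (\<lambda>i k. of_int (a i k)) = of_int (fdet I S a)"
  unfolding fdet_def det_mat_Leibniz by simp

text \<open>The block matrix with rows \<open>(1, -A)\<close> and \<open>(B, 1)\<close> factors both
  as \<open>?X * ?L\<close> and as \<open>?L * ?Y\<close>. All three factors are block triangular
  and \<open>?L\<close> has determinant 1.\<close>

lemma det_one_plus_mult_commute:
  fixes A :: "'a :: idom mat"
  assumes A: "A \<in> carrier_mat n m" and B: "B \<in> carrier_mat m n"
  shows "det (1\<^sub>m n + A * B) = det (1\<^sub>m m + B * A)"
proof -
  let ?L = "four_block_mat (1\<^sub>m n) (0\<^sub>m n m) B (1\<^sub>m m)"
  let ?X = "four_block_mat (1\<^sub>m n + A * B) (- A) (0\<^sub>m m n) (1\<^sub>m m)"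
  let ?Y = "four_block_mat (1\<^sub>m n) (- A) (0\<^sub>m m n) (1\<^sub>m m + B * A)"
  have AB: "A * B \<in> carrier_mat n n" "B * A \<in> carrier_mat m m" using A B by auto
  have u: "- A * B = - (A * B)" "B * - A = - (B * A)"
    using A B by auto
  have "?X * ?L = four_block_mat ((1\<^sub>m n + A * B) * 1\<^sub>m n + - A * B) ((1\<^sub>m n + A * B) * 0\<^sub>m n m + - A * 1\<^sub>m m)
      (0\<^sub>m m n * 1\<^sub>m n + 1\<^sub>m m * B) (0\<^sub>m m n * 0\<^sub>m n m + 1\<^sub>m m * 1\<^sub>m m)"
    by (rule mult_four_block_mat[of _ n n _ m _ m _ _ n _ m]) (use A B in auto)
  also have "\<dots> = four_block_mat (1\<^sub>m n) (- A) B (1\<^sub>m m)"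
    using A B AB unfolding u by (intro cong_four_block_mat eq_matI) auto
  also have "\<dots> = four_block_mat (1\<^sub>m n * 1\<^sub>m n + 0\<^sub>m n m * 0\<^sub>m m n) (1\<^sub>m n * - A + 0\<^sub>m n m * (1\<^sub>m m + B * A))
      (B * 1\<^sub>m n + 1\<^sub>m m * 0\<^sub>m m n) (B * - A + 1\<^sub>m m * (1\<^sub>m m + B * A))"
    using A B AB unfolding u by (intro cong_four_block_mat eq_matI) auto
  also have "\<dots> = ?L * ?Y"
    by (rule mult_four_block_mat[of _ n n _ m _ m _ _ n _ m, symmetric]) (use A B in auto)
  finally have e: "?X * ?L = ?L * ?Y" .
  have "det (?X * ?L) = det ?X * det ?L" by (rule det_mult[of _ "n + m"]) (use A B in auto)
  moreover have "det (?L * ?Y) = det ?L * det ?Y" by (rule det_mult[of _ "n + m"]) (use A B in auto)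
  moreover have "det ?L = 1" by (subst det_four_block_mat_upper_right_zero[of _ n _ m]) (use A B in auto)
  moreover have "det ?X = det (1\<^sub>m n + A * B)"
    by (subst det_four_block_mat_lower_left_zero[of _ n _ m]) (use A B in auto)
  moreover have "det ?Y = det (1\<^sub>m m + B * A)"
    by (subst det_four_block_mat_lower_left_zero[of _ n _ m]) (use A B in auto)
  ultimately show ?thesis using e by simp
qed

text \<open>Moves the determinant of the vertex part from edges to vertices, where its dependence on
  the set of edges is monotone. With a one-element \<open>J\<close> it is the rank-one determinant
  formula.\<close>

lemma fdet_sylvester:
  fixes a :: "'i \<Rightarrow> 'j \<Rightarrow> 'a :: idom"
  assumes I: "finite I" and J: "finite J"
  shows "fdet I I (\<lambda>i i'. (if i = i' then 1 else 0) + (\<Sum>j\<in>J. a i j * b j i')) =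
         fdet J J (\<lambda>j j'. (if j = j' then 1 else 0) + (\<Sum>i\<in>I. b j i * a i j'))"
proof -
  let ?n = "card I" and ?m = "card J"
  let ?i = "enum_of I" and ?j = "enum_of J"
  let ?A = "mat ?n ?m (\<lambda>(i, j). a (?i i) (?j j))" and ?B = "mat ?m ?n (\<lambda>(j, i). b (?j j) (?i i))"
  note ei = bij_enum_of[OF I] note ej = bij_enum_of[OF J]
  note inj = enum_of_inject[OF I] enum_of_inject[OF J]
  have S: "(\<Sum>j\<in>J. a x j * b j y) = (\<Sum>j = 0..<?m. a x (?j j) * b (?j j) y)"
    "(\<Sum>i\<in>I. b z i * a i w) = (\<Sum>i = 0..<?n. b z (?i i) * a (?i i) w)" for x y z w
    by (simp_all add: sum.reindex_bij_betw[OF ej, of "\<lambda>j. a x j * b j y"]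
        sum.reindex_bij_betw[OF ei, of "\<lambda>i. b z i * a i w"])
  have L: "mat ?n ?n (\<lambda>(i, i'). (if ?i i = ?i i' then 1 else 0) + (\<Sum>j\<in>J. a (?i i) j * b j (?i i')))
      = 1\<^sub>m ?n + ?A * ?B"
    by (intro eq_matI) (simp_all add: scalar_prod_def S inj)
  have R: "mat ?m ?m (\<lambda>(j, j'). (if ?j j = ?j j' then 1 else 0) + (\<Sum>i\<in>I. b (?j j) i * a i (?j j')))
      = 1\<^sub>m ?m + ?B * ?A"
    by (intro eq_matI) (simp_all add: scalar_prod_def S inj)
  show ?thesis unfolding fdet_def L R
    by (rule det_one_plus_mult_commute) auto
qed

lemma enum_of_surj:
  assumes "finite S" "x \<in> S"
  shows "\<exists>i<card S. x = enum_of S i"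
proof -
  have "x \<in> enum_of S ` {0..<card S}"
    using bij_betw_imp_surj_on[OF bij_enum_of[OF assms(1)]] assms(2) by simp
  then show ?thesis by auto
qed

lemma inv_enum_of: "finite S \<Longrightarrow> i < card S \<Longrightarrow> inv_into {0..<card S} (enum_of S) (enum_of S i) = i"
  by (rule inv_into_f_f[OF bij_betw_imp_inj_on[OF bij_enum_of]]) auto

lemma fdet_rank_one:
  fixes s v :: "'i \<Rightarrow> 'a :: idom"
  assumes "finite I"
  shows "fdet I I (\<lambda>i j. (if i = j then 1 else 0) + s i * v j) = 1 + (\<Sum>i\<in>I. v i * s i)"
proof -
  have "fdet {()} {()} f = f () ()" for f :: "unit \<Rightarrow> unit \<Rightarrow> 'a"
    unfolding fdet_def by (subst det_single) auto
  then show ?thesis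
    using fdet_sylvester[OF assms, of "{()}" "\<lambda>i _. s i" "\<lambda>_ j. v j"] by simp
qed

lemma fdet_zero_imp_kernel:
  fixes a :: "'i \<Rightarrow> 'i \<Rightarrow> 'a :: idom"
  assumes I: "finite I" and 0: "fdet I I a = 0"
  obtains x where "\<And>i. i \<in> I \<Longrightarrow> (\<Sum>j\<in>I. a i j * x j) = 0" "\<exists>i\<in>I. x i \<noteq> 0"
proof -
  let ?n = "card I"
  let ?A = "mat ?n ?n (\<lambda>(i, j). a (enum_of I i) (enum_of I j))"
  obtain v where v: "v \<in> carrier_vec ?n" "v \<noteq> 0\<^sub>v ?n" "?A *\<^sub>v v = 0\<^sub>v ?n"
    using 0 det_0_iff_vec_prod_zero[of ?A ?n] unfolding fdet_def by auto
  note e = bij_enum_of[OF I]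
  define x where "x i = v $ inv_into {0..<?n} (enum_of I) i" for i
  have x: "x (enum_of I i) = v $ i" if "i < ?n" for i
    using that by (simp add: x_def inv_enum_of[OF I])
  show thesis
  proof
    fix i assume "i \<in> I"
    then obtain i' where i': "i' < ?n" "i = enum_of I i'" using enum_of_surj[OF I] by blast
    have "(\<Sum>j\<in>I. a i j * x j) = (\<Sum>j = 0..<?n. a i (enum_of I j) * x (enum_of I j))"
      by (rule sum.reindex_bij_betw[OF e, symmetric])
    also have "\<dots> = (?A *\<^sub>v v) $ i'"
      using i' v(1) by (auto simp: scalar_prod_def x intro!: sum.cong)
    finally show "(\<Sum>j\<in>I. a i j * x j) = 0" using i' v(3) by simp
  next
    obtain k where "k < ?n" "v $ k \<noteq> 0" using v(1,2) by (metis carrier_vecD eq_vecI index_zero_vec)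
    then show "\<exists>i\<in>I. x i \<noteq> 0"
      using x enum_of_mem[OF I] by metis
  qed
qed

lemma fdet_nonzero_solve:
  fixes a :: "'i \<Rightarrow> 'i \<Rightarrow> 'a :: field"
  assumes I: "finite I" and nz: "fdet I I a \<noteq> 0"
  obtains s where "\<And>i. i \<in> I \<Longrightarrow> (\<Sum>j\<in>I. a i j * s j) = v i"
proof -
  let ?n = "card I"
  let ?A = "mat ?n ?n (\<lambda>(i, j). a (enum_of I i) (enum_of I j))"
  let ?d = "det ?A"
  have d: "?d \<noteq> 0" using nz by (simp add: fdet_def)
  have A: "?A \<in> carrier_mat ?n ?n" by simp
  note e = bij_enum_of[OF I]
  define w where "w = vec ?n (\<lambda>i. v (enum_of I i))"
  \<comment> \<open>By the adjugate identity \<open>?A\<close> maps this vector to \<open>?d\<close>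
    times \<open>w\<close>; dividing by \<open>?d\<close> solves the system.\<close>
  define u where "u = adj_mat ?A *\<^sub>v w"
  have w: "w \<in> carrier_vec ?n" by (simp add: w_def)
  have "?A *\<^sub>v u = (?A * adj_mat ?A) *\<^sub>v w"
    unfolding u_def by (rule assoc_mult_mat_vec[symmetric, OF A adj_mat(1)[OF A] w])
  also have "\<dots> = ?d \<cdot>\<^sub>v w" unfolding adj_mat(2)[OF A]
    using w by (intro eq_vecI) (auto simp: scalar_prod_def if_distribR if_distrib cong: if_cong)
  finally have Au: "?A *\<^sub>v u = ?d \<cdot>\<^sub>v w" .
  have u: "u \<in> carrier_vec ?n" unfolding u_def using adj_mat(1)[OF A] w by simp
  define s where "s i = u $ inv_into {0..<?n} (enum_of I) i / ?d" for i
  have x: "s (enum_of I i) = u $ i / ?d" if "i < ?n" for i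
    using that by (simp add: s_def inv_enum_of[OF I])
  show thesis
  proof
    fix i assume "i \<in> I"
    then obtain i' where i': "i' < ?n" "i = enum_of I i'" using enum_of_surj[OF I] by blast
    have "(\<Sum>j\<in>I. a i j * s j) = (\<Sum>j = 0..<?n. a i (enum_of I j) * s (enum_of I j))"
      by (rule sum.reindex_bij_betw[OF e, symmetric])
    also have "\<dots> = (\<Sum>j = 0..<?n. a i (enum_of I j) * u $ j) / ?d"
      unfolding sum_divide_distrib by (intro sum.cong) (auto simp: x)
    also have "(\<Sum>j = 0..<?n. a i (enum_of I j) * u $ j) = (?A *\<^sub>v u) $ i'"
      using i' u by (auto simp: scalar_prod_def intro!: sum.cong)
    also have "\<dots> = ?d * v i" unfolding Au using i' by (simp add: w_def)
    finally show "(\<Sum>j\<in>I. a i j * s j) = v i" using d by simp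
  qed
qed

section \<open>Forms bounded below and rank-one updates of determinants\<close>

definition coercive_on :: "'i set \<Rightarrow> real \<Rightarrow> ('i \<Rightarrow> 'i \<Rightarrow> real) \<Rightarrow> bool" where
  "coercive_on I c M \<longleftrightarrow> (\<forall>x. c * (\<Sum>i\<in>I. (x i)\<^sup>2) \<le> (\<Sum>i\<in>I. \<Sum>j\<in>I. x i * M i j * x j))"

lemma rank_one_quadratic_form:
  fixes x v :: "'i \<Rightarrow> real"
  shows "(\<Sum>i\<in>I. \<Sum>j\<in>I. x i * (y * v i * v j) * x j) = y * (\<Sum>i\<in>I. v i * x i)\<^sup>2"
  by (simp add: power2_eq_square sum_product sum_distrib_left mult_ac)

lemma coercive_on_add_rank_one:
  assumes "coercive_on I c M" "y \<ge> 0"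
  shows "coercive_on I c (\<lambda>i j. M i j + y * v i * v j)"
  unfolding coercive_on_def
proof
  fix x
  have "(\<Sum>i\<in>I. \<Sum>j\<in>I. x i * (M i j + y * v i * v j) * x j)
      = (\<Sum>i\<in>I. \<Sum>j\<in>I. x i * M i j * x j) + y * (\<Sum>i\<in>I. v i * x i)\<^sup>2"
    unfolding rank_one_quadratic_form[symmetric] sum.distrib[symmetric] by (simp add: algebra_simps)
  then show "c * (\<Sum>i\<in>I. (x i)\<^sup>2) \<le> (\<Sum>i\<in>I. \<Sum>j\<in>I. x i * (M i j + y * v i * v j) * x j)"
    using assms add_increasing2[of "y * (\<Sum>i\<in>I. v i * x i)\<^sup>2"] unfolding coercive_on_def by simp
qed

lemma coercive_on_fdet_nonzero:
  assumes "finite I" "coercive_on I c M" "c > 0"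
  shows "fdet I I M \<noteq> 0"
proof
  assume "fdet I I M = 0"
  then obtain x where x: "\<And>i. i \<in> I \<Longrightarrow> (\<Sum>j\<in>I. M i j * x j) = 0" "\<exists>i\<in>I. x i \<noteq> 0"
    using fdet_zero_imp_kernel[OF assms(1), of M] by blast
  have "(\<Sum>i\<in>I. \<Sum>j\<in>I. x i * M i j * x j) = (\<Sum>i\<in>I. x i * (\<Sum>j\<in>I. M i j * x j))"
    by (simp add: sum_distrib_left mult_ac)
  then have "(\<Sum>i\<in>I. \<Sum>j\<in>I. x i * M i j * x j) = 0" using x(1) by simp
  then have "c * (\<Sum>i\<in>I. (x i)\<^sup>2) \<le> 0" using assms(2)[unfolded coercive_on_def, rule_format, of x] by simp
  moreover have "(\<Sum>i\<in>I. (x i)\<^sup>2) > 0" using x(2) assms(1) by (auto intro!: sum_pos2)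
  ultimately show False using assms(3) by (simp add: mult_le_0_iff)
qed

text \<open>Solve \<open>M s = v\<close> and let \<rho> be the product of \<open>v\<close> and
  \<open>s\<close>, which is the form of \<open>M\<close> at \<open>s\<close>. Coercivity bounds the
  squared norm of \<open>s\<close> by \<open>\<rho> / c\<close>, and Cauchy-Schwarz then bounds the
  square of \<rho> by \<rho> times the squared norm of \<open>v\<close> over \<open>c\<close>. The
  same \<rho> serves all \<open>y\<close>.\<close>

lemma fdet_rank_one_update:
  fixes M :: "'i \<Rightarrow> 'i \<Rightarrow> real"
  assumes I: "finite I" and M: "coercive_on I c M" and c: "c > 0"
  obtains \<rho> where "0 \<le> \<rho>" "\<rho> \<le> (\<Sum>i\<in>I. (v i)\<^sup>2) / c"
    "\<And>y. fdet I I (\<lambda>i j. M i j + y * v i * v j) = fdet I I M * (1 + y * \<rho>)"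
proof -
  obtain s where s: "\<And>i. i \<in> I \<Longrightarrow> (\<Sum>j\<in>I. M i j * s j) = v i"
    by (rule fdet_nonzero_solve[OF I coercive_on_fdet_nonzero[OF I M c], where v = v]) (rule that)
  define \<rho> where "\<rho> = (\<Sum>i\<in>I. v i * s i)"
  have "(\<Sum>i\<in>I. \<Sum>j\<in>I. s i * M i j * s j) = (\<Sum>i\<in>I. s i * (\<Sum>j\<in>I. M i j * s j))"
    by (simp add: sum_distrib_left mult_ac)
  also have "\<dots> = \<rho>" unfolding \<rho>_def using s by (intro sum.cong) (auto simp: mult_ac)
  finally have le: "c * (\<Sum>i\<in>I. (s i)\<^sup>2) \<le> \<rho>" using M[unfolded coercive_on_def, rule_format, of s] by simp
  have nn: "\<rho> \<ge> 0" using order_trans[OF _ le, of 0] c by (simp add: sum_nonneg)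
  have "\<rho>\<^sup>2 \<le> (\<Sum>i\<in>I. (v i)\<^sup>2) * (\<Sum>i\<in>I. (s i)\<^sup>2)"
    unfolding \<rho>_def by (rule Cauchy_Schwarz_ineq_sum)
  also have "\<dots> \<le> (\<Sum>i\<in>I. (v i)\<^sup>2) * (\<rho> / c)"
    using le c by (intro mult_left_mono) (auto simp: field_simps sum_nonneg)
  finally have sq: "\<rho> * \<rho> \<le> ((\<Sum>i\<in>I. (v i)\<^sup>2) / c) * \<rho>" by (simp add: power2_eq_square)
  have ub: "\<rho> \<le> (\<Sum>i\<in>I. (v i)\<^sup>2) / c"
  proof (cases "\<rho> = 0")
    case False
    then show ?thesis using mult_right_le_imp_le[OF sq] nn by simp
  qed (use c in \<open>simp add: sum_nonneg\<close>)
  show thesis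
  proof (rule that[OF nn ub])
    fix y
    have "fdet I I (\<lambda>i j. M i j + y * v i * v j)
        = fdet I I (\<lambda>i j. \<Sum>l\<in>I. M i l * ((if l = j then 1 else 0) + (y * s l) * v j))"
    proof (rule fdet_cong[OF _ I I refl])
      fix i j assume ij: "i \<in> I" "j \<in> I"
      have "(\<Sum>l\<in>I. M i l * ((if l = j then 1 else 0) + (y * s l) * v j))
          = (\<Sum>l\<in>I. M i l * (if l = j then 1 else 0)) + (\<Sum>l\<in>I. M i l * s l) * y * v j"
        by (simp add: algebra_simps sum.distrib sum_distrib_left)
      then show "M i j + y * v i * v j = (\<Sum>l\<in>I. M i l * ((if l = j then 1 else 0) + (y * s l) * v j))"
        using ij I s by (simp add: mult_ac if_distrib[of "(*) _"] cong: if_cong)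
    qed
    also have "\<dots> = fdet I I M * (1 + (\<Sum>i\<in>I. v i * (y * s i)))"
      unfolding fdet_mult[OF I I refl] fdet_rank_one[OF I, of "\<lambda>l. y * s l"] ..
    also have "(\<Sum>i\<in>I. v i * (y * s i)) = y * \<rho>"
      unfolding \<rho>_def sum_distrib_left by (simp add: mult_ac)
    finally show "fdet I I (\<lambda>i j. M i j + y * v i * v j) = fdet I I M * (1 + y * \<rho>)" .
  qed
qed

text \<open>The vectors are added one at a time. Nonnegative rank-one terms preserve the constant
  \<open>c\<close>, so every step contributes a factor with the same bound; coercivity is therefore
  carried along in the induction.\<close>

lemma fdet_rank_one_updates:
  fixes M :: "'i \<Rightarrow> 'i \<Rightarrow> real"
  assumes I: "finite I" and M: "coercive_on I c M" and c: "c > 0" and F: "finite F" and y: "y \<ge> 0"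
    and b: "\<And>k. k \<in> F \<Longrightarrow> (\<Sum>i\<in>I. (v k i)\<^sup>2) \<le> b"
  shows "\<exists>r. 1 \<le> r \<and> r \<le> (1 + y * b / c) ^ card F \<and>
    fdet I I (\<lambda>i j. M i j + (\<Sum>k\<in>F. y * v k i * v k j)) = fdet I I M * r"
proof -
  have "coercive_on I c (\<lambda>i j. M i j + (\<Sum>k\<in>F. y * v k i * v k j)) \<and> (\<exists>r. 1 \<le> r \<and> r \<le> (1 + y * b / c) ^ card F \<and>
    fdet I I (\<lambda>i j. M i j + (\<Sum>k\<in>F. y * v k i * v k j)) = fdet I I M * r)"
    using F b
  proof (induction F)
    case empty
    then show ?case using M by (auto intro!: exI[of _ 1])
  next
    case (insert k F)
    let ?M = "\<lambda>i j. M i j + (\<Sum>k\<in>F. y * v k i * v k j)"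
    have e: "(\<lambda>i j. M i j + (\<Sum>k\<in>insert k F. y * v k i * v k j)) = (\<lambda>i j. ?M i j + y * v k i * v k j)"
      using insert.hyps by (auto simp: fun_eq_iff)
    obtain r where r: "coercive_on I c ?M" "1 \<le> r" "r \<le> (1 + y * b / c) ^ card F" "fdet I I ?M = fdet I I M * r"
      using insert by auto
    obtain \<rho> where \<rho>: "0 \<le> \<rho>" "\<rho> \<le> (\<Sum>i\<in>I. (v k i)\<^sup>2) / c"
      "\<And>y. fdet I I (\<lambda>i j. ?M i j + y * v k i * v k j) = fdet I I ?M * (1 + y * \<rho>)"
      by (rule fdet_rank_one_update[OF I r(1) c, where v = "v k"]) (rule that)
    have "\<rho> \<le> b / c" using order_trans[OF \<rho>(2), of "b / c"] insert.prems[of k] c by (simp add: divide_right_mono)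
    then have "1 + y * \<rho> \<le> 1 + y * b / c" using y mult_left_mono by fastforce
    moreover have "1 \<le> 1 + y * \<rho>" using y \<rho> by simp
    ultimately have "1 * 1 \<le> r * (1 + y * \<rho>)" "r * (1 + y * \<rho>) \<le> (1 + y * b / c) ^ card F * (1 + y * b / c)"
      using r(2,3) by (intro mult_mono; simp)+
    then show ?case
      unfolding e using insert.hyps \<rho>(3) r(4) coercive_on_add_rank_one[OF r(1) y]
      by (auto intro!: exI[of _ "r * (1 + y * \<rho>)"] simp: mult_ac)
  qed
  then show ?thesis by blast
qed

text \<open>The weight is attached to only one of the two factors in the Cauchy-Binet formula, so
  that each column contributes it once.\<close>

lemma fdet_gram:
  fixes v :: "'k \<Rightarrow> 'i \<Rightarrow> 'a :: comm_ring_1"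
  assumes "finite K"
  shows "fdet I I (\<lambda>i j. \<Sum>k\<in>K. c k * v k i * v k j) =
    (\<Sum>S | S \<subseteq> K \<and> card S = card I. (\<Prod>k\<in>S. c k) * (fdet I S (\<lambda>i k. v k i))\<^sup>2)"
proof -
  have "fdet I I (\<lambda>i j. \<Sum>k\<in>K. c k * v k i * v k j) = (\<Sum>S | S \<subseteq> K \<and> card S = card I.
      fdet I S (\<lambda>i k. c k * v k i) * fdet I S (\<lambda>i k. v k i))"
    by (rule cauchy_binet[OF assms])
  also have "\<dots> = (\<Sum>S | S \<subseteq> K \<and> card S = card I. (\<Prod>k\<in>S. c k) * (fdet I S (\<lambda>i k. v k i))\<^sup>2)"
    by (rule sum.cong[OF refl])
       (use assms in \<open>auto simp: fdet_scale_columns finite_subset power2_eq_square mult_ac\<close>)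
  finally show ?thesis .
qed

text \<open>By Cauchy-Binet both sides are sums of squares of minors, and a larger index set only
  adds summands.\<close>

lemma fdet_gram_mono:
  fixes v :: "'k \<Rightarrow> 'i \<Rightarrow> real"
  assumes "finite K'" "K \<subseteq> K'"
  shows "fdet I I (\<lambda>i j. \<Sum>k\<in>K. v k i * v k j) \<le> fdet I I (\<lambda>i j. \<Sum>k\<in>K'. v k i * v k j)"
proof -
  have "finite K" using assms finite_subset by blast
  then show ?thesis
    using fdet_gram[of K I "\<lambda>_. 1" v] fdet_gram[OF assms(1), of I "\<lambda>_. 1" v] assms
    by (auto intro!: sum_mono2)
qed

section \<open>Index of a full sublattice\<close>

text \<open>Vectors are total functions of which only the coordinates in \<open>I\<close> are
  tested.\<close>

definition in_lattice :: "'i set \<Rightarrow> 'k set \<Rightarrow> ('i \<Rightarrow> 'k \<Rightarrow> int) \<Rightarrow> ('i \<Rightarrow> int) \<Rightarrow> bool" where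
  "in_lattice I S a x \<longleftrightarrow> (\<exists>z. \<forall>i\<in>I. x i = (\<Sum>k\<in>S. a i k * z k))"

text \<open>One representative for each coset of the lattice. Since functions agreeing on
  \<open>I\<close> lie in the same coset, the size of \<open>R\<close> is the index of the lattice
  in the integer vectors over \<open>I\<close>.\<close>

definition transversal :: "'i set \<Rightarrow> 'k set \<Rightarrow> ('i \<Rightarrow> 'k \<Rightarrow> int) \<Rightarrow> ('i \<Rightarrow> int) set \<Rightarrow> bool" where
  "transversal I S a R \<longleftrightarrow> (\<forall>x. \<exists>!r. r \<in> R \<and> in_lattice I S a (\<lambda>i. x i - r i))"

lemma transversalE:
  assumes "transversal I S a R"
  obtains r where "r \<in> R" "in_lattice I S a (\<lambda>i. x i - r i)"
    "\<And>r'. r' \<in> R \<Longrightarrow> in_lattice I S a (\<lambda>i. x i - r' i) \<Longrightarrow> r' = r"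
proof -
  from assms have "\<exists>!r. r \<in> R \<and> in_lattice I S a (\<lambda>i. x i - r i)"
    unfolding transversal_def by (rule spec)
  then show ?thesis by (elim ex1E conjE) (rule that, assumption, assumption, simp)
qed

abbreviation ndet :: "nat \<Rightarrow> (nat \<Rightarrow> nat \<Rightarrow> int) \<Rightarrow> int" where
  "ndet n a \<equiv> det (mat n n (\<lambda>(i, j). a i j))"

lemma ndet_zero_row:
  assumes "k < n" "\<And>j. j < n \<Longrightarrow> a k j = 0"
  shows "ndet n a = 0"
  unfolding det_mat_Leibniz
proof (rule sum.neutral, clarify)
  fix p assume p: "p permutes {0..<n}"
  have "a k (p k) = 0" using assms permutes_in_image[OF p, of k] by simp
  then have "(\<Prod>i<n. a i (p i)) = 0" using assms(1) by (intro prod_zero) auto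
  then show "signof p * (\<Prod>i<n. a i (p i)) = 0" by simp
qed

lemma ndet_swap_columns:
  assumes "j < n" "k < n"
  shows "\<bar>ndet n (\<lambda>i l. a i (Transposition.transpose j k l))\<bar> = \<bar>ndet n a\<bar>"
proof -
  have p: "Transposition.transpose j k permutes {0..<n}" using assms by (intro permutes_swap_id) auto
  have "ndet n (\<lambda>i l. a i (Transposition.transpose j k l)) = ndet n (\<lambda>i l. a l (Transposition.transpose j k i))"
    by (simp only: det_mat_Leibniz_rows[of n "\<lambda>i l. a l (Transposition.transpose j k i)"] det_mat_Leibniz[of n "\<lambda>i l. a i (Transposition.transpose j k l)"])
  also have "\<dots> = signof (Transposition.transpose j k) * ndet n (\<lambda>i l. a l i)"
    by (rule det_mat_permute[OF p])
  also have "ndet n (\<lambda>i l. a l i) = ndet n a"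
    by (simp only: det_mat_Leibniz_rows[of n "\<lambda>i l. a l i"] det_mat_Leibniz[of n a])
  finally show ?thesis by (simp add: abs_mult sign_def)
qed

lemma ndet_add_column:
  assumes "j < n" "k < n" "j \<noteq> k"
  shows "ndet n (\<lambda>i l. if l = k then a i k + m * a i j else a i l) = ndet n a"
proof -
  have "mat n n (\<lambda>(i, l). if l = k then a i k + m * a i j else a i l) = addcol m k j (mat n n (\<lambda>(i, l). a i l))"
    using assms by (intro eq_matI) auto
  then show ?thesis using det_addcol[of j n k "mat n n (\<lambda>(i, l). a i l)" m] assms by simp
qed

lemma ndet_Suc_last_row:
  assumes "\<And>j. j < n \<Longrightarrow> a n j = 0"
  shows "ndet (Suc n) a = ndet n a * a n n"
proof -
  have "mat (Suc n) (Suc n) (\<lambda>(i, j). a i j) = four_block_mat (mat n n (\<lambda>(i, j). a i j))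
     (mat n 1 (\<lambda>(i, j). a i n)) (0\<^sub>m 1 n) (mat 1 1 (\<lambda>_. a n n))"
    using assms by (intro eq_matI) (auto simp: less_Suc_eq not_less)
  then show ?thesis
    by (simp add: det_four_block_mat_lower_left_zero[of _ n _ 1] det_single)
qed

lemma in_lattice_swap_columns:
  fixes n :: nat
  assumes "j < n" "k < n"
  shows "in_lattice I {..<n} (\<lambda>i l. a i (Transposition.transpose j k l)) x = in_lattice I {..<n} a x"
proof -
  have b: "bij_betw (Transposition.transpose j k) {..<n} {..<n}"
    using assms by (intro permutes_imp_bij permutes_swap_id) auto
  have s: "(\<Sum>l<n. a i (Transposition.transpose j k l) * z l) = (\<Sum>l<n. a i l * z (Transposition.transpose j k l))" for i z
    using sum.reindex_bij_betw[OF b, of "\<lambda>l. a i l * z (Transposition.transpose j k l)"] by simp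
  show ?thesis
    unfolding in_lattice_def
  proof safe
    fix z assume "\<forall>i\<in>I. x i = (\<Sum>l<n. a i (Transposition.transpose j k l) * z l)"
    then show "\<exists>z. \<forall>i\<in>I. x i = (\<Sum>l<n. a i l * z l)"
      unfolding s by (intro exI[of _ "\<lambda>l. z (Transposition.transpose j k l)"])
  next
    fix z assume "\<forall>i\<in>I. x i = (\<Sum>l<n. a i l * z l)"
    then show "\<exists>z. \<forall>i\<in>I. x i = (\<Sum>l<n. a i (Transposition.transpose j k l) * z l)"
      unfolding s by (intro exI[of _ "\<lambda>l. z (Transposition.transpose j k l)"]) simp
  qed
qed

lemma in_lattice_add_column:
  fixes n :: nat
  assumes "j < n" "k < n" "j \<noteq> k"
  shows "in_lattice I {..<n} (\<lambda>i l. if l = k then a i k + m * a i j else a i l) x = in_lattice I {..<n} a x"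
proof -
  have s: "(\<Sum>l<n. (if l = k then a i k + m * a i j else a i l) * z l) =
      (\<Sum>l<n. a i l * (z(j := z j + m * z k)) l)" for i z
  proof -
    have "(\<Sum>l<n. (if l = k then a i k + m * a i j else a i l) * z l)
        = (\<Sum>l<n. a i l * z l + (if l = k then m * a i j * z k else 0))"
      by (intro sum.cong) (auto simp: algebra_simps)
    also have "\<dots> = (\<Sum>l<n. a i l * z l) + m * a i j * z k"
      using assms(2) by (simp add: sum.distrib)
    also have "\<dots> = (\<Sum>l<n. a i l * z l + (if l = j then a i j * (m * z k) else 0))"
      using assms(1) by (simp add: sum.distrib mult_ac)
    also have "\<dots> = (\<Sum>l<n. a i l * (z(j := z j + m * z k)) l)"
      by (intro sum.cong) (auto simp: algebra_simps)
    finally show ?thesis .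
  qed
  show ?thesis
    unfolding in_lattice_def
  proof safe
    fix z assume "\<forall>i\<in>I. x i = (\<Sum>l<n. (if l = k then a i k + m * a i j else a i l) * z l)"
    then show "\<exists>z. \<forall>i\<in>I. x i = (\<Sum>l<n. a i l * z l)"
      unfolding s by (intro exI[of _ "z(j := z j + m * z k)"])
  next
    fix z assume z: "\<forall>i\<in>I. x i = (\<Sum>l<n. a i l * z l)"
    let ?z = "z(j := z j - m * z k)"
    have zz: "?z(j := ?z j + m * ?z k) = z" using assms(3) by auto
    then show "\<exists>z. \<forall>i\<in>I. x i = (\<Sum>l<n. (if l = k then a i k + m * a i j else a i l) * z l)"
      unfolding s using z by (intro exI[of _ ?z]) (simp only: zz)
  qed
qed

text \<open>Column operations change neither the lattice nor the absolute value of the determinant.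
  Euclid's algorithm on the last row, which decreases the sum of its absolute values, leaves one
  nonzero entry; a swap moves it to the corner. Representatives are then pairs of a representative
  in dimension \<open>n\<close> and a residue modulo the corner entry.\<close>

lemma transversal_nat:
  "ndet n a \<noteq> 0 \<Longrightarrow> \<exists>R. finite R \<and> int (card R) = \<bar>ndet n a\<bar> \<and> transversal {..<n} {..<n} a R"
proof (induction n arbitrary: a)
  case 0
  show ?case by (rule exI[of _ "{\<lambda>_. 0}"]) (auto simp: transversal_def in_lattice_def)
next
  case (Suc n)
  let ?I = "{..<Suc n}"
  let ?goal = "\<lambda>a. \<exists>R. finite R \<and> int (card R) = \<bar>ndet (Suc n) a\<bar> \<and> transversal ?I ?I a R"
  have last: "?goal a" if nz: "ndet (Suc n) a \<noteq> 0" and 0: "\<And>j. j < n \<Longrightarrow> a n j = 0" for a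
  proof -
    have d: "ndet (Suc n) a = ndet n a * a n n" by (rule ndet_Suc_last_row) (rule 0)
    let ?g = "a n n"
    have g: "?g \<noteq> 0" and "ndet n a \<noteq> 0" using nz d by auto
    then obtain R where R: "finite R" "int (card R) = \<bar>ndet n a\<bar>" "transversal {..<n} {..<n} a R"
      using Suc.IH by blast
    define f where "f = (\<lambda>(r :: nat \<Rightarrow> int, \<rho>). r(n := \<rho>))"
    let ?P = "R \<times> {0..<\<bar>?g\<bar>}"
    \<comment> \<open>The last coordinate determines the coefficient \<open>q\<close> of the last
      column; subtracting that multiple leaves a membership question in dimension
      \<open>n\<close>.\<close>
    have mem: "in_lattice ?I ?I a (\<lambda>i. x i - (r(n := \<rho>)) i) \<longleftrightarrow>
        (\<exists>q. x n - \<rho> = ?g * q \<and> in_lattice {..<n} {..<n} a (\<lambda>i. (x i - a i n * q) - r i))" for x r \<rho>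
    proof
      assume "in_lattice ?I ?I a (\<lambda>i. x i - (r(n := \<rho>)) i)"
      then obtain z where z: "\<And>i. i < Suc n \<Longrightarrow> x i - (r(n := \<rho>)) i = (\<Sum>k<n. a i k * z k) + a i n * z n"
        unfolding in_lattice_def by auto
      have "x n - \<rho> = ?g * z n" using z[of n] 0 by simp
      moreover have "(x i - a i n * z n) - r i = (\<Sum>k<n. a i k * z k)" if "i < n" for i
        using z[of i] that by (simp add: algebra_simps)
      ultimately show "\<exists>q. x n - \<rho> = ?g * q \<and> in_lattice {..<n} {..<n} a (\<lambda>i. (x i - a i n * q) - r i)"
        unfolding in_lattice_def by blast
    next
      assume "\<exists>q. x n - \<rho> = ?g * q \<and> in_lattice {..<n} {..<n} a (\<lambda>i. (x i - a i n * q) - r i)"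
      then obtain q z where q: "x n - \<rho> = ?g * q"
        and z: "\<And>i. i < n \<Longrightarrow> (x i - a i n * q) - r i = (\<Sum>k<n. a i k * z k)"
        unfolding in_lattice_def by auto
      have "x i - (r(n := \<rho>)) i = (\<Sum>k<n. a i k * (z(n := q)) k) + a i n * q" if "i < Suc n" for i
        using q z[of i] 0 that by (cases "i = n") auto
      then show "in_lattice ?I ?I a (\<lambda>i. x i - (r(n := \<rho>)) i)"
        unfolding in_lattice_def by (intro exI[of _ "z(n := q)"]) auto
    qed
    \<comment> \<open>The corner entry may be negative, so residues are taken modulo its absolute
      value and the quotient is recovered by exact division.\<close>
    have uniq: "\<rho> = x mod \<bar>?g\<bar> \<and> q = (x - x mod \<bar>?g\<bar>) div ?g" if "x - \<rho> = ?g * q" "0 \<le> \<rho>" "\<rho> < \<bar>?g\<bar>" for x \<rho> q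
    proof -
      have "x = \<rho> + \<bar>?g\<bar> * (sgn ?g * q)" using that(1) by (simp add: mult.assoc[symmetric] abs_mult_sgn)
      then have \<rho>: "\<rho> = x mod \<bar>?g\<bar>" using that(2,3) by simp
      moreover have "q = (x - \<rho>) div ?g" using that(1) g by simp
      ultimately show ?thesis by simp
    qed
    have dvd: "?g dvd x - x mod \<bar>?g\<bar>" for x
      by (metis abs_dvd_iff dvd_minus_mod)
    have inj: "inj_on f ?P"
    proof (rule inj_onI, clarsimp simp: f_def)
      fix r \<rho> r' \<rho>' assume r: "r \<in> R" "r' \<in> R" and e: "r(n := \<rho>) = r'(n := \<rho>')"
      have "in_lattice {..<n} {..<n} a (\<lambda>i. r i - r i)" "in_lattice {..<n} {..<n} a (\<lambda>i. r i - r' i)"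
        using fun_cong[OF e] unfolding in_lattice_def
        by (auto intro!: exI[of _ "\<lambda>_. 0"]) (metis diff_self fun_upd_other less_irrefl)
      then have "r = r'" using R(3) r unfolding transversal_def by blast
      moreover have "\<rho> = \<rho>'" using fun_cong[OF e, of n] by simp
      ultimately show "r = r' \<and> \<rho> = \<rho>'" by simp
    qed
    have "transversal ?I ?I a (f ` ?P)"
      unfolding transversal_def
    proof
      fix x :: "nat \<Rightarrow> int"
      define \<rho> where "\<rho> = x n mod \<bar>?g\<bar>"
      define q where "q = (x n - \<rho>) div ?g"
      have q: "x n - \<rho> = ?g * q" using dvd[of "x n"] by (simp add: q_def \<rho>_def)
      have \<rho>: "\<rho> \<in> {0..<\<bar>?g\<bar>}" using g by (simp add: \<rho>_def)
      obtain r where r: "r \<in> R" "in_lattice {..<n} {..<n} a (\<lambda>i. (x i - a i n * q) - r i)"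
        and ru: "\<And>r'. r' \<in> R \<Longrightarrow> in_lattice {..<n} {..<n} a (\<lambda>i. (x i - a i n * q) - r' i) \<Longrightarrow> r' = r"
        by (rule transversalE[OF R(3), of "\<lambda>i. x i - a i n * q"]) (rule that)
      show "\<exists>!s. s \<in> f ` ?P \<and> in_lattice ?I ?I a (\<lambda>i. x i - s i)"
      proof (rule ex1I[of _ "r(n := \<rho>)"])
        show "r(n := \<rho>) \<in> f ` ?P \<and> in_lattice ?I ?I a (\<lambda>i. x i - (r(n := \<rho>)) i)"
          using r \<rho> q mem[of x r \<rho>] by (auto simp: f_def intro!: image_eqI[of _ _ "(r, \<rho>)"])
      next
        fix s assume s: "s \<in> f ` ?P \<and> in_lattice ?I ?I a (\<lambda>i. x i - s i)"
        then obtain r' \<rho>' where s': "s = r'(n := \<rho>')" "r' \<in> R" "0 \<le> \<rho>'" "\<rho>' < \<bar>?g\<bar>" by (auto simp: f_def)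
        obtain q' where q': "x n - \<rho>' = ?g * q'" "in_lattice {..<n} {..<n} a (\<lambda>i. (x i - a i n * q') - r' i)"
          using s mem[of x r' \<rho>'] s'(1) by auto
        have "\<rho>' = \<rho>" "q' = q" using uniq[OF q'(1) s'(3,4)] by (simp_all add: \<rho>_def q_def)
        then show "s = r(n := \<rho>)" using ru[OF s'(2)] q'(2) s'(1) by simp
      qed
    qed
    moreover have "int (card (f ` ?P)) = \<bar>ndet (Suc n) a\<bar>"
      using R(2) by (simp add: card_image[OF inj] card_cartesian_product d abs_mult)
    ultimately show ?thesis using R(1) by (intro exI[of _ "f ` ?P"]) auto
  qed
  show ?case using Suc.prems
  proof (induction "\<Sum>j<Suc n. nat \<bar>a n j\<bar>" arbitrary: a rule: less_induct)
    case less
    consider (two) j k where "j < Suc n" "k < Suc n" "j \<noteq> k" "a n j \<noteq> 0" "\<bar>a n j\<bar> \<le> \<bar>a n k\<bar>"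
      | (one) j where "j < Suc n" "\<And>k. k < Suc n \<Longrightarrow> k \<noteq> j \<Longrightarrow> a n k = 0"
    proof -
      have "\<exists>j<Suc n. a n j \<noteq> 0"
      proof (rule ccontr)
        assume "\<not> ?thesis"
        then have "ndet (Suc n) a = 0" by (intro ndet_zero_row[of n]) auto
        then show False using less.prems by simp
      qed
      then obtain j where j: "j < Suc n" "a n j \<noteq> 0" by blast
      show thesis
      proof (cases "\<exists>k<Suc n. k \<noteq> j \<and> a n k \<noteq> 0")
        case True
        then obtain k where "k < Suc n" "k \<noteq> j" "a n k \<noteq> 0" by blast
        then show thesis using j two[of j k] two[of k j] by (metis linear)
      next
        case False
        then show thesis using j one[of j] by blast
      qed
    qed
    then show ?case
    proof cases
      case two
      \<comment> \<open>The sign that reduces the larger entry: \<open>\<bar>a n k\<bar>\<close>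
        drops by \<open>\<bar>a n j\<bar>\<close>, which is positive.\<close>
      define m where "m = - sgn (a n j) * sgn (a n k)"
      let ?a = "\<lambda>i l. if l = k then a i k + m * a i j else a i l"
      have "\<bar>a n k + m * a n j\<bar> < \<bar>a n k\<bar>"
        using two(4,5) unfolding m_def by (auto simp: sgn_if split: if_splits)
      then have lt: "(\<Sum>l<Suc n. nat \<bar>?a n l\<bar>) < (\<Sum>l<Suc n. nat \<bar>a n l\<bar>)"
        using two(2) by (intro sum_strict_mono_ex1) auto
      have d: "ndet (Suc n) ?a = ndet (Suc n) a" by (rule ndet_add_column[OF two(1,2,3)])
      have "ndet (Suc n) ?a \<noteq> 0" unfolding d by (rule less.prems)
      with lt have "?goal ?a" by (rule less.hyps[of ?a])
      then show ?thesis unfolding d transversal_def in_lattice_add_column[OF two(1,2,3)] .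
    next
      case one
      let ?a = "\<lambda>i l. a i (Transposition.transpose j n l)"
      have d: "\<bar>ndet (Suc n) ?a\<bar> = \<bar>ndet (Suc n) a\<bar>" by (rule ndet_swap_columns) (use one in auto)
      have "?goal ?a"
      proof (rule last)
        show "ndet (Suc n) ?a \<noteq> 0" using d less.prems by auto
        fix l assume "l < n"
        then show "a n (Transposition.transpose j n l) = 0" using one by (cases "l = j") (auto simp: transpose_def)
      qed
      then show ?thesis
        unfolding d transversal_def in_lattice_swap_columns[OF one(1) lessI] .
    qed
  qed
qed

lemma in_lattice_enum:
  assumes I: "finite I" and S: "finite S" "card S = card I"
  shows "in_lattice I S a x \<longleftrightarrow>
    in_lattice {..<card I} {..<card I} (\<lambda>i j. a (enum_of I i) (enum_of S j)) (\<lambda>i. x (enum_of I i))"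
proof -
  let ?n = "card I"
  have eI: "bij_betw (enum_of I) {..<?n} I" and eS: "bij_betw (enum_of S) {..<?n} S"
    using bij_enum_of[OF I] bij_enum_of[OF S(1)] S(2) by (simp_all add: lessThan_atLeast0)
  have s: "(\<Sum>k\<in>S. a i k * z k) = (\<Sum>k<?n. a i (enum_of S k) * z (enum_of S k))" for i z
    by (rule sum.reindex_bij_betw[OF eS, symmetric])
  show ?thesis
    unfolding in_lattice_def
  proof safe
    fix z assume "\<forall>i\<in>I. x i = (\<Sum>k\<in>S. a i k * z k)"
    then show "\<exists>z. \<forall>i\<in>{..<?n}. x (enum_of I i) = (\<Sum>k<?n. a (enum_of I i) (enum_of S k) * z k)"
      unfolding s using enum_of_mem[OF I] by (intro exI[of _ "\<lambda>k. z (enum_of S k)"]) auto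
  next
    fix z assume z: "\<forall>i\<in>{..<?n}. x (enum_of I i) = (\<Sum>k<?n. a (enum_of I i) (enum_of S k) * z k)"
    let ?z = "\<lambda>k. z (inv_into {..<?n} (enum_of S) k)"
    have A: "(\<Sum>k<?n. a i (enum_of S k) * ?z (enum_of S k)) = (\<Sum>k<?n. a i (enum_of S k) * z k)" for i
      using eS by (intro sum.cong) (auto simp: bij_betw_def)
    show "\<exists>z. \<forall>i\<in>I. x i = (\<Sum>k\<in>S. a i k * z k)"
      unfolding s
    proof (intro exI[of _ ?z] ballI)
      fix i assume "i \<in> I"
      then obtain i' where "i' < ?n" "i = enum_of I i'" using eI by (force simp: bij_betw_def)
      then show "x i = (\<Sum>k<?n. a i (enum_of S k) * ?z (enum_of S k))"
        unfolding A using z by simp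
    qed
  qed
qed

text \<open>This is what turns the order of the first homology group into the absolute value of a
  determinant.\<close>

theorem lattice_transversal:
  assumes I: "finite I" and S: "finite S" "card S = card I" and nz: "fdet I S a \<noteq> 0"
  obtains R where "finite R" "int (card R) = \<bar>fdet I S a\<bar>" "transversal I S a R"
proof -
  let ?n = "card I"
  let ?a = "\<lambda>i j. a (enum_of I i) (enum_of S j)"
  have eI: "bij_betw (enum_of I) {..<?n} I" using bij_enum_of[OF I] by (simp add: lessThan_atLeast0)
  obtain R where R: "finite R" "int (card R) = \<bar>fdet I S a\<bar>" "transversal {..<?n} {..<?n} ?a R"
    using transversal_nat[of ?n ?a] nz unfolding fdet_def by auto
  define f where "f r = (\<lambda>i. r (inv_into {..<?n} (enum_of I) i))" for r :: "nat \<Rightarrow> int"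
  have f: "f r (enum_of I i) = r i" if "i < ?n" for r i
    using eI that by (simp add: f_def bij_betw_def)
  have mem: "in_lattice I S a (\<lambda>i. x i - f r i) \<longleftrightarrow> in_lattice {..<?n} {..<?n} ?a (\<lambda>i. x (enum_of I i) - r i)" for x r
    by (subst in_lattice_enum[OF I S]) (auto simp: in_lattice_def f)
  have inj: "inj_on f R"
  proof (rule inj_onI)
    fix r r' assume r: "r \<in> R" "r' \<in> R" and e: "f r = f r'"
    have "in_lattice {..<?n} {..<?n} ?a (\<lambda>i. r i - r i)" "in_lattice {..<?n} {..<?n} ?a (\<lambda>i. r i - r' i)"
      using f[of _ r] f[of _ r'] e unfolding in_lattice_def by (auto intro!: exI[of _ "\<lambda>_. 0"])
    then show "r = r'" using R(3) r unfolding transversal_def by blast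
  qed
  show thesis
  proof (rule that[of "f ` R"])
    show "transversal I S a (f ` R)"
      unfolding transversal_def
    proof
      fix x
      obtain r where r: "r \<in> R" "in_lattice {..<?n} {..<?n} ?a (\<lambda>i. x (enum_of I i) - r i)"
        and u: "\<And>r'. r' \<in> R \<Longrightarrow> in_lattice {..<?n} {..<?n} ?a (\<lambda>i. x (enum_of I i) - r' i) \<Longrightarrow> r' = r"
        by (rule transversalE[OF R(3), of "\<lambda>i. x (enum_of I i)"]) (rule that)
      show "\<exists>!r. r \<in> f ` R \<and> in_lattice I S a (\<lambda>i. x i - r i)"
      proof (rule ex1I[of _ "f r"])
        show "f r \<in> f ` R \<and> in_lattice I S a (\<lambda>i. x i - f r i)" using r mem[of x r] by simp
      next
        fix s assume s: "s \<in> f ` R \<and> in_lattice I S a (\<lambda>i. x i - s i)"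
        then obtain r' where r': "r' \<in> R" "s = f r'" by blast
        then show "s = f r" using s u[OF r'(1)] mem[of x r'] by simp
      qed
    qed
  qed (use R inj in \<open>auto simp: card_image\<close>)
qed

section \<open>Tails of the limit laws\<close>

text \<open>The q-Pochhammer symbol (q; q)_k at q = 1/2.\<close>

definition qpoch :: "nat \<Rightarrow> real" where
  "qpoch k = (\<Prod>j<k. 1 - 1 / 2 ^ Suc j)"

definition qpoch_inf :: real where
  "qpoch_inf = prodinf (\<lambda>j. 1 - 1 / 2 ^ Suc j)"

lemma qpoch_Suc: "qpoch (Suc k) = qpoch k * (1 - 1 / 2 ^ Suc k)"
  by (simp add: qpoch_def)

lemma qpoch_lower: "qpoch k \<ge> 1 / 4"
proof -
  \<comment> \<open>The additional \<open>1 / 2 ^ (k + 2)\<close> makes the induction work: if it is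
    called \<open>x\<close>, then \<open>x \<le> 1 / 4\<close> and
    \<open>(1 / 4 + x) * (1 - x)\<close> is at least \<open>1 / 4 + x / 2\<close>.\<close>
  have A: "qpoch (Suc k) \<ge> 1 / 4 + 1 / 2 ^ (k + 2)" for k
  proof (induction k)
    case (Suc k)
    define x :: real where "x = 1 / 2 ^ (k + 2)"
    have x: "0 \<le> x" "x \<le> 1 / 4"
      unfolding x_def by (auto simp: field_simps intro: order_trans[OF _ power_increasing[of 2 "k + 2" 2]])
    have "x * x \<le> x * (1 / 4)" by (rule mult_left_mono[OF x(2) x(1)])
    moreover have "(1 / 4 + x) * (1 - x) = 1 / 4 + 3 / 4 * x - x * x" by (simp add: field_simps)
    ultimately have "1 / 4 + x / 2 \<le> (1 / 4 + x) * (1 - x)" by linarith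
    also have "(1 / 4 + x) * (1 - x) \<le> qpoch (Suc k) * (1 - x)"
      using Suc[folded x_def] x by (intro mult_right_mono) auto
    finally show ?case by (simp add: qpoch_Suc[of "Suc k"] x_def)
  qed (simp add: qpoch_def)
  have "qpoch (Suc k) \<ge> 1 / 4" for k
  proof -
    have "(0 :: real) \<le> 1 / 2 ^ (k + 2)" by simp
    then show ?thesis using A[of k] by linarith
  qed
  then show ?thesis by (cases k) (auto simp: qpoch_def)
qed

lemma qpoch_pos: "qpoch k > 0" using qpoch_lower[of k] by linarith

lemma qpoch_le_1: "qpoch k \<le> 1"
proof -
  have "(1 :: real) \<le> 2 ^ Suc j" for j by (rule one_le_power) simp
  then show ?thesis unfolding qpoch_def by (intro prod_le_1) (auto simp del: power_Suc)
qed

lemma qpoch_tendsto: "qpoch \<longlonglongrightarrow> qpoch_inf"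
proof -
  have "summable (\<lambda>j. (1 / 2 :: real) ^ Suc j)"
    unfolding summable_Suc_iff by (rule summable_geometric) simp
  then have "summable (\<lambda>j. norm ((1 - 1 / 2 ^ Suc j) - 1 :: real))"
    by (simp add: power_one_over)
  then have "convergent_prod (\<lambda>j. 1 - 1 / 2 ^ Suc j :: real)"
    by (intro abs_convergent_prod_imp_convergent_prod) (simp add: abs_convergent_prod_conv_summable)
  then have "(\<lambda>n. \<Prod>j\<le>n. 1 - 1 / 2 ^ Suc j :: real) \<longlonglongrightarrow> qpoch_inf"
    unfolding qpoch_inf_def by (rule convergent_prod_LIMSEQ)
  then have "(\<lambda>n. qpoch (Suc n)) \<longlonglongrightarrow> qpoch_inf"
    by (simp add: qpoch_def lessThan_Suc_atMost)
  then show ?thesis by (rule LIMSEQ_imp_Suc)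
qed

lemma qpoch_inf_bounds: "1 / 4 \<le> qpoch_inf" "qpoch_inf \<le> 1"
  by (rule LIMSEQ_le_const[OF qpoch_tendsto], use qpoch_lower in blast)
     (rule LIMSEQ_le_const2[OF qpoch_tendsto], use qpoch_le_1 in blast)

section \<open>The Durfee rectangle identity at q = 1/2\<close>

definition durfee_term :: "nat \<Rightarrow> nat \<Rightarrow> real" where
  "durfee_term m k = (1 / 2) ^ (k * (k + m)) / (qpoch k * qpoch (k + m))"

lemma durfee_term_bounds:
  "0 \<le> durfee_term m k" "durfee_term m k \<le> 16 * (1 / 2) ^ (k * (k + m))"
proof -
  have "1 / 4 * (1 / 4) \<le> qpoch k * qpoch (k + m)"
    by (intro mult_mono qpoch_lower) (use qpoch_pos[of k] in auto)
  then have q: "1 \<le> 16 * (qpoch k * qpoch (k + m))" by simp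
  show "0 \<le> durfee_term m k"
    using qpoch_pos[of k] qpoch_pos[of "k + m"] by (simp add: durfee_term_def)
  have "(1 / 2 :: real) ^ (k * (k + m)) * 1 \<le> (1 / 2) ^ (k * (k + m)) * (16 * (qpoch k * qpoch (k + m)))"
    by (rule mult_left_mono[OF q]) simp
  then show "durfee_term m k \<le> 16 * (1 / 2) ^ (k * (k + m))"
    using qpoch_pos[of k] qpoch_pos[of "k + m"] by (simp add: durfee_term_def divide_le_eq mult_ac)
qed

lemma durfee_term_geometric: "durfee_term m k \<le> 16 * (1 / 2) ^ k"
proof -
  have "(1 / 2 :: real) ^ (k * (k + m)) \<le> (1 / 2) ^ k"
    by (rule power_decreasing) (cases k; auto)+
  then show ?thesis using durfee_term_bounds(2)[of m k] by linarith
qed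

lemma half_sums: "(\<lambda>k. c * (1 / 2) ^ k) sums (2 * c :: real)"
proof -
  have "(\<lambda>k. c * (1 / 2) ^ k) sums (c * (1 / (1 - 1 / 2)))" by (intro sums_mult geometric_sums) simp
  moreover have "c * (1 / (1 - 1 / 2)) = 2 * c" by simp
  ultimately show ?thesis by (simp only:)
qed

lemma durfee_summable: "summable (durfee_term m)"
  by (rule summable_comparison_test'[OF sums_summable[OF half_sums[of 16]], of 0])
     (use durfee_term_bounds durfee_term_geometric in auto)

text \<open>Classifying partitions by their largest rectangle of shape k by k + m shows that the
  value is the partition generating function, the same for all \<open>m\<close>. Below this is
  derived analytically, from a recurrence in \<open>m\<close>.\<close>

definition durfee_sum :: "nat \<Rightarrow> real" where
  "durfee_sum m = (\<Sum>k. durfee_term m k)"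

lemma durfee_sum_bounds: "0 \<le> durfee_sum m" "durfee_sum m \<le> 32"
proof -
  show "0 \<le> durfee_sum m"
    unfolding durfee_sum_def by (intro suminf_nonneg durfee_summable durfee_term_bounds)
  have "durfee_sum m \<le> (\<Sum>k. 16 * (1 / 2) ^ k)"
    unfolding durfee_sum_def
    by (intro suminf_le durfee_summable durfee_term_geometric sums_summable[OF half_sums])
  then show "durfee_sum m \<le> 32" using sums_unique[OF half_sums[of 16]] by simp
qed

text \<open>Termwise, the difference is \<open>u k\<close> minus \<open>?q ^ Suc m\<close> times a
  term of index \<open>Suc m\<close>. Since \<open>u 0 = 0\<close> and \<open>u (Suc k)\<close> is
  \<open>?q ^ Suc m\<close> times a term of index \<open>Suc (Suc m)\<close>, summation gives the
  recurrence.\<close>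

lemma durfee_sum_recurrence:
  "durfee_sum m - durfee_sum (Suc m) = - ((1 / 2) ^ Suc m * (durfee_sum (Suc m) - durfee_sum (Suc (Suc m))))"
proof -
  let ?q = "1 / 2 :: real"
  define u where "u k = ?q ^ (k * (k + m)) * (1 - ?q ^ k) / (qpoch k * qpoch (k + Suc m))" for k
  have nz: "qpoch k \<noteq> 0" for k using qpoch_pos[of k] by simp
  have S1: "qpoch (Suc k) = qpoch k * (1 - ?q ^ Suc k)" for k by (simp add: qpoch_Suc power_one_over)
  have nz1: "1 - ?q ^ Suc k \<noteq> 0" for k using nz[of "Suc k"] unfolding S1 by auto
  have trm: "durfee_term m k - durfee_term (Suc m) k = u k - ?q ^ Suc m * durfee_term (Suc m) k" for k
  proof -
    have "durfee_term m k = ?q ^ (k * (k + m)) * (1 - ?q ^ Suc (k + m)) / (qpoch k * qpoch (k + Suc m))"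
      unfolding durfee_term_def using nz nz1[of "k + m"] by (simp add: S1 del: power_Suc)
    moreover have "durfee_term (Suc m) k = ?q ^ (k * (k + m)) * ?q ^ k / (qpoch k * qpoch (k + Suc m))"
      unfolding durfee_term_def by (simp add: power_add[symmetric] algebra_simps)
    moreover have "?q ^ Suc (k + m) = ?q ^ k * ?q ^ Suc m" by (simp add: power_add)
    moreover have "X * (1 - Y * Z) / d - X * Y / d = X * (1 - Y) / d - Z * (X * Y / d)" for X Y Z d :: real
      by (simp add: algebra_simps diff_divide_distrib add_divide_distrib)
    ultimately show ?thesis unfolding u_def by (simp only:)
  qed
  have u0: "u 0 = 0" by (simp add: u_def)
  have uS: "u (Suc k) = ?q ^ Suc m * durfee_term (Suc (Suc m)) k" for k
  proof -
    have "Suc k * (Suc k + m) = Suc m + k * (k + Suc (Suc m))" by (simp add: algebra_simps)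
    then have "?q ^ (Suc k * (Suc k + m)) = ?q ^ Suc m * ?q ^ (k * (k + Suc (Suc m)))"
      by (simp only: power_add)
    then show ?thesis
      unfolding u_def durfee_term_def using nz nz1[of k]
      by (simp add: S1[of k] del: power_Suc)
  qed
  have su: "summable (\<lambda>k. u (Suc k))" unfolding uS by (intro summable_mult durfee_summable)
  then have su': "summable u" by (simp add: summable_Suc_iff)
  have "(\<Sum>k. u (Suc k)) = ?q ^ Suc m * durfee_sum (Suc (Suc m))"
    unfolding uS durfee_sum_def by (rule suminf_mult[OF durfee_summable])
  then have "suminf u = ?q ^ Suc m * durfee_sum (Suc (Suc m))"
    using suminf_split_head[OF su'] u0 by simp
  moreover have "durfee_sum m - durfee_sum (Suc m) = suminf u - ?q ^ Suc m * durfee_sum (Suc m)"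
    unfolding durfee_sum_def suminf_mult[OF durfee_summable, symmetric]
      suminf_diff[OF durfee_summable durfee_summable] suminf_diff[OF su' summable_mult[OF durfee_summable]] trm ..
  ultimately show ?thesis unfolding right_diff_distrib by linarith
qed

text \<open>By the recurrence each difference is at most half the next one. As all differences are
  bounded, iterating forces them to be 0.\<close>

lemma durfee_sum_Suc: "durfee_sum (Suc m) = durfee_sum m"
proof -
  define D where "D m = \<bar>durfee_sum m - durfee_sum (Suc m)\<bar>" for m
  have D: "D m \<le> (1 / 2) * D (Suc m)" for m
  proof -
    have "D m = (1 / 2) ^ Suc m * D (Suc m)"
      unfolding D_def durfee_sum_recurrence[of m] by (simp add: abs_mult)
    moreover have "(1 / 2 :: real) ^ Suc m \<le> 1 / 2" by (simp add: power_le_one)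
    ultimately show ?thesis using mult_right_mono[of "(1 / 2) ^ Suc m" "1 / 2" "D (Suc m)"] by (simp add: D_def)
  qed
  have it: "D m \<le> (1 / 2) ^ j * D (m + j)" for j
  proof (induction j)
    case (Suc j)
    have "(1 / 2) ^ j * D (m + j) \<le> (1 / 2) ^ j * ((1 / 2) * D (Suc (m + j)))"
      by (intro mult_left_mono D) simp
    with Suc have "D m \<le> (1 / 2) ^ j * ((1 / 2) * D (Suc (m + j)))" by (rule order_trans)
    then show ?case by (simp add: mult_ac)
  qed simp
  have bd: "D m \<le> 64 * (1 / 2) ^ j" for j
  proof -
    have "D (m + j) \<le> 64"
      using durfee_sum_bounds[of "m + j"] durfee_sum_bounds[of "Suc (m + j)"] unfolding D_def by linarith
    then have "(1 / 2) ^ j * D (m + j) \<le> (1 / 2) ^ j * 64" by (intro mult_left_mono) auto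
    with it[of j] have "D m \<le> (1 / 2) ^ j * 64" by (rule order_trans)
    then show ?thesis by (simp only: mult.commute)
  qed
  have "(\<lambda>j. 64 * (1 / 2 :: real) ^ j) \<longlonglongrightarrow> 0" by real_asymp
  then have "D m \<le> 0" by (rule LIMSEQ_le_const) (use bd in blast)
  then show ?thesis by (simp add: D_def)
qed

text \<open>The sum does not depend on \<open>m\<close>, and for large \<open>m\<close> only its
  term \<open>k = 0\<close> survives; this term is \<open>1 / qpoch m\<close>.\<close>

lemma durfee_sum_0: "durfee_sum 0 = 1 / qpoch_inf"
proof -
  have const: "durfee_sum m = durfee_sum 0" for m by (induction m) (auto simp: durfee_sum_Suc)
  have lo: "1 / qpoch m \<le> durfee_sum m" for m
  proof -
    have "durfee_term m 0 + (\<Sum>k. durfee_term m (Suc k)) = durfee_sum m"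
      unfolding durfee_sum_def using suminf_split_head[OF durfee_summable[of m]] by simp
    moreover have "(\<Sum>k. durfee_term m (Suc k)) \<ge> 0"
      by (intro suminf_nonneg durfee_term_bounds) (simp add: summable_Suc_iff durfee_summable)
    ultimately show ?thesis by (simp add: durfee_term_def qpoch_def)
  qed
  have hi: "durfee_sum m \<le> 1 / qpoch m + 16 * (1 / 2) ^ m" for m
  proof -
    have t: "durfee_term m (Suc k) \<le> 8 * (1 / 2) ^ m * (1 / 2) ^ k" for k
    proof -
      have "(1 / 2 :: real) ^ (Suc k * (Suc k + m)) \<le> (1 / 2) ^ (Suc k + m)"
        by (rule power_decreasing) auto
      moreover have "8 * (1 / 2 :: real) ^ m * (1 / 2) ^ k = 16 * (1 / 2) ^ (Suc k + m)"
        by (simp add: power_add)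
      ultimately show ?thesis using durfee_term_bounds(2)[of m "Suc k"] by linarith
    qed
    have "(\<Sum>k. durfee_term m (Suc k)) \<le> (\<Sum>k. 8 * (1 / 2) ^ m * (1 / 2) ^ k)"
      by (intro suminf_le t sums_summable[OF half_sums]) (simp add: summable_Suc_iff durfee_summable)
    also have "\<dots> = 16 * (1 / 2) ^ m" using sums_unique[OF half_sums[of "8 * (1 / 2) ^ m"]] by simp
    finally have "(\<Sum>k. durfee_term m (Suc k)) \<le> 16 * (1 / 2) ^ m" .
    moreover have "durfee_term m 0 + (\<Sum>k. durfee_term m (Suc k)) = durfee_sum m"
      unfolding durfee_sum_def using suminf_split_head[OF durfee_summable[of m]] by simp
    ultimately show ?thesis by (simp add: durfee_term_def qpoch_def)
  qed
  have nz: "qpoch_inf \<noteq> 0" using qpoch_inf_bounds by auto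
  have l: "(\<lambda>m. 1 / qpoch m) \<longlonglongrightarrow> 1 / qpoch_inf"
    by (intro tendsto_intros qpoch_tendsto nz)
  have z: "(\<lambda>m. 16 * (1 / 2 :: real) ^ m) \<longlonglongrightarrow> 0" by real_asymp
  have u: "(\<lambda>m. 1 / qpoch m + 16 * (1 / 2) ^ m) \<longlonglongrightarrow> 1 / qpoch_inf"
    using tendsto_add[OF l z] by simp
  have lo0: "1 / qpoch m \<le> durfee_sum 0" for m using lo[of m] unfolding const[of m] .
  have hi0: "durfee_sum 0 \<le> 1 / qpoch m + 16 * (1 / 2) ^ m" for m using hi[of m] unfolding const[of m] .
  have "1 / qpoch_inf \<le> durfee_sum 0"
    by (rule LIMSEQ_le_const2[OF l]) (use lo0 in blast)
  moreover have "durfee_sum 0 \<le> 1 / qpoch_inf"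
    by (rule LIMSEQ_le_const[OF u]) (use hi0 in blast)
  ultimately show ?thesis by simp
qed

section \<open>Tail of the conjectured law of the dimension\<close>

definition corank_law :: "nat \<Rightarrow> real" where
  "corank_law k = 1 / 2 ^ (k ^ 2) * (\<Prod>j=1..k. 1 / (1 - 1 / 2 ^ j) ^ 2) * prodinf (\<lambda>j. 1 - 1 / 2 ^ Suc j)"

lemma corank_law_eq: "corank_law k = qpoch_inf * durfee_term 0 k"
proof -
  have "(\<Prod>j=1..k. 1 / (1 - 1 / 2 ^ j) ^ 2) = 1 / (qpoch k * qpoch k)"
  proof (induction k)
    case (Suc k)
    then show ?case by (simp add: qpoch_Suc power2_eq_square)
  qed (simp add: qpoch_def)
  then show ?thesis
    by (simp add: corank_law_def durfee_term_def qpoch_inf_def power2_eq_square power_one_over)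
qed

text \<open>The Durfee identity with \<open>m = 0\<close> says that the law has total mass 1, so the
  left-hand side is the sum over the indices from \<open>h\<close> on. That sum is geometric because
  \<open>(k + h) * (k + h)\<close> is at least \<open>h * h + k\<close>.\<close>

lemma corank_law_tail: "1 - (\<Sum>k<h. corank_law k) \<le> 32 / 2 ^ (h * h)"
proof -
  have nz: "qpoch_inf \<noteq> 0" using qpoch_inf_bounds by auto
  have "1 = qpoch_inf * durfee_sum 0" using durfee_sum_0 nz by simp
  also have "durfee_sum 0 = (\<Sum>k. durfee_term 0 (k + h)) + (\<Sum>k<h. durfee_term 0 k)"
    unfolding durfee_sum_def by (rule suminf_split_initial_segment[OF durfee_summable])
  finally have "1 - (\<Sum>k<h. corank_law k) = qpoch_inf * (\<Sum>k. durfee_term 0 (k + h))"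
    by (simp add: corank_law_eq sum_distrib_left algebra_simps)
  also have "\<dots> \<le> 1 * (\<Sum>k. durfee_term 0 (k + h))"
    using qpoch_inf_bounds
    by (intro mult_right_mono suminf_nonneg durfee_term_bounds summable_ignore_initial_segment durfee_summable) auto
  also have "(\<Sum>k. durfee_term 0 (k + h)) \<le> (\<Sum>k. 16 * (1 / 2) ^ (h * h) * (1 / 2) ^ k)"
  proof (intro suminf_le sums_summable[OF half_sums] summable_ignore_initial_segment durfee_summable)
    fix k
    have "(1 / 2 :: real) ^ ((k + h) * (k + h)) \<le> (1 / 2) ^ (h * h + k)"
      by (rule power_decreasing) (cases k; auto simp: algebra_simps)+
    then show "durfee_term 0 (k + h) \<le> 16 * (1 / 2) ^ (h * h) * (1 / 2) ^ k"
      using durfee_term_bounds(2)[of 0 "k + h"] by (simp add: power_add)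
  qed
  also have "\<dots> = 32 * (1 / 2) ^ (h * h)" using sums_unique[OF half_sums[of "16 * (1 / 2) ^ (h * h)"]] by simp
  finally show ?thesis by (simp add: power_one_over)
qed

text \<open>Raising \<open>h\<close> by one amounts to a new first factor \<open>1 + 2 ^ h\<close>,
  at most \<open>2 ^ Suc h\<close>, in front of the product for the old \<open>h\<close>; the
  exponents add up to a triangular number. For \<open>h = 0\<close> the product is at most
  \<open>exp 1\<close>.\<close>

lemma prod_one_plus_bound: "(\<Prod>i<m. 1 + 2 ^ h / 2 ^ Suc i :: real) \<le> 4 * 2 ^ (h * Suc h div 2)"
proof (induction h arbitrary: m)
  case 0
  have "(\<Sum>i<m. 1 / 2 ^ Suc i :: real) \<le> (\<Sum>i. 1 / 2 * (1 / 2) ^ i)"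
  proof -
    have "(\<Sum>i<m. 1 / 2 ^ Suc i :: real) = (\<Sum>i<m. 1 / 2 * (1 / 2) ^ i)" by (simp add: power_one_over)
    also have "\<dots> \<le> (\<Sum>i. 1 / 2 * (1 / 2) ^ i)" by (intro sum_le_suminf sums_summable[OF half_sums]) auto
    finally show ?thesis .
  qed
  then have s: "(\<Sum>i<m. 1 / 2 ^ Suc i :: real) \<le> 1" using sums_unique[OF half_sums[of "1 / 2"]] by simp
  have "(\<Prod>i<m. 1 + 1 / 2 ^ Suc i :: real) \<le> (\<Prod>i<m. exp (1 / 2 ^ Suc i))"
    by (intro prod_mono conjI exp_ge_add_one_self) auto
  also have "\<dots> = exp (\<Sum>i<m. 1 / 2 ^ Suc i)" by (simp add: exp_sum)
  also have "\<dots> \<le> 3" by (rule order_trans[OF _ exp_le]) (use s in simp)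
  finally show ?case by simp
next
  case (Suc h)
  have e: "Suc h * Suc (Suc h) div 2 = h * Suc h div 2 + Suc h"
  proof -
    have "Suc h * Suc (Suc h) = h * Suc h + 2 * Suc h" by (simp add: algebra_simps)
    then show ?thesis by (metis div_mult_self2 add.commute zero_neq_numeral)
  qed
  show ?case
  proof (cases m)
    case (Suc k)
    have "(\<Prod>i<m. 1 + 2 ^ Suc h / 2 ^ Suc i :: real) = (1 + 2 ^ h) * (\<Prod>i<k. 1 + 2 ^ h / 2 ^ Suc i)"
      unfolding Suc prod.lessThan_Suc_shift by simp
    also have "\<dots> \<le> (2 ^ h + 2 ^ h) * (4 * 2 ^ (h * Suc h div 2))"
      by (intro mult_mono Suc.IH) (auto intro!: prod_nonneg add_nonneg_nonneg)
    finally show ?thesis unfolding e by (simp add: power_add mult_ac)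
  next
    case 0
    have "(1 :: real) \<le> 2 ^ (Suc h * Suc (Suc h) div 2)" by (rule one_le_power) simp
    then have "(1 :: real) \<le> 4 * 2 ^ (Suc h * Suc (Suc h) div 2)" by linarith
    then show ?thesis unfolding 0 by (simp only: lessThan_0 prod.empty)
  qed
qed

section \<open>Weights of Hermite forms with few nontrivial pivots\<close>

definition hermite_weight :: "nat \<Rightarrow> nat \<Rightarrow> nat \<Rightarrow> real" where
  "hermite_weight m A h =
     (\<Sum>a | a \<in> {..<m} \<rightarrow>\<^sub>E {..A} \<and> card {j. j < m \<and> a j \<noteq> 0} < h. \<Prod>j<m. (1 / 2) ^ (a j * (m - j)))"

text \<open>A Chernoff bound for the tuples with at least \<open>h\<close> nonzero exponents. If
  every nonzero exponent receives an extra factor \<open>2 ^ h\<close>, such a tuple gains at least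
  \<open>2 ^ (h * h)\<close>, while the modified sum over all tuples is a product of geometric
  series.\<close>

lemma hermite_weight_lower:
  "(\<Prod>j<m. \<Sum>a\<le>A. (1 / 2 :: real) ^ (a * (m - j))) - 4 * 2 ^ (Suc h * Suc (Suc h) div 2) / 2 ^ (h * h)
     \<le> hermite_weight m A h"
proof -
  let ?F = "{..<m} \<rightarrow>\<^sub>E {..A}" and ?c = "\<lambda>a. card {j. j < m \<and> a j \<noteq> (0 :: nat)}"
  let ?w = "\<lambda>a. \<Prod>j<m. (1 / 2 :: real) ^ (a j * (m - j))"
  have fin: "finite ?F" by (simp add: finite_PiE)
  have all: "(\<Prod>j<m. \<Sum>a\<le>A. (1 / 2 :: real) ^ (a * (m - j))) = (\<Sum>a\<in>?F. ?w a)"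
    by (rule prod_sum_PiE) auto
  have split: "(\<Sum>a\<in>?F. ?w a) = hermite_weight m A h + (\<Sum>a | a \<in> ?F \<and> \<not> ?c a < h. ?w a)"
    unfolding hermite_weight_def by (subst sum.union_disjoint[symmetric]) (use fin in \<open>auto intro!: sum.cong\<close>)
  let ?g = "\<lambda>j a. (if a = 0 then 1 else 2 ^ h) * (1 / 2 :: real) ^ (a * (m - j))"
  have "(\<Sum>a | a \<in> ?F \<and> \<not> ?c a < h. ?w a) \<le> (\<Sum>a | a \<in> ?F \<and> \<not> ?c a < h. (\<Prod>j<m. ?g j (a j)) / 2 ^ (h * h))"
  proof (rule sum_mono)
    fix a assume "a \<in> {a. a \<in> ?F \<and> \<not> ?c a < h}"
    then have c: "h \<le> ?c a" by simp
    have "(\<Prod>j<m. if a j = 0 then 1 else 2 ^ h :: real) = (2 ^ h) ^ ?c a"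
    proof -
      have "(\<Prod>j<m. if a j = 0 then 1 else 2 ^ h :: real) = (\<Prod>j\<in>{j. j < m \<and> a j \<noteq> 0}. 2 ^ h)"
        by (rule prod.mono_neutral_cong_right) auto
      then show ?thesis by simp
    qed
    also have "\<dots> \<ge> (2 ^ h) ^ h" by (rule power_increasing[OF c]) simp
    finally have "2 ^ (h * h) \<le> (\<Prod>j<m. if a j = 0 then 1 else 2 ^ h :: real)" by (simp add: power_mult)
    then have "2 ^ (h * h) * ?w a \<le> (\<Prod>j<m. if a j = 0 then 1 else 2 ^ h :: real) * ?w a"
      by (intro mult_right_mono prod_nonneg) auto
    then show "?w a \<le> (\<Prod>j<m. ?g j (a j)) / 2 ^ (h * h)"
      by (simp add: prod.distrib[symmetric] field_simps)
  qed
  also have "\<dots> \<le> (\<Sum>a\<in>?F. (\<Prod>j<m. ?g j (a j)) / 2 ^ (h * h))"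
  proof (rule sum_mono2[OF fin])
    have g0: "0 \<le> ?g j b" for j b by simp
    show "0 \<le> (\<Prod>j<m. ?g j (a j)) / 2 ^ (h * h)" for a
      by (intro divide_nonneg_nonneg prod_nonneg ballI g0) simp
  qed blast
  also have "\<dots> = (\<Prod>j<m. \<Sum>a\<le>A. ?g j a) / 2 ^ (h * h)"
    unfolding sum_divide_distrib[symmetric] by (subst prod_sum_PiE) auto
  also have "(\<Prod>j<m. \<Sum>a\<le>A. ?g j a) \<le> (\<Prod>j<m. 1 + 2 ^ Suc h / 2 ^ Suc (m - Suc j))"
  proof (rule prod_mono, rule conjI)
    fix j assume "j \<in> {..<m}"
    then have mj: "m - j = Suc (m - Suc j)" by auto
    let ?x = "(1 / 2 :: real) ^ (m - j)"
    have x: "0 < ?x" "?x \<le> 1 / 2" unfolding mj by (auto simp: power_le_one)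
    have sm: "summable (\<lambda>a. ?x * ?x ^ a)" using x by (intro summable_mult summable_geometric) auto
    have "(\<Sum>a\<le>A. ?g j a) = 1 + (\<Sum>a<A. 2 ^ h * (?x * ?x ^ a))"
      unfolding lessThan_Suc_atMost[symmetric] sum.lessThan_Suc_shift
      by (simp add: power_mult[symmetric] mult.commute power_add[symmetric])
    also have "(\<Sum>a<A. 2 ^ h * (?x * ?x ^ a)) = 2 ^ h * (\<Sum>a<A. ?x * ?x ^ a)"
      by (rule sum_distrib_left[symmetric])
    also have "\<dots> \<le> 2 ^ h * (\<Sum>a. ?x * ?x ^ a)"
      using x by (intro mult_left_mono sum_le_suminf sm) auto
    also have "(\<Sum>a. ?x * ?x ^ a) = ?x * (1 / (1 - ?x))"
      using x by (subst suminf_mult) (auto simp: suminf_geometric intro!: summable_geometric)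
    also have "\<dots> \<le> ?x * 2" using x by (intro mult_left_mono) (auto simp: field_simps)
    finally show "(\<Sum>a\<le>A. ?g j a) \<le> 1 + 2 ^ Suc h / 2 ^ Suc (m - Suc j)"
      unfolding mj by (simp add: power_one_over mult_ac)
  qed (auto intro!: sum_nonneg)
  also have "(\<Prod>j<m. 1 + 2 ^ Suc h / 2 ^ Suc (m - Suc j) :: real) = (\<Prod>i<m. 1 + 2 ^ Suc h / 2 ^ Suc i)"
    by (rule prod.nat_diff_reindex)
  also have "\<dots> \<le> 4 * 2 ^ (Suc h * Suc (Suc h) div 2)" by (rule prod_one_plus_bound)
  finally have "(\<Sum>a | a \<in> ?F \<and> \<not> ?c a < h. ?w a) \<le> 4 * 2 ^ (Suc h * Suc (Suc h) div 2) / 2 ^ (h * h)"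
    by (simp add: divide_right_mono)
  then show ?thesis unfolding all split by simp
qed

text \<open>Letting first \<open>A\<close> and then \<open>m\<close> tend to infinity removes both
  truncations. The main term times \<open>qpoch_inf\<close> tends to 1, so \<beta> can only come
  from the error term.\<close>

lemma hermite_weight_limit:
  assumes "\<And>m A. qpoch_inf * hermite_weight m A h \<le> 1 - \<beta>"
  shows "\<beta> \<le> 4 * 2 ^ (Suc h * Suc (Suc h) div 2) / 2 ^ (h * h)" (is "_ \<le> ?\<epsilon>")
proof -
  have m: "qpoch_inf * (1 / qpoch m - ?\<epsilon>) \<le> 1 - \<beta>" for m
  proof (rule LIMSEQ_le_const2)
    have "(\<lambda>A. \<Sum>a\<le>A. (1 / 2 :: real) ^ (a * (m - j))) \<longlonglongrightarrow> 1 / (1 - 1 / 2 ^ (m - j))" if "j < m" for j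
    proof -
      have "m - j = Suc (m - Suc j)" using that by simp
      then have "(1 / 2 :: real) ^ (m - j) \<le> 1 / 2" by (simp add: power_le_one)
      then have "(1 / 2 :: real) ^ (m - j) < 1" by linarith
      then have "(\<lambda>a. ((1 / 2 :: real) ^ (m - j)) ^ a) sums (1 / (1 - (1 / 2) ^ (m - j)))"
        by (intro geometric_sums) auto
      then show ?thesis by (simp add: sums_def_le power_mult mult.commute[of _ "m - j"] power_one_over)
    qed
    then have "(\<lambda>A. \<Prod>j<m. \<Sum>a\<le>A. (1 / 2 :: real) ^ (a * (m - j))) \<longlonglongrightarrow> (\<Prod>j<m. 1 / (1 - 1 / 2 ^ (m - j)))"
      by (intro tendsto_prod) auto
    also have "(\<Prod>j<m. 1 / (1 - 1 / 2 ^ (m - j)) :: real) = (\<Prod>j<m. 1 / (1 - 1 / 2 ^ Suc (m - Suc j)))"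
      by (intro prod.cong refl) (simp add: Suc_diff_Suc)
    also have "\<dots> = (\<Prod>j<m. 1 / (1 - 1 / 2 ^ Suc j))"
      by (rule prod.nat_diff_reindex)
    also have "\<dots> = 1 / qpoch m" by (simp add: qpoch_def prod_dividef)
    finally show "(\<lambda>A. qpoch_inf * ((\<Prod>j<m. \<Sum>a\<le>A. (1 / 2 :: real) ^ (a * (m - j))) - ?\<epsilon>))
        \<longlonglongrightarrow> qpoch_inf * (1 / qpoch m - ?\<epsilon>)"
      by (intro tendsto_intros)
    have "qpoch_inf * ((\<Prod>j<m. \<Sum>a\<le>A. (1 / 2 :: real) ^ (a * (m - j))) - ?\<epsilon>) \<le> 1 - \<beta>" for A
      using mult_left_mono[OF hermite_weight_lower[of m A h], of qpoch_inf] assms[of m A] qpoch_inf_bounds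
      by linarith
    then show "\<exists>N. \<forall>A\<ge>N. qpoch_inf * ((\<Prod>j<m. \<Sum>a\<le>A. (1 / 2 :: real) ^ (a * (m - j))) - ?\<epsilon>) \<le> 1 - \<beta>"
      by blast
  qed
  have nz: "qpoch_inf \<noteq> 0" using qpoch_inf_bounds by auto
  have "(\<lambda>m. qpoch_inf * (1 / qpoch m - ?\<epsilon>)) \<longlonglongrightarrow> qpoch_inf * (1 / qpoch_inf - ?\<epsilon>)"
    by (intro tendsto_intros qpoch_tendsto nz)
  then have "qpoch_inf * (1 / qpoch_inf - ?\<epsilon>) \<le> 1 - \<beta>"
    by (rule LIMSEQ_le_const2) (use m in blast)
  then have "\<beta> \<le> qpoch_inf * ?\<epsilon>" using nz by (simp add: right_diff_distrib)
  also have "\<dots> \<le> 1 * ?\<epsilon>" using qpoch_inf_bounds by (intro mult_right_mono) auto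
  finally show ?thesis by simp
qed

section \<open>Numerical comparison of the bounds\<close>

lemma superexponential_beats:
  "\<exists>h::nat. h > 0 \<and> 4 * 2 ^ (Suc h * Suc (Suc h) div 2) / 2 ^ (h * h) < exp (- 200 * real h) / (100 * real h) ^ (5 * h) \<and>
     32 / 2 ^ (h * h) < exp (- 200 * real h) / (100 * real h) ^ (5 * h)"
proof -
  \<comment> \<open>After taking logarithms: \<open>Suc h * Suc (Suc h) div 2 - h * h\<close> is
    about \<open>- h\<^sup>2 / 2\<close>, which outweighs the \<open>200 h + 5 h ln (100 h)\<close>
    in the lower bound. The slack \<open>2 h + 8\<close> absorbs the remaining terms
    \<open>3 + 3 h / 2\<close> and \<open>5\<close>.\<close>
  have "eventually (\<lambda>h::nat. ln 2 / 2 * real h ^ 2 - 200 * real h - 5 * real h * ln (100 * real h) - 2 * real h - 8 > 0) sequentially"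
    by real_asymp
  then have "eventually (\<lambda>h::nat. h \<ge> 1 \<and> ln 2 / 2 * real h ^ 2 - 200 * real h - 5 * real h * ln (100 * real h) - 2 * real h - 8 > 0) sequentially"
    by (intro eventually_conj eventually_ge_at_top)
  then obtain h :: nat where h: "h \<ge> 1" and g: "ln 2 / 2 * real h ^ 2 - 200 * real h - 5 * real h * ln (100 * real h) - 2 * real h - 8 > 0"
    using eventually_happens[of _ sequentially] by (auto simp: trivial_limit_sequentially)
  have e: "exp (- 200 * real h) / (100 * real h) ^ (5 * h) = exp (- 200 * real h - 5 * real h * ln (100 * real h))"
  proof -
    have "(100 * real h) ^ (5 * h) = exp (ln (100 * real h)) ^ (5 * h)" using h by simp
    also have "\<dots> = exp (real (5 * h) * ln (100 * real h))" by (rule exp_of_nat_mult[symmetric])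
    finally show ?thesis by (simp add: exp_diff)
  qed
  have p: "2 ^ k = exp (ln 2 * real k)" for k :: nat
  proof -
    have "(2 :: real) ^ k = exp (ln 2) ^ k" by simp
    also have "\<dots> = exp (real k * ln 2)" by (rule exp_of_nat_mult[symmetric])
    finally show ?thesis by (simp add: mult.commute)
  qed
  have l2: "0 < ln (2 :: real)" "ln (2 :: real) \<le> 1" using ln_le_minus_one[of 2] by auto
  define k where "k = Suc h * Suc (Suc h) div 2"
  have "2 * k \<le> Suc h * Suc (Suc h)" unfolding k_def by (rule times_div_less_eq_dividend)
  then have "real (2 * k) \<le> real (Suc h * Suc (Suc h))" by (rule of_nat_mono)
  then have k: "real k \<le> (real h ^ 2 + 3 * real h + 2) / 2" by (simp add: power2_eq_square algebra_simps)
  have gen: "1 * (3 + 3 / 2 * x) - L < - 200 * x - l \<and> 5 - L < - 200 * x - l"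
    if L: "0 < L - 200 * x - l - 2 * x - 8" and x: "0 \<le> x" for L l x :: real
  proof
    show "1 * (3 + 3 / 2 * x) - L < - 200 * x - l" using L x by (simp add: field_simps)
    show "5 - L < - 200 * x - l" using L x by simp
  qed
  have "4 * 2 ^ k / 2 ^ (h * h) = exp (ln 2 * real (2 + k) - ln 2 * real (h * h))"
    unfolding exp_diff p[symmetric] by (simp add: power_add)
  also have "\<dots> < exp (- 200 * real h - 5 * real h * ln (100 * real h))"
  proof -
    have "ln 2 * real (2 + k) - ln 2 * real (h * h) = ln 2 * (2 + real k - real h ^ 2)"
      by (simp add: power2_eq_square algebra_simps)
    also have "\<dots> \<le> ln 2 * (2 + (real h ^ 2 + 3 * real h + 2) / 2 - real h ^ 2)"
      using k l2 by (intro mult_left_mono) auto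
    also have "\<dots> = ln 2 * (3 + 3 / 2 * real h) - ln 2 / 2 * real h ^ 2" by (simp add: field_simps)
    also have "\<dots> \<le> 1 * (3 + 3 / 2 * real h) - ln 2 / 2 * real h ^ 2"
      using l2 by (intro diff_right_mono mult_right_mono) auto
    also have "\<dots> < - 200 * real h - 5 * real h * ln (100 * real h)" using gen[OF g] by simp
    finally show ?thesis by simp
  qed
  finally have 1: "4 * 2 ^ k / 2 ^ (h * h) < exp (- 200 * real h - 5 * real h * ln (100 * real h))" .
  have "32 / 2 ^ (h * h) = exp (ln 2 * real (5 :: nat) - ln 2 * real (h * h))"
    unfolding exp_diff p[symmetric] by simp
  also have "\<dots> < exp (- 200 * real h - 5 * real h * ln (100 * real h))"
  proof -
    have nn: "0 \<le> ln 2 / 2 * real h ^ 2" using l2 by simp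
    have "ln 2 * real (5 :: nat) - ln 2 * real (h * h) = ln 2 * 5 - 2 * (ln 2 / 2 * real h ^ 2)"
      by (simp add: power2_eq_square)
    also have "\<dots> \<le> 5 - ln 2 / 2 * real h ^ 2" using l2 nn by linarith
    also have "\<dots> < - 200 * real h - 5 * real h * ln (100 * real h)" using gen[OF g] by simp
    finally show ?thesis by simp
  qed
  finally have 2: "32 / 2 ^ (h * h) < exp (- 200 * real h - 5 * real h * ln (100 * real h))" .
  have "0 < h" using h by simp
  then show ?thesis using 1 2 unfolding e[symmetric] k_def by blast
qed

text \<open>Since \<open>n \<ge> 200 * h\<close>, rounding loses at most a factor 2, so
  \<open>?w\<close> is at least \<open>n / (200 h)\<close>; this costs \<open>2 ^ (5 * h)\<close>,
  at most \<open>exp (5 h)\<close>. As \<open>2 n / (n - 8) \<le> 4\<close>, the other power is at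
  most \<open>exp (20 h)\<close>. The surplus \<open>exp (175 h)\<close> covers the
  \<open>3 / 4\<close>.\<close>

lemma parameter_bound:
  assumes h: "h > 0" and n: "n \<ge> 200 * h" "n \<ge> 16"
  shows "3 / 4 * real (n div (100 * h)) ^ (5 * h) / (real n ^ (5 * h) * (1 + 2 / (real n - 8)) ^ (5 * h * n))
    \<ge> exp (- 200 * real h) / (100 * real h) ^ (5 * h)"
proof -
  let ?w = "n div (100 * h)" and ?H = "real h"
  have H: "?H \<ge> 1" using h by simp
  have "n < 100 * h * (?w + 1)" using h dividend_less_times_div[of "100 * h" n] by (simp add: algebra_simps)
  then have "real n < real (100 * h * (?w + 1))" by (simp only: of_nat_less_iff)
  then have "real n < 100 * ?H * (real ?w + 1)" by (simp add: algebra_simps)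
  moreover have "2 * (100 * ?H) \<le> real n" using n(1) of_nat_mono[of "200 * h" n] by simp
  ultimately have w: "real n / (200 * ?H) \<le> real ?w" using H by (simp add: field_simps)
  have n16: "real n \<ge> 16" using n(2) by simp
  have "(1 + 2 / (real n - 8)) ^ (5 * h * n) \<le> exp (2 / (real n - 8)) ^ (5 * h * n)"
    using n16 by (intro power_mono exp_ge_add_one_self) auto
  also have "\<dots> = exp (real (5 * h * n) * (2 / (real n - 8)))" by (rule exp_of_nat_mult[symmetric])
  also have "\<dots> \<le> exp (20 * ?H)"
  proof -
    have "real n * (2 / (real n - 8)) \<le> 4" using n16 by (simp add: field_simps)
    then have "5 * ?H * (real n * (2 / (real n - 8))) \<le> 5 * ?H * 4" by (intro mult_left_mono) auto
    then show ?thesis by (simp add: mult_ac)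
  qed
  finally have d: "(1 + 2 / (real n - 8)) ^ (5 * h * n) \<le> exp (20 * ?H)" .
  have "(2 :: real) \<le> exp 1" using exp_ge_add_one_self[of 1] by simp
  then have "(2 :: real) ^ (5 * h) \<le> exp 1 ^ (5 * h)" by (intro power_mono) auto
  also have "\<dots> = exp (5 * ?H)" using exp_of_nat_mult[of "5 * h" "1 :: real"] by simp
  finally have two: "(2 :: real) ^ (5 * h) \<le> exp (5 * ?H)" .
  have big: "1 \<le> 3 / 4 * exp (175 * ?H)" using exp_ge_add_one_self[of "175 * ?H"] H by linarith
  have "exp (- 200 * ?H) * 1 \<le> exp (- 200 * ?H) * (3 / 4 * exp (175 * ?H))"
    by (rule mult_left_mono[OF big]) simp
  also have "\<dots> = 3 / 4 / (exp (5 * ?H) * exp (20 * ?H))"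
  proof -
    have "exp (- 200 * ?H) * exp (175 * ?H) = exp (- (5 * ?H + 20 * ?H))"
      unfolding exp_add[symmetric] by simp
    also have "\<dots> = inverse (exp (5 * ?H) * exp (20 * ?H))" unfolding exp_minus exp_add ..
    finally show ?thesis by (simp only: divide_inverse mult.left_commute)
  qed
  also have "\<dots> \<le> 3 / 4 / (2 ^ (5 * h) * exp (20 * ?H))"
    using two by (intro divide_left_mono mult_right_mono) auto
  finally have "exp (- 200 * ?H) / (100 * ?H) ^ (5 * h) \<le> 3 / 4 / (2 ^ (5 * h) * exp (20 * ?H)) / (100 * ?H) ^ (5 * h)"
    by (intro divide_right_mono) auto
  also have "\<dots> = 3 / 4 * (real n / (200 * ?H)) ^ (5 * h) / (real n ^ (5 * h) * exp (20 * ?H))"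
  proof -
    have "(200 * ?H) ^ (5 * h) = 2 ^ (5 * h) * (100 * ?H) ^ (5 * h)"
      unfolding power_mult_distrib[symmetric] by simp
    then have "(real n / (200 * ?H)) ^ (5 * h) = real n ^ (5 * h) / (2 ^ (5 * h) * (100 * ?H) ^ (5 * h))"
      by (simp only: power_divide)
    moreover have "real n ^ (5 * h) \<noteq> 0" using n16 by simp
    moreover have "3 / 4 / (t * ex) / c = 3 / 4 * (N / (t * c)) / (N * ex)" if "N \<noteq> 0" for t ex c N :: real
      using that by (simp add: mult_ac)
    ultimately show ?thesis by (simp only: not_False_eq_True)
  qed
  also have "\<dots> \<le> 3 / 4 * real ?w ^ (5 * h) / (real n ^ (5 * h) * (1 + 2 / (real n - 8)) ^ (5 * h * n))"
    using w d n16 H by (intro frac_le mult_left_mono power_mono mult_pos_pos) (auto intro!: zero_less_power add_pos_nonneg)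
  finally show ?thesis .
qed

section \<open>Cokernels of Hermite matrices\<close>

text \<open>Lower triangular with powers of 2 on the diagonal, so that its columns span a lattice of
  2-power index.\<close>

definition hermite_matrix :: "(nat \<Rightarrow> nat) \<Rightarrow> (nat \<Rightarrow> nat \<Rightarrow> int) \<Rightarrow> nat \<Rightarrow> nat \<Rightarrow> int" where
  "hermite_matrix a c j i = (if i = j then 2 ^ a j else if i < j then c j i else 0)"

text \<open>Each entry below the diagonal is reduced modulo the pivot of its row, which makes the
  form unique. Fewer than \<open>h\<close> pivots differ from 1, so the quotient has fewer than
  \<open>h\<close> generators; \<open>A\<close> only keeps the set finite.\<close>

definition hermite_data :: "nat \<Rightarrow> nat \<Rightarrow> nat \<Rightarrow> ((nat \<Rightarrow> nat) \<times> (nat \<Rightarrow> nat \<Rightarrow> int)) set" where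
  "hermite_data m A h =
     (SIGMA a:{a. a \<in> {..<m} \<rightarrow>\<^sub>E {..A} \<and> card {j. j < m \<and> a j \<noteq> 0} < h}.
        PiE {..<m} (\<lambda>j. {..<j} \<rightarrow>\<^sub>E {0..<2 ^ a j}))"

abbreviation hermite_lattice :: "nat \<Rightarrow> (nat \<Rightarrow> nat) \<times> (nat \<Rightarrow> nat \<Rightarrow> int) \<Rightarrow> (nat \<Rightarrow> int) \<Rightarrow> bool" where
  "hermite_lattice m H \<equiv> in_lattice {..<m} {..<m} (hermite_matrix (fst H) (snd H))"

lemma hermite_sum:
  assumes "j < m"
  shows "(\<Sum>i<m. hermite_matrix a c j i * g i) = 2 ^ a j * g j + (\<Sum>i<j. c j i * g i)"
proof -
  have "(\<Sum>i<m. hermite_matrix a c j i * g i) = (\<Sum>i<Suc j. hermite_matrix a c j i * g i)"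
    using assms by (intro sum.mono_neutral_right) (auto simp: hermite_matrix_def)
  also have "\<dots> = (\<Sum>i<j. hermite_matrix a c j i * g i) + 2 ^ a j * g j"
    by (simp add: hermite_matrix_def)
  also have "(\<Sum>i<j. hermite_matrix a c j i * g i) = (\<Sum>i<j. c j i * g i)"
    by (intro sum.cong) (auto simp: hermite_matrix_def)
  finally show ?thesis by simp
qed

lemma hermite_column:
  assumes k: "k < m"
  shows "hermite_lattice m (a, c) (\<lambda>j. hermite_matrix a c j k)"
  unfolding in_lattice_def
proof (intro exI[of _ "\<lambda>i. if i = k then 1 else 0"] ballI)
  fix j assume "j \<in> {..<m}"
  have "(\<Sum>i<m. hermite_matrix a c j i * (if i = k then 1 else 0)) = (\<Sum>i<m. if i = k then hermite_matrix a c j k else 0)"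
    by (intro sum.cong) auto
  then show "hermite_matrix a c j k = (\<Sum>i<m. hermite_matrix (fst (a, c)) (snd (a, c)) j i * (if i = k then 1 else 0))"
    using k by simp
qed

text \<open>Forward substitution: column \<open>k\<close> vanishes above row \<open>k\<close>, hence
  so do the coefficients of the columns before \<open>k\<close>.\<close>

lemma hermite_compare:
  assumes l: "hermite_lattice m (a, c) (\<lambda>j. hermite_matrix a' c' j k)" and k: "k < m"
  shows "\<exists>g. 2 ^ a' k = 2 ^ a k * g k \<and>
    (\<forall>j. k < j \<longrightarrow> j < m \<longrightarrow> c' j k = 2 ^ a j * g j + (\<Sum>i\<in>{k..<j}. c j i * g i))"
proof -
  obtain g where "\<And>j. j < m \<Longrightarrow> hermite_matrix a' c' j k = (\<Sum>i<m. hermite_matrix a c j i * g i)"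
    using l unfolding in_lattice_def by auto
  then have g: "hermite_matrix a' c' j k = 2 ^ a j * g j + (\<Sum>i<j. c j i * g i)" if "j < m" for j
    using that by (simp add: hermite_sum)
  have 0: "g j = 0" if "j < k" for j
    using that
  proof (induction j rule: less_induct)
    case (less j)
    have "(\<Sum>i<j. c j i * g i) = 0" using less by (intro sum.neutral) auto
    then show ?case using g[of j] less.prems k by (simp add: hermite_matrix_def)
  qed
  have s: "(\<Sum>i<j. c j i * g i) = (\<Sum>i\<in>{k..<j}. c j i * g i)" for j
    using 0 by (intro sum.mono_neutral_right) auto
  show ?thesis
  proof (intro exI[of _ g] conjI allI impI)
    show "2 ^ a' k = 2 ^ a k * g k" using g[OF k] s[of k] by (simp add: hermite_matrix_def)
    show "c' j k = 2 ^ a j * g j + (\<Sum>i\<in>{k..<j}. c j i * g i)" if "k < j" "j < m" for j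
      using g[OF that(2)] s[of j] that(1) by (simp add: hermite_matrix_def)
  qed
qed

text \<open>Uniqueness of the Hermite normal form. Comparing column \<open>k\<close> in both
  directions makes the pivots divide each other; then column \<open>k\<close> is compared row by row
  below the diagonal.\<close>

lemma hermite_lattice_inj:
  assumes H: "H \<in> hermite_data m A h" and H': "H' \<in> hermite_data m A h"
    and eq: "\<And>x. hermite_lattice m H x = hermite_lattice m H' x"
  shows "H = H'"
proof -
  obtain a c a' c' where HH: "H = (a, c)" "H' = (a', c')" by (cases H, cases H') auto
  have l: "hermite_lattice m (a, c) (\<lambda>j. hermite_matrix a' c' j k)"
    "hermite_lattice m (a', c') (\<lambda>j. hermite_matrix a c j k)" if "k < m" for k
    using eq hermite_column[OF that] unfolding HH by blast+
  have d: "a \<in> {..<m} \<rightarrow>\<^sub>E {..A}" "a' \<in> {..<m} \<rightarrow>\<^sub>E {..A}"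
    "c \<in> PiE {..<m} (\<lambda>j. {..<j} \<rightarrow>\<^sub>E {0..<2 ^ a j})" "c' \<in> PiE {..<m} (\<lambda>j. {..<j} \<rightarrow>\<^sub>E {0..<2 ^ a' j})"
    using H H' unfolding HH hermite_data_def by auto
  have ak: "a k = a' k" if k: "k < m" for k
  proof -
    have "(2 :: int) ^ a k dvd 2 ^ a' k" using hermite_compare[OF l(1)[OF k] k] by (auto intro: dvdI)
    then have "(2 :: int) ^ a k \<le> 2 ^ a' k" by (rule zdvd_imp_le) simp
    moreover have "(2 :: int) ^ a' k dvd 2 ^ a k" using hermite_compare[OF l(2)[OF k] k] by (auto intro: dvdI)
    then have "(2 :: int) ^ a' k \<le> 2 ^ a k" by (rule zdvd_imp_le) simp
    ultimately show ?thesis by simp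
  qed
  have a: "a = a'" using d(1,2) ak by (intro PiE_ext[of a "{..<m}" "\<lambda>_. {..A}"]) auto
  have ck: "c j k = c' j k" if jk: "k < j" "j < m" for j k
  proof -
    have k: "k < m" using jk by simp
    obtain g where g0: "2 ^ a' k = 2 ^ a k * g k \<and>
      (\<forall>j. k < j \<longrightarrow> j < m \<longrightarrow> c' j k = 2 ^ a j * g j + (\<Sum>i\<in>{k..<j}. c j i * g i))"
      using hermite_compare[OF l(1)[OF k] k] by (elim exE)
    have g: "2 ^ a' k = 2 ^ a k * g k" using g0 by (rule conjunct1)
    have g': "c' j k = 2 ^ a j * g j + (\<Sum>i\<in>{k..<j}. c j i * g i)" if "k < j" "j < m" for j
      using conjunct2[OF g0] that by simp
    have gk: "g k = 1" using g a by simp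
    \<comment> \<open>Both claims are proved together: once the coefficients strictly between
      \<open>k\<close> and \<open>j\<close> vanish, the two entries in row \<open>j\<close> are
      congruent modulo the pivot. Both are reduced, so they agree, and then
      \<open>g j = 0\<close>.\<close>
    have "g j = 0 \<and> c j k = c' j k" if "k < j" "j < m" for j
      using that
    proof (induction j rule: less_induct)
      case (less j)
      have "(\<Sum>i\<in>{k..<j}. c j i * g i) = c j k * g k + (\<Sum>i\<in>{Suc k..<j}. c j i * g i)"
        using less.prems(1) by (rule sum.atLeast_Suc_lessThan)
      also have "(\<Sum>i\<in>{Suc k..<j}. c j i * g i) = 0"
        using less.IH less.prems by (intro sum.neutral) auto
      finally have e: "c' j k = 2 ^ a j * g j + c j k" using g'[OF less.prems] gk by simp
      have "c j k \<in> {0..<2 ^ a j}" "c' j k \<in> {0..<2 ^ a j}"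
        using PiE_mem[OF PiE_mem[OF d(3), of j], of k] PiE_mem[OF PiE_mem[OF d(4), of j], of k] less.prems a by auto
      then have r: "c j k mod 2 ^ a j = c j k" "c' j k mod 2 ^ a j = c' j k" by auto
      have "c' j k mod 2 ^ a j = c j k mod 2 ^ a j" unfolding e by simp
      then have "c' j k = c j k" using r by simp
      then show ?case using e by simp
    qed
    then show ?thesis using jk by blast
  qed
  have "c = c'"
  proof (rule PiE_ext[OF d(3)])
    show "c' \<in> PiE {..<m} (\<lambda>j. {..<j} \<rightarrow>\<^sub>E {0..<2 ^ a j})" using d(4) a by simp
    fix j assume "j \<in> {..<m}"
    then have "c j \<in> {..<j} \<rightarrow>\<^sub>E {0..<2 ^ a j}" "c' j \<in> {..<j} \<rightarrow>\<^sub>E {0..<2 ^ a j}"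
      using PiE_mem[OF d(3)] PiE_mem[OF d(4)] a by auto
    then show "c j = c' j" using ck \<open>j \<in> {..<m}\<close> by (intro PiE_ext) auto
  qed
  then show ?thesis unfolding HH using a by simp
qed

lemma hermite_transversal:
  "\<exists>R. finite R \<and> card R = 2 ^ (\<Sum>j<m. a j) \<and> transversal {..<m} {..<m} (hermite_matrix a c) R"
proof -
  let ?A = "mat m m (\<lambda>(i, j). hermite_matrix a c i j)"
  have "det ?A = prod_list (diag_mat ?A)"
    by (rule det_lower_triangular[of m]) (auto simp: hermite_matrix_def)
  also have "\<dots> = (\<Prod>i = 0..<m. 2 ^ a i)" by (simp add: prod_list_diag_prod hermite_matrix_def)
  also have "\<dots> = 2 ^ (\<Sum>j<m. a j)" by (simp add: power_sum lessThan_atLeast0)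
  finally have d: "ndet m (hermite_matrix a c) = 2 ^ (\<Sum>j<m. a j)" .
  then obtain R where R: "finite R" "int (card R) = 2 ^ (\<Sum>j<m. a j)" "transversal {..<m} {..<m} (hermite_matrix a c) R"
    using transversal_nat[of m "hermite_matrix a c"] by auto
  have "int (card R) = int (2 ^ (\<Sum>j<m. a j))" using R(2) by simp
  then have "card R = 2 ^ (\<Sum>j<m. a j)" by (simp only: of_nat_eq_iff)
  then show ?thesis using R by blast
qed

lemma in_lattice_diff:
  assumes "in_lattice I S a x" "in_lattice I S a y"
  shows "in_lattice I S a (\<lambda>i. x i - y i)"
proof -
  obtain z z' where z: "\<forall>i\<in>I. x i = (\<Sum>k\<in>S. a i k * z k)" "\<forall>i\<in>I. y i = (\<Sum>k\<in>S. a i k * z' k)"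
    using assms unfolding in_lattice_def by blast
  show ?thesis unfolding in_lattice_def
    by (rule exI[of _ "\<lambda>k. z k - z' k"]) (simp add: z right_diff_distrib sum_subtractf)
qed

lemma in_lattice_zero: "in_lattice I S a (\<lambda>_. 0)"
  unfolding in_lattice_def by (rule exI[of _ "\<lambda>_. 0"]) simp

lemma in_lattice_uminus: "in_lattice I S a x \<Longrightarrow> in_lattice I S a (\<lambda>i. - x i)"
  using in_lattice_diff[OF in_lattice_zero] by simp

lemma in_lattice_add: "in_lattice I S a x \<Longrightarrow> in_lattice I S a y \<Longrightarrow> in_lattice I S a (\<lambda>i. x i + y i)"
  using in_lattice_diff[OF _ in_lattice_uminus, of I S a x y] by simp

section \<open>The quotient groups as groups of natural numbers\<close>

lemma transversal_classes:
  assumes R: "finite R" "transversal I S a R"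
  shows "\<exists>\<kappa> :: ('i \<Rightarrow> int) \<Rightarrow> nat. (\<forall>x y. \<kappa> x = \<kappa> y \<longleftrightarrow> in_lattice I S a (\<lambda>i. x i - y i)) \<and>
    finite (range \<kappa>) \<and> card (range \<kappa>) = card R"
proof -
  obtain f :: "('i \<Rightarrow> int) \<Rightarrow> nat" where f: "inj_on f R" using finite_imp_inj_to_nat_seg[OF R(1)] by blast
  have "\<forall>x. \<exists>r. r \<in> R \<and> in_lattice I S a (\<lambda>i. x i - r i)"
    using R(2) unfolding transversal_def by (intro allI) (drule spec, erule ex1_implies_ex)
  then obtain \<rho> where \<rho>: "\<And>x. \<rho> x \<in> R" "\<And>x. in_lattice I S a (\<lambda>i. x i - \<rho> x i)" by metis
  have uniq: "r = \<rho> x" if "r \<in> R" "in_lattice I S a (\<lambda>i. x i - r i)" for r x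
    using transversalE[OF R(2), of x] \<rho>[of x] that by metis
  have eq: "\<rho> x = \<rho> y \<longleftrightarrow> in_lattice I S a (\<lambda>i. x i - y i)" for x y
  proof
    assume "\<rho> x = \<rho> y"
    then show "in_lattice I S a (\<lambda>i. x i - y i)" using in_lattice_diff[OF \<rho>(2)[of x] \<rho>(2)[of y]] by simp
  next
    assume "in_lattice I S a (\<lambda>i. x i - y i)"
    then have "in_lattice I S a (\<lambda>i. (x i - y i) + (y i - \<rho> y i))" using \<rho>(2)[of y] by (rule in_lattice_add)
    then have "in_lattice I S a (\<lambda>i. x i - \<rho> y i)" by simp
    then show "\<rho> x = \<rho> y" using uniq[OF \<rho>(1)] by simp
  qed
  have "r \<in> range \<rho>" if "r \<in> R" for r
  proof -
    have "r = \<rho> r" by (rule uniq[OF that]) (simp add: in_lattice_zero)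
    then show ?thesis by (rule range_eqI[of r \<rho> r])
  qed
  then have rr: "range \<rho> = R" using \<rho>(1) by blast
  show ?thesis
  proof (intro exI[of _ "\<lambda>x. f (\<rho> x)"] conjI allI)
    show "f (\<rho> x) = f (\<rho> y) \<longleftrightarrow> in_lattice I S a (\<lambda>i. x i - y i)" for x y
      using inj_on_eq_iff[OF f \<rho>(1) \<rho>(1)] eq by simp
    have r: "range (\<lambda>x. f (\<rho> x)) = f ` R" unfolding rr[symmetric] by (rule image_image[symmetric])
    show "finite (range (\<lambda>x. f (\<rho> x)))" using R(1) by (simp add: r)
    show "card (range (\<lambda>x. f (\<rho> x))) = card R" unfolding r by (rule card_image[OF f])
  qed
qed

text \<open>Coset map with values in the natural numbers, because the limit law is stated for groups
  of type \<open>nat monoid\<close>.\<close>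

definition hclass :: "nat \<Rightarrow> (nat \<Rightarrow> nat) \<times> (nat \<Rightarrow> nat \<Rightarrow> int) \<Rightarrow> (nat \<Rightarrow> int) \<Rightarrow> nat" where
  "hclass m H = (SOME \<kappa>. (\<forall>x y. \<kappa> x = \<kappa> y \<longleftrightarrow> hermite_lattice m H (\<lambda>i. x i - y i)) \<and>
    finite (range \<kappa>) \<and> card (range \<kappa>) = 2 ^ (\<Sum>j<m. fst H j))"

lemma hclass: "hclass m H x = hclass m H y \<longleftrightarrow> hermite_lattice m H (\<lambda>i. x i - y i)"
  "finite (range (hclass m H))" "card (range (hclass m H)) = 2 ^ (\<Sum>j<m. fst H j)"
proof -
  obtain R where R: "finite R" "card R = 2 ^ (\<Sum>j<m. fst H j)"
    "transversal {..<m} {..<m} (hermite_matrix (fst H) (snd H)) R"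
    using hermite_transversal[where a = "fst H" and c = "snd H"] by blast
  have "\<exists>\<kappa> :: (nat \<Rightarrow> int) \<Rightarrow> nat. (\<forall>x y. \<kappa> x = \<kappa> y \<longleftrightarrow> hermite_lattice m H (\<lambda>i. x i - y i)) \<and>
    finite (range \<kappa>) \<and> card (range \<kappa>) = 2 ^ (\<Sum>j<m. fst H j)"
    using transversal_classes[OF R(1,3)] unfolding R(2) .
  from someI_ex[OF this] have s: "(\<forall>x y. hclass m H x = hclass m H y \<longleftrightarrow> hermite_lattice m H (\<lambda>i. x i - y i)) \<and>
    finite (range (hclass m H)) \<and> card (range (hclass m H)) = 2 ^ (\<Sum>j<m. fst H j)" unfolding hclass_def .
  then show "hclass m H x = hclass m H y \<longleftrightarrow> hermite_lattice m H (\<lambda>i. x i - y i)"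
    "finite (range (hclass m H))" "card (range (hclass m H)) = 2 ^ (\<Sum>j<m. fst H j)" by simp_all
qed

text \<open>The quotient by the Hermite lattice, transported to the codes of cosets. Products go
  through arbitrary preimages of the codes; \<open>hgroup_mult\<close> shows that the choice is
  irrelevant.\<close>

definition hgroup :: "nat \<Rightarrow> (nat \<Rightarrow> nat) \<times> (nat \<Rightarrow> nat \<Rightarrow> int) \<Rightarrow> nat monoid" where
  "hgroup m H = \<lparr>carrier = range (hclass m H),
     mult = (\<lambda>p q. hclass m H (\<lambda>i. inv_into UNIV (hclass m H) p i + inv_into UNIV (hclass m H) q i)),
     one = hclass m H (\<lambda>_. 0)\<rparr>"

lemma hgroup_carrier: "carrier (hgroup m H) = range (hclass m H)"
  and hgroup_one: "\<one>\<^bsub>hgroup m H\<^esub> = hclass m H (\<lambda>_. 0)"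
  by (simp_all add: hgroup_def)

lemma hgroup_mult: "hclass m H x \<otimes>\<^bsub>hgroup m H\<^esub> hclass m H y = hclass m H (\<lambda>i. x i + y i)"
proof -
  let ?\<kappa> = "hclass m H" let ?s = "inv_into UNIV ?\<kappa>"
  have e: "?\<kappa> (?s (?\<kappa> x)) = ?\<kappa> x" for x using f_inv_into_f[of "?\<kappa> x" ?\<kappa> UNIV] by simp
  have "hermite_lattice m H (\<lambda>i. (?s (?\<kappa> x) i - x i) + (?s (?\<kappa> y) i - y i))"
    using e[of x] e[of y] unfolding hclass(1) by (rule in_lattice_add)
  then have "?\<kappa> (\<lambda>i. ?s (?\<kappa> x) i + ?s (?\<kappa> y) i) = ?\<kappa> (\<lambda>i. x i + y i)"
    unfolding hclass(1) by (simp add: algebra_simps)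
  then show ?thesis by (simp add: hgroup_def)
qed

lemma hgroup_comm_group: "comm_group (hgroup m H)"
proof (rule comm_groupI; unfold hgroup_carrier hgroup_one)
  show "\<exists>y\<in>range (hclass m H). y \<otimes>\<^bsub>hgroup m H\<^esub> x = hclass m H (\<lambda>_. 0)" if x: "x \<in> range (hclass m H)" for x
  proof -
    obtain f where "x = hclass m H f" using x by blast
    then have "hclass m H (\<lambda>i. - f i) \<otimes>\<^bsub>hgroup m H\<^esub> x = hclass m H (\<lambda>_. 0)" by (simp add: hgroup_mult)
    then show ?thesis by blast
  qed
qed (auto simp: hgroup_mult algebra_simps)

lemma hgroup_p_group: "finite_abelian_p_group 2 (hgroup m H)"
  unfolding finite_abelian_p_group_def order_def using hgroup_comm_group hclass(2,3)[of m H] by (auto simp: hgroup_carrier)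

text \<open>Up to values outside \<open>{..<m}\<close>, \<open>x\<close> is an integer combination
  of the unit vectors in its support. The principle serves both for membership in a generated
  subgroup and for the equality of two homomorphisms.\<close>

lemma closed_contains:
  assumes zero: "\<And>x. (\<And>i. i < m \<Longrightarrow> x i = 0) \<Longrightarrow> S (x :: nat \<Rightarrow> int)"
    and add: "\<And>x y. S x \<Longrightarrow> S y \<Longrightarrow> S (\<lambda>i. x i + y i)" and neg: "\<And>x. S x \<Longrightarrow> S (\<lambda>i. - x i)"
    and e: "\<And>j. j < m \<Longrightarrow> x j \<noteq> 0 \<Longrightarrow> S (\<lambda>i. if i = j then 1 else 0)"
  shows "S x"
proof -
  have mult: "S (\<lambda>i. int k * (if i = j then 1 else 0))" if "S (\<lambda>i. if i = j then 1 else 0)" for k j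
  proof (induction k)
    case 0
    then show ?case using zero by simp
  next
    case (Suc k)
    show ?case using add[OF Suc that] by (simp add: algebra_simps)
  qed
  have multz: "S (\<lambda>i. if i = j then x j else 0)" if "j < m" for j
  proof (cases "x j = 0")
    case True
    then show ?thesis using zero[of "\<lambda>_. 0"] by (simp cong: if_cong)
  next
    case False
    note Sj = mult[OF e[OF that False], of "nat \<bar>x j\<bar>"]
    show ?thesis
    proof (cases "x j \<ge> 0")
      case True
      then have "int (nat \<bar>x j\<bar>) * (if i = j then 1 else 0) = (if i = j then x j else 0)" for i
        by (cases "i = j") simp_all
      then show ?thesis using Sj by simp
    next
      case False
      then have "- (int (nat \<bar>x j\<bar>) * (if i = j then 1 else 0)) = (if i = j then x j else 0)" for i
        by (cases "i = j") simp_all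
      then show ?thesis using neg[OF Sj] by simp
    qed
  qed
  have "S (\<lambda>i. if i < k then x i else 0)" if "k \<le> m" for k
    using that
  proof (induction k)
    case 0
    then show ?case using assms(1) by simp
  next
    case (Suc k)
    have "(\<lambda>i. (if i < k then x i else 0) + (if i = k then x k else 0)) = (\<lambda>i. if i < Suc k then x i else 0)"
      by (auto simp: fun_eq_iff)
    then show ?case using add[OF Suc.IH multz[of k]] Suc.prems by simp
  qed
  then have a: "S (\<lambda>i. if i < m then x i else 0)" by simp
  have b: "S (\<lambda>i. if i < m then 0 else x i)" by (rule zero) simp
  have "S (\<lambda>i. (if i < m then x i else 0) + (if i < m then 0 else x i))" by (rule add[OF a b])
  moreover have "(\<lambda>i. (if i < m then x i else 0) + (if i < m then 0 else x i)) = x" by auto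
  ultimately show ?thesis by simp
qed

text \<open>The unit vectors with \<open>a j \<noteq> 0\<close> generate. If \<open>a j = 0\<close>,
  column \<open>j\<close> expresses the unit vector \<open>u j\<close>, modulo the lattice, through
  vectors \<open>u i\<close> with \<open>i > j\<close> and \<open>c i j \<noteq> 0\<close>; such an
  entry lies below \<open>2 ^ a i\<close>, which forces \<open>a i \<noteq> 0\<close>.\<close>

lemma hgroup_generated:
  assumes H: "H \<in> hermite_data m A h"
  obtains B where "B \<subseteq> carrier (hgroup m H)" "finite B" "card B < h" "generate (hgroup m H) B = carrier (hgroup m H)"
proof -
  obtain a c where HH: "H = (a, c)" by (cases H)
  have d: "card {j. j < m \<and> a j \<noteq> 0} < h" "c \<in> PiE {..<m} (\<lambda>j. {..<j} \<rightarrow>\<^sub>E {0..<2 ^ a j})"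
    using H unfolding HH hermite_data_def by auto
  interpret G: comm_group "hgroup m H" by (rule hgroup_comm_group)
  define u where "u j = (\<lambda>i. if i = j then 1 else 0 :: int)" for j :: nat
  define B where "B = (\<lambda>j. hclass m H (u j)) ` {j. j < m \<and> a j \<noteq> 0}"
  have B: "B \<subseteq> carrier (hgroup m H)" by (auto simp: B_def hgroup_carrier)
  have sg: "subgroup (generate (hgroup m H) B) (hgroup m H)" by (rule G.generate_is_subgroup[OF B])
  define S where "S x \<longleftrightarrow> hclass m H x \<in> generate (hgroup m H) B" for x
  have zero: "S x" if "hermite_lattice m H x" for x
  proof -
    have "hclass m H x = \<one>\<^bsub>hgroup m H\<^esub>" unfolding hgroup_one hclass(1) using that by simp
    then show ?thesis unfolding S_def using subgroup.one_closed[OF sg] by simp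
  qed
  have zero': "S x" if "\<And>i. i < m \<Longrightarrow> x i = 0" for x
    using that by (intro zero) (auto simp: in_lattice_def intro!: exI[of _ "\<lambda>_. 0"])
  have add: "S (\<lambda>i. x i + y i)" if "S x" "S y" for x y
    using subgroup.m_closed[OF sg] that unfolding S_def hgroup_mult[symmetric] by blast
  have neg: "S (\<lambda>i. - x i)" if "S x" for x
  proof -
    have "hclass m H (\<lambda>i. - x i) \<otimes>\<^bsub>hgroup m H\<^esub> hclass m H x = \<one>\<^bsub>hgroup m H\<^esub>" by (simp add: hgroup_mult hgroup_one)
    then have "inv\<^bsub>hgroup m H\<^esub> (hclass m H x) = hclass m H (\<lambda>i. - x i)"
      by (intro G.inv_equality) (auto simp: hgroup_carrier)
    then show ?thesis using subgroup.m_inv_closed[OF sg] that unfolding S_def by metis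
  qed
  have uB: "S (u j)" if "j < m" "a j \<noteq> 0" for j
    unfolding S_def using that by (intro generate.incl) (auto simp: B_def)
  have uS: "S (u j)" if j: "j < m" for j
  proof (cases "a j = 0")
    case True
    let ?y = "\<lambda>i. hermite_matrix a c i j - u j i"
    have "S ?y"
    proof (rule closed_contains[of m S, OF zero' add neg])
      fix i assume i: "i < m" "?y i \<noteq> 0"
      then have ij: "j < i" "c i j \<noteq> 0" using True by (auto simp: hermite_matrix_def u_def split: if_splits)
      have "c i j \<in> {0..<2 ^ a i}" using PiE_mem[OF PiE_mem[OF d(2), of i], of j] i(1) ij(1) by auto
      then have "a i \<noteq> 0" using ij(2) by (cases "a i = 0") auto
      then show "S (\<lambda>k. if k = i then 1 else 0)" using uB[OF i(1)] by (simp add: u_def)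
    qed
    then have "S (\<lambda>i. hermite_matrix a c i j + - ?y i)"
      using hermite_column[OF j, of a c] unfolding HH[symmetric] by (rule add[OF zero neg, rotated])
    then show ?thesis by simp
  qed (rule uB[OF j])
  have "S x" for x
    by (rule closed_contains[of m S, OF zero' add neg]) (use uS in \<open>simp_all add: u_def\<close>)
  then have "generate (hgroup m H) B = carrier (hgroup m H)"
    using subgroup.subset[OF sg] by (auto simp: S_def hgroup_carrier)
  moreover have "card B < h" unfolding B_def using card_image_le[of "{j. j < m \<and> a j \<noteq> 0}" "\<lambda>j. hclass m H (u j)"] d(1) by simp
  ultimately show ?thesis using that[of B] B by (simp add: B_def)
qed

text \<open>A pair of a Hermite form with cokernel \<open>G\<close> and an automorphism of \<open>G\<close> is determined by the
  images in \<open>G\<close> of the unit vectors.\<close>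

lemma hermite_count:
  assumes G: "comm_group (G :: nat monoid)" "finite (carrier G)"
    and D: "D \<subseteq> hermite_data m A h" "\<And>H. H \<in> D \<Longrightarrow> hgroup m H \<cong> G"
  shows "card D * card (auto G) \<le> order G ^ m"
proof -
  interpret G: comm_group G by fact
  have "\<forall>H\<in>D. \<exists>\<phi>. \<phi> \<in> iso (hgroup m H) G" using D(2) unfolding is_iso_def by blast
  then obtain \<phi> where \<phi>: "\<And>H. H \<in> D \<Longrightarrow> \<phi> H \<in> iso (hgroup m H) G" by metis
  \<comment> \<open>The composite of the quotient map, the chosen isomorphism and the automorphism:
    a surjection onto \<open>G\<close> whose kernel is the Hermite lattice.\<close>
  define \<psi> where "\<psi> z x = snd z (\<phi> (fst z) (hclass m (fst z) x))"
    for z :: "((nat \<Rightarrow> nat) \<times> (nat \<Rightarrow> nat \<Rightarrow> int)) \<times> (nat \<Rightarrow> nat)" and x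
  let ?Z = "D \<times> auto G"
  define F where "F z = (\<lambda>j\<in>{..<m}. \<psi> z (\<lambda>i. if i = j then 1 else 0))" for z
  have \<phi>in: "\<phi> H (hclass m H x) \<in> carrier G" if "H \<in> D" for H x
    using \<phi>[OF that] by (auto simp: iso_def hom_def hgroup_carrier)
  have \<psi>in: "\<psi> z x \<in> carrier G" if "z \<in> ?Z" for z x
    using that \<phi>in by (auto simp: \<psi>_def auto_def hom_def)
  have \<psi>add: "\<psi> z (\<lambda>i. x i + y i) = \<psi> z x \<otimes>\<^bsub>G\<^esub> \<psi> z y" if "z \<in> ?Z" for z x y
  proof -
    obtain H \<alpha> where z1: "z = (H, \<alpha>)" by (cases z)
    then have z: "z = (H, \<alpha>)" "H \<in> D" "\<alpha> \<in> hom G G" using that by (simp_all add: auto_def)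
    have "\<phi> H (hclass m H (\<lambda>i. x i + y i)) = \<phi> H (hclass m H x) \<otimes>\<^bsub>G\<^esub> \<phi> H (hclass m H y)"
      unfolding hgroup_mult[symmetric] using \<phi>[OF z(2)] by (intro hom_mult[of _ "hgroup m H" G]) (auto simp: iso_def hgroup_carrier)
    then show ?thesis using hom_mult[OF z(3) \<phi>in[OF z(2)] \<phi>in[OF z(2)]] by (simp add: \<psi>_def z(1))
  qed
  have \<psi>eq: "\<psi> z x = \<psi> z y \<longleftrightarrow> hermite_lattice m (fst z) (\<lambda>i. x i - y i)" if "z \<in> ?Z" for z x y
  proof -
    obtain H \<alpha> where z1: "z = (H, \<alpha>)" by (cases z)
    then have z: "z = (H, \<alpha>)" "H \<in> D" "\<alpha> \<in> Bij (carrier G)" using that by (simp_all add: auto_def)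
    have "inj_on \<alpha> (carrier G)" using z(3) by (simp add: Bij_def bij_betw_def)
    moreover have "inj_on (\<phi> H) (carrier (hgroup m H))" using \<phi>[OF z(2)] by (simp add: iso_iff)
    ultimately have "\<alpha> (\<phi> H (hclass m H x)) = \<alpha> (\<phi> H (hclass m H y)) \<longleftrightarrow> hclass m H x = hclass m H y"
      using inj_on_eq_iff[of \<alpha> "carrier G" "\<phi> H (hclass m H x)" "\<phi> H (hclass m H y)"] \<phi>in[OF z(2)]
        inj_on_eq_iff[of "\<phi> H" "carrier (hgroup m H)" "hclass m H x" "hclass m H y"] by (simp add: hgroup_carrier)
    then show ?thesis unfolding \<psi>_def z(1) fst_conv snd_conv hclass(1) .
  qed
  have "inj_on F ?Z"
  proof (rule inj_onI)
    fix z z' assume z: "z \<in> ?Z" "z' \<in> ?Z" and eq: "F z = F z'"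
    have e: "\<psi> z (\<lambda>i. if i = j then 1 else 0) = \<psi> z' (\<lambda>i. if i = j then 1 else 0)" if "j < m" for j
      using fun_cong[OF eq, of j] that by (simp add: F_def)
    have \<psi>0: "\<psi> y x = \<one>\<^bsub>G\<^esub>" if y: "y \<in> ?Z" and x: "\<And>i. i < m \<Longrightarrow> x i = 0" for y x
    proof -
      have "\<psi> y (\<lambda>i. x i + x i) = \<psi> y x" unfolding \<psi>eq[OF y] using x
        by (auto simp: in_lattice_def intro!: exI[of _ "\<lambda>_. 0"])
      then have "\<psi> y x \<otimes>\<^bsub>G\<^esub> \<psi> y x = \<psi> y x" by (rule trans[OF \<psi>add[OF y, symmetric]])
      then show ?thesis using G.r_cancel_one[OF \<psi>in[OF y] \<psi>in[OF y]] by simp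
    qed
    have eqx: "\<psi> z x = \<psi> z' x" for x
    proof (rule closed_contains[of m "\<lambda>x. \<psi> z x = \<psi> z' x"])
      show "\<psi> z x = \<psi> z' x" if "\<And>i. i < m \<Longrightarrow> x i = 0" for x using \<psi>0[OF z(1) that] \<psi>0[OF z(2) that] by simp
      show "\<psi> z (\<lambda>i. x i + y i) = \<psi> z' (\<lambda>i. x i + y i)" if "\<psi> z x = \<psi> z' x" "\<psi> z y = \<psi> z' y" for x y
        using that by (simp add: \<psi>add[OF z(1)] \<psi>add[OF z(2)])
      show "\<psi> z (\<lambda>i. - x i) = \<psi> z' (\<lambda>i. - x i)" if "\<psi> z x = \<psi> z' x" for x
      proof -
        have i: "\<psi> y (\<lambda>i. - x i) = inv\<^bsub>G\<^esub> \<psi> y x" if "y \<in> ?Z" for y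
          using \<psi>add[OF that, of "\<lambda>i. - x i" x] \<psi>0[OF that, of "\<lambda>_. 0"]
          by (intro G.inv_equality[symmetric]) (simp_all add: \<psi>in[OF that])
        show ?thesis unfolding i[OF z(1)] i[OF z(2)] that ..
      qed
      show "\<psi> z (\<lambda>i. if i = j then 1 else 0) = \<psi> z' (\<lambda>i. if i = j then 1 else 0)" if "j < m" for j by (rule e[OF that])
    qed
    \<comment> \<open>Equal surjections have equal kernels, so the Hermite forms agree; surjectivity
      then gives the equality of the automorphisms.\<close>
    have l: "hermite_lattice m (fst z) x = hermite_lattice m (fst z') x" for x
      using \<psi>eq[OF z(1), of x "\<lambda>_. 0"] \<psi>eq[OF z(2), of x "\<lambda>_. 0"] eqx by simp
    have f: "fst z = fst z'" using z D(1) by (intro hermite_lattice_inj[OF _ _ l]) auto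
    have "snd z = snd z'"
    proof (rule extensionalityI[of _ "carrier G"])
      show "snd z \<in> extensional (carrier G)" "snd z' \<in> extensional (carrier G)" using z by (auto simp: auto_def Bij_def)
      fix g assume "g \<in> carrier G"
      moreover have "\<phi> (fst z) ` range (hclass m (fst z)) = carrier G"
      proof -
        have "fst z \<in> D" using z(1) by auto
        then show ?thesis using \<phi>[of "fst z"] by (simp add: iso_iff hgroup_carrier)
      qed
      ultimately obtain x where "g = \<phi> (fst z) (hclass m (fst z) x)" by blast
      then show "snd z g = snd z' g" using eqx[of x] f by (simp add: \<psi>_def)
    qed
    then show "z = z'" using f by (simp add: prod_eq_iff)
  qed
  moreover have "F ` ?Z \<subseteq> {..<m} \<rightarrow>\<^sub>E carrier G"
  proof (rule image_subsetI)
    fix z assume z: "z \<in> ?Z"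
    show "F z \<in> {..<m} \<rightarrow>\<^sub>E carrier G" unfolding F_def using \<psi>in[OF z] by (simp add: PiE_iff)
  qed
  moreover have "finite ({..<m} \<rightarrow>\<^sub>E carrier G)" using G(2) by (simp add: finite_PiE)
  ultimately have "card ?Z \<le> card ({..<m} \<rightarrow>\<^sub>E carrier G)" by (rule card_inj_on_le)
  then show ?thesis by (simp add: card_cartesian_product card_PiE order_def)
qed

lemma finite_hermite_data: "finite (hermite_data m A h)"
  unfolding hermite_data_def
proof (rule finite_SigmaI)
  show "finite {a. a \<in> {..<m} \<rightarrow>\<^sub>E {..A} \<and> card {j. j < m \<and> a j \<noteq> 0} < h}"
    by (rule finite_subset[of _ "{..<m} \<rightarrow>\<^sub>E {..A}"]) (auto intro: finite_PiE)
qed (intro finite_PiE; simp)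

text \<open>This is the origin of the weight: row \<open>j\<close> leaves \<open>j\<close> free
  residues modulo \<open>2 ^ a j\<close>, and the \<open>m\<close>-th power of the order contributes
  \<open>2 ^ a j\<close> to the power \<open>m\<close>, so the exponent \<open>a j * (m - j)\<close>
  remains in the denominator.\<close>

lemma hermite_weight_sum: "hermite_weight m A h = (\<Sum>H\<in>hermite_data m A h. 1 / real (order (hgroup m H)) ^ m)"
proof -
  let ?A = "{a. a \<in> {..<m} \<rightarrow>\<^sub>E {..A} \<and> card {j. j < m \<and> a j \<noteq> 0} < h}"
  let ?C = "\<lambda>a. PiE {..<m} (\<lambda>j. {..<j} \<rightarrow>\<^sub>E {0..<(2 :: int) ^ a j})"
  have o: "real (order (hgroup m (a, c))) = 2 ^ (\<Sum>j<m. a j)" for a c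
    using hclass(3)[of m "(a, c)"] by (simp add: order_def hgroup_carrier)
  have fA: "finite ?A" by (rule finite_subset[of _ "{..<m} \<rightarrow>\<^sub>E {..A}"]) (auto intro: finite_PiE)
  have "(\<Sum>H\<in>hermite_data m A h. 1 / real (order (hgroup m H)) ^ m) = (\<Sum>a\<in>?A. \<Sum>c\<in>?C a. 1 / real (order (hgroup m (a, c))) ^ m)"
    unfolding hermite_data_def using fA by (subst sum.Sigma) (auto intro!: finite_PiE sum.cong)
  also have "\<dots> = (\<Sum>a\<in>?A. \<Prod>j<m. (1 / 2) ^ (a j * (m - j)))"
  proof (rule sum.cong[OF refl])
    fix a
    have "(\<Sum>c\<in>?C a. 1 / real (order (hgroup m (a, c))) ^ m) = real (card (?C a)) / (2 ^ (\<Sum>j<m. a j)) ^ m" by (simp add: o)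
    also have "card (?C a) = (\<Prod>j<m. (2 ^ a j) ^ j)" by (simp add: card_PiE nat_power_eq)
    also have "((2 :: real) ^ (\<Sum>j<m. a j)) ^ m = (\<Prod>j<m. (2 ^ a j) ^ m)" by (simp add: power_sum prod_power_distrib)
    also have "real (\<Prod>j<m. (2 ^ a j) ^ j) / (\<Prod>j<m. (2 ^ a j) ^ m) = (\<Prod>j<m. (2 ^ a j) ^ j / (2 ^ a j) ^ m)"
      by (simp add: prod_dividef)
    also have "\<dots> = (\<Prod>j<m. (1 / 2) ^ (a j * (m - j)))"
    proof (rule prod.cong[OF refl])
      fix j assume "j \<in> {..<m}"
      then have "((2 :: real) ^ a j) ^ m = (2 ^ a j) ^ j * (2 ^ a j) ^ (m - j)" by (simp add: power_add[symmetric])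
      then show "((2 :: real) ^ a j) ^ j / (2 ^ a j) ^ m = (1 / 2) ^ (a j * (m - j))"
        by (simp add: power_mult power_one_over)
    qed
    finally show "(\<Sum>c\<in>?C a. 1 / real (order (hgroup m (a, c))) ^ m) = (\<Prod>j<m. (1 / 2) ^ (a j * (m - j)))" .
  qed
  finally show ?thesis unfolding hermite_weight_def by simp
qed

text \<open>The forms are grouped by the isomorphism type of their quotient. By
  \<open>hermite_count\<close> a type \<open>G\<close> contributes at most
  \<open>1 / card (auto G)\<close>, its Cohen-Lenstra mass up to the constant.\<close>

lemma hermite_weight_reps:
  obtains \<R> :: "nat monoid set" where "finite \<R>" "\<And>G. G \<in> \<R> \<Longrightarrow> \<exists>H\<in>hermite_data m A h. G = hgroup m H"
    "\<And>G G'. G \<in> \<R> \<Longrightarrow> G' \<in> \<R> \<Longrightarrow> G \<cong> G' \<Longrightarrow> G = G'"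
    "hermite_weight m A h \<le> (\<Sum>G\<in>\<R>. 1 / real (card (auto G)))"
proof -
  let ?D = "hermite_data m A h" and ?N = "hgroup m"
  \<comment> \<open>The chosen representative depends only on the isomorphism class, because
    isomorphic quotients give equivalent predicates under the choice operator.\<close>
  define r where "r H = ?N (SOME H'. H' \<in> ?D \<and> ?N H \<cong> ?N H')" for H
  have grp: "group (?N H)" for H using hgroup_comm_group[of m H] by (simp add: comm_group_def)
  have r: "\<exists>H'\<in>?D. r H = ?N H' \<and> ?N H \<cong> ?N H'" if "H \<in> ?D" for H
  proof -
    have "\<exists>H'. H' \<in> ?D \<and> ?N H \<cong> ?N H'" using that iso_refl by blast
    from someI_ex[OF this] show ?thesis unfolding r_def by blast
  qed
  have req: "r H = r H'" if "?N H \<cong> ?N H'" for H H'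
  proof -
    have "?N H \<cong> ?N H'' \<longleftrightarrow> ?N H' \<cong> ?N H''" for H''
      using iso_trans[OF that, of "?N H''"] iso_trans[OF group.iso_sym[OF grp that], of "?N H''"] by blast
    then show ?thesis unfolding r_def by simp
  qed
  have "hermite_weight m A h = (\<Sum>G\<in>r ` ?D. \<Sum>H | H \<in> ?D \<and> r H = G. 1 / real (order (?N H)) ^ m)"
    unfolding hermite_weight_sum by (rule sum.image_gen[OF finite_hermite_data])
  also have "\<dots> \<le> (\<Sum>G\<in>r ` ?D. 1 / real (card (auto G)))"
  proof (rule sum_mono)
    fix G assume "G \<in> r ` ?D"
    then obtain H1 where H1: "H1 \<in> ?D" "G = r H1" by blast
    obtain H0 where H0: "H0 \<in> ?D" "G = ?N H0" using r[OF H1(1)] unfolding H1(2) by blast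
    let ?E = "{H \<in> ?D. r H = G}"
    have iso: "?N H \<cong> G" if "H \<in> ?E" for H using r[of H] that by auto
    have fin: "finite (carrier G)" unfolding H0(2) hgroup_carrier by (rule hclass(2))
    have oG: "order (?N H) = order G" if "H \<in> ?E" for H using iso_same_card[OF iso[OF that]] by (simp add: order_def)
    have pos: "order G > 0" using fin unfolding order_def H0(2) hgroup_carrier by (simp add: card_gt_0_iff)
    have "id_auto": "restrict (\<lambda>x. x) (carrier G) \<in> auto G"
      using grp[of H0] unfolding H0(2) by (rule group.id_in_auto)
    have "finite (auto G)" using fin by (intro finite_subset[OF _ finite_PiE[of "carrier G" "\<lambda>_. carrier G"]]) (auto simp: auto_def Bij_def hom_def PiE_def)
    then have apos: "card (auto G) > 0" using id_auto by (auto simp: card_gt_0_iff)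
    have "real (card ?E) * real (card (auto G)) \<le> real (order G) ^ m"
      using hermite_count[of G ?E m A h] hgroup_comm_group fin iso H0(2)
      by (metis (no_types, lifting) mem_Collect_eq of_nat_le_iff of_nat_mult of_nat_power subsetI)
    then have "real (card ?E) / real (order G) ^ m \<le> 1 / real (card (auto G))"
      using pos apos by (simp add: field_simps)
    then show "(\<Sum>H | H \<in> ?D \<and> r H = G. 1 / real (order (?N H)) ^ m) \<le> 1 / real (card (auto G))"
      using oG by simp
  qed
  finally have w: "hermite_weight m A h \<le> (\<Sum>G\<in>r ` ?D. 1 / real (card (auto G)))" .
  show ?thesis
  proof (rule that[OF _ _ _ w])
    show "finite (r ` ?D)" using finite_hermite_data by blast
    show "\<exists>H\<in>?D. G = ?N H" if G: "G \<in> r ` ?D" for G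
    proof -
      obtain H where H: "H \<in> ?D" "G = r H" using G by blast
      show ?thesis using r[OF H(1)] unfolding H(2) by blast
    qed
    show "G = G'" if G: "G \<in> r ` ?D" "G' \<in> r ` ?D" "G \<cong> G'" for G G'
    proof -
      obtain H H' where H: "H \<in> ?D" "G = r H" "H' \<in> ?D" "G' = r H'" using G by auto
      have a: "?N H \<cong> G" "?N H' \<cong> G'" using r[OF H(1)] r[OF H(3)] H by auto
      have "?N H \<cong> ?N H'" using iso_trans[OF iso_trans[OF a(1) G(3)] group.iso_sym[OF grp a(2)]] .
      then show ?thesis using req H by simp
    qed
  qed
qed

section \<open>Incidence of triangles and edges\<close>

lemma fdet_transpose: "fdet I I (\<lambda>i j. a j i) = fdet I I a"
  by (simp only: fdet_def det_mat_Leibniz_rows[of "card I" "\<lambda>i j. a (enum_of I j) (enum_of I i)"]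
      det_mat_Leibniz[of "card I" "\<lambda>i j. a (enum_of I i) (enum_of I j)"])

lemma fdet_zero_row:
  assumes I: "finite I" and S: "finite S" "card S = card I" and i: "i \<in> I" "\<And>k. k \<in> S \<Longrightarrow> a i k = 0"
  shows "fdet I S a = 0"
  unfolding fdet_def det_mat_Leibniz
proof (rule sum.neutral, clarify)
  fix p assume p: "p permutes {0..<card I}"
  obtain i' where i': "i' < card I" "i = enum_of I i'" using enum_of_surj[OF I i(1)] by blast
  have "p i' < card S" using permutes_in_image[OF p, of i'] i' S by simp
  then have "a (enum_of I i') (enum_of S (p i')) = 0" using i(2) enum_of_mem[OF S(1)] i'(2) by simp
  then have "(\<Prod>i<card I. a (enum_of I i) (enum_of S (p i))) = 0" using i'(1) by (intro prod_zero) auto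
  then show "signof p * (\<Prod>i<card I. a (enum_of I i) (enum_of S (p i))) = 0" by simp
qed

abbreviation less_sign :: "nat \<Rightarrow> nat \<Rightarrow> int" where
  "less_sign a b \<equiv> (if a < b then - 1 else 1)"

lemma incidence_remove:
  assumes "finite \<tau>" "v \<in> \<tau>"
  shows "incidence \<tau> (\<tau> - {v}) = (- 1) ^ card {u \<in> \<tau>. u < v}"
proof -
  have "(\<Sum>w\<in>\<tau>. if \<tau> - {v} = \<tau> - {w} then (- 1) ^ card {u \<in> \<tau>. u < w} else 0 :: int)
      = (\<Sum>w\<in>\<tau>. if w = v then (- 1) ^ card {u \<in> \<tau>. u < w} else 0)"
    using assms by (intro sum.cong) auto
  then show ?thesis using assms by (simp add: incidence_def)
qed

lemma incidence_nonzero: "incidence \<tau> \<sigma> \<noteq> 0 \<Longrightarrow> \<exists>v\<in>\<tau>. \<sigma> = \<tau> - {v}"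
  unfolding incidence_def by (rule ccontr) (simp add: sum.neutral)

lemma incidence_subset: "incidence \<tau> \<sigma> \<noteq> 0 \<Longrightarrow> \<sigma> \<subseteq> \<tau>"
  using incidence_nonzero[of \<tau> \<sigma>] by blast

lemma incidence_square:
  assumes "finite \<tau>" "\<sigma> \<subseteq> \<tau>" "card \<tau> = Suc (card \<sigma>)"
  shows "(incidence \<tau> \<sigma>)\<^sup>2 = 1"
proof -
  have "card (\<tau> - \<sigma>) = 1" using assms by (simp add: card_Diff_subset finite_subset)
  then obtain v where "\<tau> - \<sigma> = {v}" by (auto simp: card_1_singleton_iff)
  then have v: "v \<in> \<tau>" "\<sigma> = \<tau> - {v}" using assms(2) by auto
  show ?thesis unfolding v(2) incidence_remove[OF assms(1) v(1)]
    by (simp add: power_mult[symmetric] mult.commute[of _ 2] power_mult)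
qed

lemma incidence_vertex:
  assumes "a \<noteq> b"
  shows "incidence {a, b} {a} = less_sign a b"
proof -
  have "{u \<in> {a, b}. u < b} = (if a < b then {a} else {})" by auto
  moreover have "{a} = {a, b} - {b}" using assms by auto
  ultimately show ?thesis using incidence_remove[of "{a, b}" b] by simp
qed

lemma incidence_edge:
  assumes "a \<noteq> b" "a \<noteq> c" "b \<noteq> c"
  shows "incidence {a, b, c} {a, b} = less_sign a c * less_sign b c"
proof -
  have "{u \<in> {a, b, c}. u < c} = (if a < c then {a} else {}) \<union> (if b < c then {b} else {})" by auto
  moreover have "{a, b} = {a, b, c} - {c}" using assms by auto
  ultimately show ?thesis using incidence_remove[of "{a, b, c}" c] assms by simp
qed

lemma incidence_triangle_other:
  assumes "a \<noteq> b" "a \<noteq> c" "b \<noteq> c" "e \<notin> {{a, b}, {b, c}, {a, c}}"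
  shows "incidence {a, b, c} e = 0"
proof (rule ccontr)
  assume "incidence {a, b, c} e \<noteq> 0"
  then obtain v where "v \<in> {a, b, c}" "e = {a, b, c} - {v}" using incidence_nonzero by blast
  moreover have "{a, b, c} - {a} = {b, c}" "{a, b, c} - {b} = {a, c}" "{a, b, c} - {c} = {a, b}"
    using assms by auto
  ultimately show False using assms(4) by auto
qed

text \<open>Extension by zero lets a triangle have sides outside \<open>J\<close>.\<close>

lemma sum_triangle:
  fixes f :: "nat set \<Rightarrow> 'a :: comm_ring_1"
  assumes d: "a \<noteq> b" "a \<noteq> c" "b \<noteq> c" and J: "finite J"
    and g: "g = (\<lambda>e. if e \<in> J then f e else 0)"
  shows "(\<Sum>e\<in>J. of_int (incidence {a, b, c} e) * f e) =
    of_int (less_sign a c * less_sign b c) * g {a, b} + of_int (less_sign b a * less_sign c a) * g {b, c} +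
    of_int (less_sign a b * less_sign c b) * g {a, c}"
proof -
  let ?T = "{{a, b}, {b, c}, {a, c}}"
  have ne: "{a, b} \<noteq> {b, c}" "{a, b} \<noteq> {a, c}" "{b, c} \<noteq> {a, c}" using d by (auto simp: doubleton_eq_iff)
  have "(\<Sum>e\<in>J. of_int (incidence {a, b, c} e) * f e) = (\<Sum>e\<in>J. of_int (incidence {a, b, c} e) * g e)"
    by (simp add: g)
  also have "\<dots> = (\<Sum>e\<in>J \<union> ?T. of_int (incidence {a, b, c} e) * g e)"
    using J by (intro sum.mono_neutral_left) (auto simp: g)
  also have "\<dots> = (\<Sum>e\<in>?T. of_int (incidence {a, b, c} e) * g e)"
    using J d by (intro sum.mono_neutral_right) (auto simp: incidence_triangle_other)
  also have "\<dots> = of_int (incidence {a, b, c} {a, b}) * g {a, b} + of_int (incidence {a, b, c} {b, c}) * g {b, c} +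
      of_int (incidence {a, b, c} {a, c}) * g {a, c}"
    using ne by (simp add: add.assoc)
  also have "incidence {a, b, c} {b, c} = less_sign b a * less_sign c a"
    using incidence_edge[of b c a] d by (simp add: insert_commute)
  also have "incidence {a, b, c} {a, c} = less_sign a b * less_sign c b"
    using incidence_edge[of a c b] d by (simp add: insert_commute)
  also have "incidence {a, b, c} {a, b} = less_sign a c * less_sign b c"
    by (rule incidence_edge[OF d])
  finally show ?thesis .
qed

text \<open>For distinct arguments this is antisymmetric. Up to one global sign, the sum over a
  triangle becomes a cyclic sum, free of case distinctions on the order of the vertices.\<close>

definition oriented :: "(nat set \<Rightarrow> 'a :: comm_ring_1) \<Rightarrow> nat \<Rightarrow> nat \<Rightarrow> 'a" where
  "oriented f a b = (if a < b then f {a, b} else - f {a, b})"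

lemma sum_triangle_oriented:
  fixes f :: "nat set \<Rightarrow> 'a :: comm_ring_1"
  assumes d: "a \<noteq> b" "a \<noteq> c" "b \<noteq> c" and J: "finite J"
    and g: "g = (\<lambda>e. if e \<in> J then f e else 0)"
  shows "(\<Sum>e\<in>J. of_int (incidence {a, b, c} e) * f e) =
    of_int (less_sign a b * less_sign b c * less_sign a c) * - (oriented g a b + oriented g b c + oriented g c a)"
proof -
  have "(b < a) = (\<not> a < b)" "(c < b) = (\<not> b < c)" "(c < a) = (\<not> a < c)" using d by auto
  moreover have "{b, a} = {a, b}" "{c, b} = {b, c}" "{c, a} = {a, c}" by auto
  ultimately show ?thesis
    unfolding sum_triangle[OF d J g]
    by (cases "a < b"; cases "b < c"; cases "a < c"; simp add: oriented_def)
qed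

lemma boundary_boundary:
  assumes "a \<noteq> b" "a \<noteq> c" "b \<noteq> c" "finite J" "{a, b} \<in> J" "{b, c} \<in> J" "{a, c} \<in> J"
  shows "(\<Sum>e\<in>J. incidence {a, b, c} e * incidence e {v}) = 0"
proof -
  have o: "incidence {x, y} {v} = (if v = x then less_sign x y else if v = y then less_sign y x else 0)"
    if "x \<noteq> y" for x y
  proof -
    have "incidence {x, y} {v} = 0" if "v \<noteq> x" "v \<noteq> y"
      using incidence_nonzero[of "{x, y}" "{v}"] that by blast
    then show ?thesis using incidence_vertex[OF that] incidence_vertex[of y x] that by (auto simp: insert_commute)
  qed
  define A B C p q r :: int where "A = of_bool (v = a)" and "B = of_bool (v = b)" and "C = of_bool (v = c)"
    and "p = less_sign a b" and "q = less_sign b c" and "r = less_sign a c"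
  note defs = A_def B_def C_def p_def q_def r_def
  have i: "incidence {a, b} {v} = p * A - p * B" "incidence {b, c} {v} = q * B - q * C"
    "incidence {a, c} {v} = r * A - r * C"
    unfolding o[OF assms(1)] o[OF assms(2)] o[OF assms(3)] using assms by (auto simp: defs)
  have l: "less_sign b a = - p" "less_sign c b = - q" "less_sign c a = - r" using assms by (auto simp: defs)
  have "(\<Sum>e\<in>J. of_int (incidence {a, b, c} e) * incidence e {v}) =
      of_int (r * q) * incidence {a, b} {v} + of_int (- p * - r) * incidence {b, c} {v} + of_int (p * - q) * incidence {a, c} {v}"
    unfolding sum_triangle[OF assms(1-4) refl] l p_def[symmetric] q_def[symmetric] r_def[symmetric]
    using assms by (simp only: if_True)
  also have "\<dots> = 0" unfolding i by (simp add: algebra_simps)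
  finally show ?thesis by simp
qed

section \<open>Edges avoiding the root, and the Gram identity\<close>

definition edges_off :: "nat \<Rightarrow> nat set set" where
  "edges_off n = {e. e \<subseteq> {2..n} \<and> card e = 2}"

definition triangles :: "nat \<Rightarrow> nat set set" where
  "triangles n = {t. t \<subseteq> {1..n} \<and> card t = 3}"

lemma finite_edges_off: "finite (edges_off n)" and finite_triangles: "finite (triangles n)"
  unfolding edges_off_def triangles_def by auto

lemma edges_offE:
  assumes "e \<in> edges_off n"
  obtains a b where "e = {a, b}" "a \<noteq> b" "a \<in> {2..n}" "b \<in> {2..n}"
  using assms unfolding edges_off_def by (auto simp: card_2_iff)

lemma edges_off_at:
  assumes "e \<in> edges_off n" "a \<in> e"
  obtains b where "e = {a, b}" "a \<noteq> b" "b \<in> {2..n}"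
proof -
  obtain x y where xy: "e = {x, y}" "x \<noteq> y" "x \<in> {2..n}" "y \<in> {2..n}" using edges_offE[OF assms(1)] .
  show thesis
  proof (cases "a = x")
    case True
    then show ?thesis using that[of y] xy by simp
  next
    case False
    then show ?thesis using that[of x] xy assms(2) by (auto simp: insert_commute)
  qed
qed

text \<open>The upper and lower Laplacians of the full complex add up to \<open>n\<close>. An edge
  lies in \<open>n - 2\<close> triangles and has 2 endpoints; two edges with a common vertex span
  exactly one triangle, whose contribution cancels that of the vertex; disjoint edges contribute
  nothing.\<close>

lemma edge_gram:
  assumes e: "e \<in> edges_off n" and e': "e' \<in> edges_off n"
  shows "(\<Sum>t\<in>triangles n. incidence t e * incidence t e') + (\<Sum>v\<in>{2..n}. incidence e {v} * incidence e' {v})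
    = (if e = e' then int n else 0)"
proof (cases "e = e'")
  case True
  obtain a b where ab: "e = {a, b}" "a \<noteq> b" "a \<in> {2..n}" "b \<in> {2..n}" using edges_offE[OF e] .
  have inj: "inj_on (\<lambda>x. insert x e) ({1..n} - e)" by (auto simp: inj_on_def)
  have sup: "incidence t e * incidence t e = (if e \<subseteq> t then 1 else 0)" if "t \<in> triangles n" for t
  proof (cases "e \<subseteq> t")
    case True
    have "finite t" "card t = Suc (card e)" using that e finite_subset[of t "{1..n}"]
      by (auto simp: triangles_def edges_off_def)
    then show ?thesis using incidence_square[of t e] True by (simp add: power2_eq_square)
  next
    case False
    then show ?thesis using incidence_nonzero[of t e] by auto
  qed
  have "(\<Sum>t\<in>triangles n. incidence t e * incidence t e') = (\<Sum>t\<in>triangles n. if e \<subseteq> t then 1 else 0)"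
    unfolding True[symmetric] by (intro sum.cong refl sup)
  also have "\<dots> = (\<Sum>t\<in>{t \<in> triangles n. e \<subseteq> t}. 1)"
    by (rule sum.inter_filter[symmetric]) (rule finite_triangles)
  also have "{t \<in> triangles n. e \<subseteq> t} = (\<lambda>x. insert x e) ` ({1..n} - e)"
  proof safe
    fix t assume t: "t \<in> triangles n" "e \<subseteq> t"
    have ft: "finite t" using t(1) finite_subset[of t "{1..n}"] by (auto simp: triangles_def)
    have "card (t - e) = 1" using t e ft by (simp add: card_Diff_subset finite_subset triangles_def edges_off_def)
    then obtain x where "t - e = {x}" by (auto simp: card_1_singleton_iff)
    then have "t = insert x e" "x \<in> {1..n} - e" using t by (auto simp: triangles_def)
    then show "t \<in> (\<lambda>x. insert x e) ` ({1..n} - e)" by blast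
  next
    fix x assume "x \<in> {1..n}" "x \<notin> e"
    then show "insert x e \<in> triangles n" using ab by (auto simp: triangles_def)
  qed
  also have "(\<Sum>t\<in>(\<lambda>x. insert x e) ` ({1..n} - e). 1 :: int) = int (card ({1..n} - e))"
    by (simp only: card_image[OF inj, symmetric] sum_constant mult_1_right)
  also have "card ({1..n} - e) = n - 2" using ab by (subst card_Diff_subset) auto
  finally have 1: "(\<Sum>t\<in>triangles n. incidence t e * incidence t e') = int (n - 2)" .
  have "(\<Sum>v\<in>{2..n}. incidence e {v} * incidence e' {v}) = (\<Sum>v\<in>{a, b}. incidence e {v} * incidence e {v})"
    unfolding True[symmetric]
  proof (rule sum.mono_neutral_right)
    show "\<forall>v\<in>{2..n} - {a, b}. incidence e {v} * incidence e {v} = 0"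
    proof
      fix v assume "v \<in> {2..n} - {a, b}"
      then have "incidence e {v} = 0" using incidence_nonzero[of e "{v}"] ab(1) by blast
      then show "incidence e {v} * incidence e {v} = 0" by simp
    qed
  qed (use ab in auto)
  also have "\<dots> = 2"
    using incidence_vertex[OF ab(2)] incidence_vertex[OF ab(2)[symmetric]] ab(1,2)
    by (auto simp: insert_commute)
  finally show ?thesis using 1 True ab by (auto simp: of_nat_diff)
next
  case False
  show ?thesis
  proof (cases "e \<inter> e' = {}")
    case True
    have "incidence t e * incidence t e' = 0" if "t \<in> triangles n" for t
    proof (rule ccontr)
      assume "incidence t e * incidence t e' \<noteq> 0"
      then have "e \<union> e' \<subseteq> t" using incidence_subset[of t e] incidence_subset[of t e'] by simp
      moreover have "finite t" "card t = 3" using that finite_subset[of t "{1..n}"] by (auto simp: triangles_def)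
      moreover have "card (e \<union> e') = 4"
        using e e' True by (subst card_Un_disjoint) (auto simp: edges_off_def intro: finite_subset)
      ultimately show False using card_mono[of t "e \<union> e'"] by simp
    qed
    moreover have "incidence e {v} * incidence e' {v} = 0" for v
      using incidence_subset[of e "{v}"] incidence_subset[of e' "{v}"] True by auto
    ultimately show ?thesis using False by (simp add: sum.neutral del: mult_eq_0_iff)
  next
    case nonempty: False
    then obtain a where a: "a \<in> e" "a \<in> e'" by blast
    obtain b where b: "e = {a, b}" "a \<noteq> b" "b \<in> {2..n}" using edges_off_at[OF e a(1)] .
    obtain c where c: "e' = {a, c}" "a \<noteq> c" "c \<in> {2..n}" using edges_off_at[OF e' a(2)] .
    have bc: "b \<noteq> c" using False b c by auto
    have an: "a \<in> {2..n}" using e a by (auto simp: edges_off_def)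
    let ?t = "{a, b, c}"
    have t: "?t \<in> triangles n" using an b c bc by (auto simp: triangles_def)
    have "(\<Sum>t\<in>triangles n. incidence t e * incidence t e') = (\<Sum>t\<in>{?t}. incidence t e * incidence t e')"
    proof (rule sum.mono_neutral_right[OF finite_triangles])
      show "\<forall>s\<in>triangles n - {?t}. incidence s e * incidence s e' = 0"
      proof (rule ballI, rule ccontr)
        fix s assume s: "s \<in> triangles n - {?t}" and nz: "incidence s e * incidence s e' \<noteq> 0"
        then have "?t \<subseteq> s" using incidence_subset[of s e] incidence_subset[of s e'] b(1) c(1) by simp
        moreover have "finite s" "card s = card ?t"
          using s b c bc finite_subset[of s "{1..n}"] by (auto simp: triangles_def)
        ultimately have "?t = s" by (metis card_subset_eq)
        then show False using s by simp
      qed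
    qed (use t in auto)
    also have "\<dots> = (less_sign a c * less_sign b c) * (less_sign a b * less_sign c b)"
      using incidence_edge[of a b c] incidence_edge[of a c b] b c bc by (simp add: insert_commute)
    finally have 1: "(\<Sum>t\<in>triangles n. incidence t e * incidence t e') = (less_sign a c * less_sign b c) * (less_sign a b * less_sign c b)" .
    have "(\<Sum>v\<in>{2..n}. incidence e {v} * incidence e' {v}) = (\<Sum>v\<in>{a}. incidence e {v} * incidence e' {v})"
    proof (rule sum.mono_neutral_right)
      show "\<forall>v\<in>{2..n} - {a}. incidence e {v} * incidence e' {v} = 0"
      proof (rule ballI, rule ccontr)
        fix v assume v: "v \<in> {2..n} - {a}" "incidence e {v} * incidence e' {v} \<noteq> 0"
        then have "v \<in> e \<inter> e'" using incidence_subset[of e "{v}"] incidence_subset[of e' "{v}"] by simp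
        then show False using v(1) b(1) c(1) bc by auto
      qed
    qed (use an in auto)
    also have "\<dots> = less_sign a b * less_sign a c"
      using incidence_vertex[OF b(2)] incidence_vertex[OF c(2)] b(1) c(1) by simp
    finally show ?thesis using 1 False bc by auto
  qed
qed

section \<open>Homology as a quotient module\<close>

text \<open>\<open>Q\<close> has the shape of \<open>homology\<close>. Its scalar multiplication is
  a union over representatives; this is a single coset because \<open>B\<close> is closed under
  scalars.\<close>

lemma quotient_module:
  fixes R (structure)
  assumes "module R N" and "Module.submodule B R N"
  defines "Q \<equiv> \<lparr>carrier = a_rcosets\<^bsub>N\<^esub> B, mult = (\<lambda>X Y. B), one = B, zero = B,
      add = (\<lambda>X Y. X <+>\<^bsub>N\<^esub> Y), smult = (\<lambda>r X. \<Union>x\<in>X. B +>\<^bsub>N\<^esub> (r \<odot>\<^bsub>N\<^esub> x))\<rparr>"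
  shows "module R Q"
    and "carrier Q = (\<lambda>x. B +>\<^bsub>N\<^esub> x) ` carrier N"
    and "\<And>x y. x \<in> carrier N \<Longrightarrow> y \<in> carrier N \<Longrightarrow> (B +>\<^bsub>N\<^esub> x) \<oplus>\<^bsub>Q\<^esub> (B +>\<^bsub>N\<^esub> y) = B +>\<^bsub>N\<^esub> (x \<oplus>\<^bsub>N\<^esub> y)"
    and "\<And>r x. r \<in> carrier R \<Longrightarrow> x \<in> carrier N \<Longrightarrow> r \<odot>\<^bsub>Q\<^esub> (B +>\<^bsub>N\<^esub> x) = B +>\<^bsub>N\<^esub> (r \<odot>\<^bsub>N\<^esub> x)"
    and "\<And>x y. x \<in> carrier N \<Longrightarrow> y \<in> carrier N \<Longrightarrow> B +>\<^bsub>N\<^esub> x = B +>\<^bsub>N\<^esub> y \<longleftrightarrow> x \<ominus>\<^bsub>N\<^esub> y \<in> B"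
proof -
  interpret N: module R N by fact
  interpret B: Module.submodule B R N by fact
  interpret abelian_subgroup B N
    by (rule abelian_subgroupI3) (unfold_locales, simp add: B.subgroup_axioms)
  let ?rc = "\<lambda>x. B +>\<^bsub>N\<^esub> x"
  have B_sub: "B \<subseteq> carrier N" by (rule a_subset)
  show car: "carrier Q = ?rc ` carrier N" by (auto simp: Q_def A_RCOSETS_def')
  have addQ: "X \<oplus>\<^bsub>Q\<^esub> Y = X <+>\<^bsub>N\<^esub> Y" for X Y by (simp add: Q_def)
  show add: "?rc x \<oplus>\<^bsub>Q\<^esub> ?rc y = ?rc (x \<oplus>\<^bsub>N\<^esub> y)" if "x \<in> carrier N" "y \<in> carrier N" for x y
    using that by (simp add: addQ a_rcos_sum)
  have zero: "\<zero>\<^bsub>Q\<^esub> = ?rc \<zero>\<^bsub>N\<^esub>"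
    using B_sub by (simp add: Q_def N.a_coset_add_zero)
  show eq: "?rc x = ?rc y \<longleftrightarrow> x \<ominus>\<^bsub>N\<^esub> y \<in> B" if "x \<in> carrier N" "y \<in> carrier N" for x y
    using that a_rcos_module[OF that(2,1)] a_rcos_self[OF that(1)] a_repr_independence'[of x y]
    by (auto simp: N.minus_eq)
  show sm: "r \<odot>\<^bsub>Q\<^esub> ?rc x = ?rc (r \<odot>\<^bsub>N\<^esub> x)" if r: "r \<in> carrier R" and x: "x \<in> carrier N" for r x
  proof -
    have c: "?rc (r \<odot>\<^bsub>N\<^esub> y) = ?rc (r \<odot>\<^bsub>N\<^esub> x)" if y: "y \<in> ?rc x" for y
    proof -
      obtain b where b: "b \<in> B" "y = b \<oplus>\<^bsub>N\<^esub> x" using y by (auto simp: a_r_coset_def')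
      have bN: "b \<in> carrier N" using b B_sub by auto
      have d: "r \<odot>\<^bsub>N\<^esub> y \<ominus>\<^bsub>N\<^esub> r \<odot>\<^bsub>N\<^esub> x = r \<odot>\<^bsub>N\<^esub> b"
        using r x bN b by (simp add: N.smult_r_distr N.minus_eq N.a_assoc N.r_neg)
      have ry: "r \<odot>\<^bsub>N\<^esub> y \<in> carrier N" "r \<odot>\<^bsub>N\<^esub> x \<in> carrier N" using r x bN b by simp_all
      show ?thesis unfolding eq[OF ry] d by (rule B.smult_closed[OF r b(1)])
    qed
    have "(\<Union>y\<in>?rc x. ?rc (r \<odot>\<^bsub>N\<^esub> y)) = (\<Union>y\<in>?rc x. ?rc (r \<odot>\<^bsub>N\<^esub> x))"
      by (rule SUP_cong[OF refl]) (rule c)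
    also have "\<dots> = ?rc (r \<odot>\<^bsub>N\<^esub> x)" using a_rcos_self[OF x] by (intro SUP_const) blast
    finally show ?thesis by (simp add: Q_def)
  qed
  show "module R Q"
  proof (rule moduleI)
    show "cring R" by (rule N.R.cring_axioms)
    show "abelian_group Q"
    proof (rule abelian_groupI)
      fix X assume "X \<in> carrier Q"
      then obtain x where x: "x \<in> carrier N" "X = ?rc x" unfolding car by auto
      then show "\<exists>Y\<in>carrier Q. Y \<oplus>\<^bsub>Q\<^esub> X = \<zero>\<^bsub>Q\<^esub>"
        unfolding car by (auto intro!: bexI[of _ "\<ominus>\<^bsub>N\<^esub> x"] simp: add zero N.l_neg)
    next
      fix X Y assume "X \<in> carrier Q" "Y \<in> carrier Q"
      then obtain x y where "x \<in> carrier N" "X = ?rc x" "y \<in> carrier N" "Y = ?rc y" unfolding car by auto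
      then show "X \<oplus>\<^bsub>Q\<^esub> Y = Y \<oplus>\<^bsub>Q\<^esub> X" by (simp add: add N.a_comm[of x y])
    qed (auto simp: car add zero N.a_assoc)
  qed (auto simp: car add sm N.smult_l_distr N.smult_r_distr N.smult_assoc1)
qed

text \<open>Treats integral and mod 2 homology at once: since \<open>x mod 0 = x\<close>, the ring
  of integers is the case \<open>m = 0\<close>.\<close>

locale int_quotient_ring =
  fixes R :: "int ring" and m :: int
  assumes cring: "cring R" and carrier_R: "carrier R = {x. x mod m = x}"
    and add_R: "\<And>x y. x \<oplus>\<^bsub>R\<^esub> y = (x + y) mod m"
    and mult_R: "\<And>x y. x \<otimes>\<^bsub>R\<^esub> y = (x * y) mod m"
    and zero_R: "\<zero>\<^bsub>R\<^esub> = 0" and one_R: "\<one>\<^bsub>R\<^esub> = 1"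

interpretation Z0: int_quotient_ring \<Z> 0
  by unfold_locales (auto simp: int_is_cring)

interpretation F2: int_quotient_ring "residue_ring 2" 2
proof -
  interpret residues 2 "residue_ring 2" by unfold_locales auto
  show "int_quotient_ring (residue_ring 2) 2"
    by unfold_locales
      (auto simp: cring residue_ring_def mod_pos_pos_trivial
        intro: pos_mod_bound[of 2] simp flip: zle_diff1_eq dest: sym)
qed

declare One_nat_def [simp del]

context int_quotient_ring
begin

sublocale cring R by (rule cring)

lemma mod_carrier [simp]: "x mod m \<in> carrier R" by (simp add: carrier_R)

lemma a_inv_R: "x \<in> carrier R \<Longrightarrow> \<ominus>\<^bsub>R\<^esub> x = (- x) mod m"
  by (rule minus_equality) (auto simp: add_R zero_R mod_simps)

lemma finsum_R:
  assumes "f \<in> A \<rightarrow> carrier R"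
  shows "finsum R f A = (\<Sum>a\<in>A. f a) mod m"
  using assms
proof (induction A rule: infinite_finite_induct)
  case (insert a A)
  then show ?case by (simp add: add_R mod_simps)
qed (auto simp: zero_R finsum_infinite)

lemma add_pow_R:
  fixes k :: int
  assumes x: "x \<in> carrier R"
  shows "[k] \<cdot>\<^bsub>R\<^esub> x = (k * x) mod m"
proof -
  have nat: "[j] \<cdot>\<^bsub>R\<^esub> x = (int j * x) mod m" for j :: nat
    using x by (induction j) (auto simp: zero_R add_R mod_simps algebra_simps)
  show ?thesis
  proof (cases "k < 0")
    case True
    define j where "j = nat (- k)"
    have k: "k = - int j" using True by (simp add: j_def)
    have "[(- int j)] \<cdot>\<^bsub>R\<^esub> x = \<ominus>\<^bsub>R\<^esub> ([int j] \<cdot>\<^bsub>R\<^esub> x)"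
      unfolding add_pow_def a_inv_def by (rule group.int_pow_neg[OF a_group]) (simp add: x)
    also have "[int j] \<cdot>\<^bsub>R\<^esub> x = [j] \<cdot>\<^bsub>R\<^esub> x"
      unfolding add_pow_def by (rule int_pow_int)
    also have "\<dots> = (int j * x) mod m" by (rule nat)
    also have "\<ominus>\<^bsub>R\<^esub> ((int j * x) mod m) = (- (int j * x)) mod m"
      by (simp add: a_inv_R mod_minus_eq)
    finally show ?thesis by (simp add: k)
  next
    case False
    define j where "j = nat k"
    have k: "k = int j" using False by (simp add: j_def)
    have "[int j] \<cdot>\<^bsub>R\<^esub> x = [j] \<cdot>\<^bsub>R\<^esub> x"
      unfolding add_pow_def by (rule int_pow_int)
    then show ?thesis unfolding k nat .
  qed
qed

lemma boundary_R:
  assumes "f \<in> faces S (Suc k) \<rightarrow> carrier R"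
  shows "boundary R S k f = (\<lambda>\<sigma>\<in>faces S k. (\<Sum>\<tau>\<in>faces S (Suc k). incidence \<tau> \<sigma> * f \<tau>) mod m)"
proof -
  have "(\<Oplus>\<^bsub>R\<^esub>\<tau>\<in>faces S (Suc k). [incidence \<tau> \<sigma>] \<cdot>\<^bsub>R\<^esub> f \<tau>)
      = (\<Sum>\<tau>\<in>faces S (Suc k). (incidence \<tau> \<sigma> * f \<tau>) mod m) mod m" for \<sigma>
    using assms by (subst finsum_R) (auto simp: Pi_iff add_pow_R cong: sum.cong)
  then show ?thesis by (simp add: boundary_def mod_sum_eq)
qed

lemma chains_R:
  "carrier (chains R S k) = faces S k \<rightarrow>\<^sub>E carrier R"
  "\<zero>\<^bsub>chains R S k\<^esub> = (\<lambda>\<sigma>\<in>faces S k. 0)"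
  "f \<oplus>\<^bsub>chains R S k\<^esub> g = (\<lambda>\<sigma>\<in>faces S k. (f \<sigma> + g \<sigma>) mod m)"
  "c \<odot>\<^bsub>chains R S k\<^esub> f = (\<lambda>\<sigma>\<in>faces S k. (c * f \<sigma>) mod m)"
  by (simp_all add: chains_def func_space_def add_R mult_R zero_R)

lemma chains_module: "module R (chains R S k)"
  unfolding chains_def by (rule func_space_is_module)

lemma carrier_cycles:
  "carrier (cycles R S 1) = {f \<in> faces S 1 \<rightarrow>\<^sub>E carrier R.
     \<forall>\<sigma>\<in>faces S 0. (\<Sum>\<tau>\<in>faces S 1. incidence \<tau> \<sigma> * f \<tau>) mod m = 0}"
proof -
  have star: "boundary R S 0 f = \<zero>\<^bsub>chains R S 0\<^esub> \<longleftrightarrow>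
      (\<forall>\<sigma>\<in>faces S 0. (\<Sum>\<tau>\<in>faces S 1. incidence \<tau> \<sigma> * f \<tau>) mod m = 0)"
    if "f \<in> faces S 1 \<rightarrow>\<^sub>E carrier R" for f
  proof -
    have f: "f \<in> faces S (Suc 0) \<rightarrow> carrier R" using that by (auto simp: PiE_def One_nat_def)
    show ?thesis
      unfolding boundary_R[OF f] chains_R One_nat_def by (auto simp: fun_eq_iff restrict_def)
  qed
  have "carrier (cycles R S 1) = {f \<in> carrier (chains R S (Suc 0)). boundary R S 0 f = \<zero>\<^bsub>chains R S 0\<^esub>}"
    by (simp add: cycles_def One_nat_def a_kernel_def')
  also have "\<dots> = {f \<in> faces S 1 \<rightarrow>\<^sub>E carrier R.
     \<forall>\<sigma>\<in>faces S 0. (\<Sum>\<tau>\<in>faces S 1. incidence \<tau> \<sigma> * f \<tau>) mod m = 0}"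
    unfolding chains_R(1) One_nat_def
    by (rule Collect_cong, rule conj_cong[OF refl], rule star[unfolded One_nat_def])
  finally show ?thesis .
qed

lemma cycles_ops:
  "\<zero>\<^bsub>cycles R S 1\<^esub> = (\<lambda>\<sigma>\<in>faces S 1. 0)"
  "f \<oplus>\<^bsub>cycles R S 1\<^esub> g = (\<lambda>\<sigma>\<in>faces S 1. (f \<sigma> + g \<sigma>) mod m)"
  "c \<odot>\<^bsub>cycles R S 1\<^esub> f = (\<lambda>\<sigma>\<in>faces S 1. (c * f \<sigma>) mod m)"
  using chains_R[of S 1] by (simp_all add: cycles_def)

lemma submodule_by_smult:
  assumes N: "module R N" and "H \<subseteq> carrier N" "\<zero>\<^bsub>N\<^esub> \<in> H"
    and add: "\<And>x y. x \<in> H \<Longrightarrow> y \<in> H \<Longrightarrow> x \<oplus>\<^bsub>N\<^esub> y \<in> H"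
    and smult: "\<And>c x. c \<in> carrier R \<Longrightarrow> x \<in> H \<Longrightarrow> c \<odot>\<^bsub>N\<^esub> x \<in> H"
  shows "Module.submodule H R N"
proof -
  interpret N: module R N by fact
  show ?thesis
  proof (rule N.submoduleI)
    fix x assume x: "x \<in> H"
    then have "(\<ominus>\<^bsub>R\<^esub> \<one>\<^bsub>R\<^esub>) \<odot>\<^bsub>N\<^esub> x = \<ominus>\<^bsub>N\<^esub> x"
      using assms(2) by (auto simp: N.smult_l_minus)
    then show "\<ominus>\<^bsub>N\<^esub> x \<in> H" using smult[of "\<ominus>\<^bsub>R\<^esub> \<one>\<^bsub>R\<^esub>" x] x by simp
  qed (use assms in auto)
qed

lemma sum_mod_simps:
  "(\<Sum>\<tau>\<in>A. i \<tau> * ((c * f \<tau>) mod m)) mod m = (c * (\<Sum>\<tau>\<in>A. i \<tau> * f \<tau>)) mod m"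
  "(\<Sum>\<tau>\<in>A. i \<tau> * ((f \<tau> + g \<tau>) mod m)) mod m = ((\<Sum>\<tau>\<in>A. i \<tau> * f \<tau>) + (\<Sum>\<tau>\<in>A. i \<tau> * g \<tau>)) mod m"
  "(\<Sum>\<tau>\<in>A. i \<tau> * (h \<tau> mod m)) mod m = (\<Sum>\<tau>\<in>A. i \<tau> * h \<tau>) mod m"
proof -
  have 1: "(\<Sum>\<tau>\<in>A. i \<tau> * (h \<tau> mod m)) mod m = (\<Sum>\<tau>\<in>A. i \<tau> * h \<tau>) mod m" for h
    by (subst (1 2) mod_sum_eq[symmetric]) (simp add: mod_mult_right_eq)
  show "(\<Sum>\<tau>\<in>A. i \<tau> * (h \<tau> mod m)) mod m = (\<Sum>\<tau>\<in>A. i \<tau> * h \<tau>) mod m" by (rule 1)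
  show "(\<Sum>\<tau>\<in>A. i \<tau> * ((c * f \<tau>) mod m)) mod m = (c * (\<Sum>\<tau>\<in>A. i \<tau> * f \<tau>)) mod m"
    unfolding 1 by (simp add: sum_distrib_left mult_ac)
  show "(\<Sum>\<tau>\<in>A. i \<tau> * ((f \<tau> + g \<tau>) mod m)) mod m = ((\<Sum>\<tau>\<in>A. i \<tau> * f \<tau>) + (\<Sum>\<tau>\<in>A. i \<tau> * g \<tau>)) mod m"
    unfolding 1 by (simp add: sum.distrib algebra_simps)
qed

lemma sum_dvd_simps:
  "m dvd (\<Sum>\<tau>\<in>A. i \<tau> * ((c * f \<tau>) mod m)) \<longleftrightarrow> m dvd c * (\<Sum>\<tau>\<in>A. i \<tau> * f \<tau>)"
  "m dvd (\<Sum>\<tau>\<in>A. i \<tau> * ((f \<tau> + g \<tau>) mod m)) \<longleftrightarrow> m dvd (\<Sum>\<tau>\<in>A. i \<tau> * f \<tau>) + (\<Sum>\<tau>\<in>A. i \<tau> * g \<tau>)"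
  unfolding mod_eq_0_iff_dvd[symmetric] sum_mod_simps by (rule refl)+

lemma cycles_module: "module R (cycles R S 1)"
proof -
  have e: "cycles R S 1 = (chains R S 1)\<lparr>carrier := carrier (cycles R S 1)\<rparr>"
    by (simp add: cycles_def)
  have "Module.submodule (carrier (cycles R S 1)) R (chains R S 1)"
  proof (rule submodule_by_smult[OF chains_module])
    show "x \<oplus>\<^bsub>chains R S 1\<^esub> y \<in> carrier (cycles R S 1)"
      if "x \<in> carrier (cycles R S 1)" "y \<in> carrier (cycles R S 1)" for x y
      using that unfolding carrier_cycles chains_R
      by (auto simp: sum_dvd_simps mod_eq_0_iff_dvd cong: sum.cong)
    show "c \<odot>\<^bsub>chains R S 1\<^esub> x \<in> carrier (cycles R S 1)"
      if "c \<in> carrier R" "x \<in> carrier (cycles R S 1)" for c x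
      using that unfolding carrier_cycles chains_R
      by (auto simp: sum_dvd_simps mod_eq_0_iff_dvd cong: sum.cong)
  qed (auto simp: carrier_cycles chains_R carrier_R cong: sum.cong)
  then have "module R ((chains R S 1)\<lparr>carrier := carrier (cycles R S 1)\<rparr>)"
    by (rule Module.submodule.submodule_is_module[OF _ chains_module])
  then show ?thesis using e by simp
qed

lemma boundaries_R:
  "boundaries R S 1 = (\<lambda>g. \<lambda>\<sigma>\<in>faces S 1. (\<Sum>\<tau>\<in>faces S 2. incidence \<tau> \<sigma> * g \<tau>) mod m) ` (faces S 2 \<rightarrow>\<^sub>E carrier R)"
  unfolding boundaries_def chains_R numeral_2_eq_2 One_nat_def
  by (rule image_cong[OF refl], subst boundary_R) (auto simp: PiE_def)

text \<open>\<open>g\<close> may take arbitrary integer values, because reducing it modulo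
  \<open>m\<close> does not change the boundary. This spares carrier conditions later.\<close>

lemma boundariesI:
  "(\<lambda>\<sigma>\<in>faces S 1. (\<Sum>\<tau>\<in>faces S 2. incidence \<tau> \<sigma> * g \<tau>) mod m) \<in> boundaries R S 1"
  unfolding boundaries_R
  by (rule image_eqI[of _ _ "\<lambda>\<tau>\<in>faces S 2. g \<tau> mod m"]) (auto simp: sum_mod_simps fun_eq_iff cong: sum.cong)

lemma boundaries_submodule:
  assumes "\<And>\<tau> \<sigma>. \<tau> \<in> faces S 2 \<Longrightarrow> \<sigma> \<in> faces S 0 \<Longrightarrow> (\<Sum>\<rho>\<in>faces S 1. incidence \<rho> \<sigma> * incidence \<tau> \<rho>) = 0"
  shows "Module.submodule (boundaries R S 1) R (cycles R S 1)"
proof (rule submodule_by_smult[OF cycles_module])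
  show "boundaries R S 1 \<subseteq> carrier (cycles R S 1)"
  proof
    fix b assume "b \<in> boundaries R S 1"
    then obtain g where g: "b = (\<lambda>\<sigma>\<in>faces S 1. (\<Sum>\<tau>\<in>faces S 2. incidence \<tau> \<sigma> * g \<tau>) mod m)"
      unfolding boundaries_R by auto
    have "(\<Sum>\<rho>\<in>faces S 1. incidence \<rho> \<sigma> * b \<rho>) mod m = 0" if s: "\<sigma> \<in> faces S 0" for \<sigma>
    proof -
      have "(\<Sum>\<rho>\<in>faces S 1. incidence \<rho> \<sigma> * b \<rho>) mod m
          = (\<Sum>\<rho>\<in>faces S 1. incidence \<rho> \<sigma> * (\<Sum>\<tau>\<in>faces S 2. incidence \<tau> \<rho> * g \<tau>)) mod m"
        unfolding g by (simp add: sum_mod_simps cong: sum.cong)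
      also have "(\<Sum>\<rho>\<in>faces S 1. incidence \<rho> \<sigma> * (\<Sum>\<tau>\<in>faces S 2. incidence \<tau> \<rho> * g \<tau>))
          = (\<Sum>\<tau>\<in>faces S 2. (\<Sum>\<rho>\<in>faces S 1. incidence \<rho> \<sigma> * incidence \<tau> \<rho>) * g \<tau>)"
        unfolding sum_distrib_left sum_distrib_right by (subst sum.swap) (simp add: mult_ac)
      also have "\<dots> = 0" using assms s by simp
      finally show ?thesis by simp
    qed
    then show "b \<in> carrier (cycles R S 1)" unfolding carrier_cycles g by auto
  qed
  show "\<zero>\<^bsub>cycles R S 1\<^esub> \<in> boundaries R S 1"
    using boundariesI[where S = S and g = "\<lambda>_. 0"] unfolding cycles_ops by simp
  show "x \<oplus>\<^bsub>cycles R S 1\<^esub> y \<in> boundaries R S 1" if xy: "x \<in> boundaries R S 1" "y \<in> boundaries R S 1" for x y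
  proof -
    obtain g h where "x = (\<lambda>\<sigma>\<in>faces S 1. (\<Sum>\<tau>\<in>faces S 2. incidence \<tau> \<sigma> * g \<tau>) mod m)"
      "y = (\<lambda>\<sigma>\<in>faces S 1. (\<Sum>\<tau>\<in>faces S 2. incidence \<tau> \<sigma> * h \<tau>) mod m)"
      using xy unfolding boundaries_R by auto
    then have "x \<oplus>\<^bsub>cycles R S 1\<^esub> y = (\<lambda>\<sigma>\<in>faces S 1. (\<Sum>\<tau>\<in>faces S 2. incidence \<tau> \<sigma> * (g \<tau> + h \<tau>)) mod m)"
      unfolding cycles_ops by (auto simp: fun_eq_iff mod_add_eq sum.distrib distrib_left)
    then show ?thesis using boundariesI[where S = S and g = "\<lambda>\<tau>. g \<tau> + h \<tau>"] by simp
  qed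
  show "c \<odot>\<^bsub>cycles R S 1\<^esub> x \<in> boundaries R S 1" if x: "x \<in> boundaries R S 1" for c x
  proof -
    obtain g where "x = (\<lambda>\<sigma>\<in>faces S 1. (\<Sum>\<tau>\<in>faces S 2. incidence \<tau> \<sigma> * g \<tau>) mod m)"
      using x unfolding boundaries_R by auto
    then have "c \<odot>\<^bsub>cycles R S 1\<^esub> x = (\<lambda>\<sigma>\<in>faces S 1. (\<Sum>\<tau>\<in>faces S 2. incidence \<tau> \<sigma> * (c * g \<tau>)) mod m)"
      unfolding cycles_ops by (auto simp: fun_eq_iff mod_mult_right_eq sum_distrib_left mult_ac)
    then show ?thesis using boundariesI[where S = S and g = "\<lambda>\<tau>. c * g \<tau>"] by simp
  qed
qed

end

lemma fdet_zero_imp_left_kernel: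
  fixes a :: "'i \<Rightarrow> 'k \<Rightarrow> 'a :: idom"
  assumes I: "finite I" and S: "finite S" "card S = card I" and 0: "fdet I S a = 0"
  obtains y where "\<And>k. k \<in> S \<Longrightarrow> (\<Sum>i\<in>I. y i * a i k) = 0" "\<exists>i\<in>I. y i \<noteq> 0"
proof -
  define \<phi> where "\<phi> i = enum_of S (inv_into {0..<card I} (enum_of I) i)" for i
  have \<phi>: "\<phi> (enum_of I j) = enum_of S j" if "j < card I" for j
    unfolding \<phi>_def inv_enum_of[OF I that] ..
  have "fdet I I (\<lambda>i j. a i (\<phi> j)) = fdet I S a"
    unfolding fdet_def by (rule arg_cong[where f = det], rule eq_matI) (auto simp: \<phi>)
  then have "fdet I I (\<lambda>i j. a j (\<phi> i)) = 0" using 0 by (simp only: fdet_transpose[of I "\<lambda>i j. a i (\<phi> j)"])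
  then obtain y where y: "\<And>i. i \<in> I \<Longrightarrow> (\<Sum>j\<in>I. a j (\<phi> i) * y j) = 0" "\<exists>i\<in>I. y i \<noteq> 0"
    using fdet_zero_imp_kernel[OF I] by blast
  show thesis
  proof (rule that[OF _ y(2)])
    fix k assume "k \<in> S"
    then obtain j where j: "j < card S" "k = enum_of S j" using enum_of_surj[OF S(1)] by blast
    then have "k = \<phi> (enum_of I j)" "enum_of I j \<in> I" using \<phi> S enum_of_mem[OF I] by auto
    then show "(\<Sum>i\<in>I. y i * a i k) = 0" using y(1)[of "enum_of I j"] by (simp add: mult.commute)
  qed
qed

section \<open>The order of the first homology group\<close>

locale skeleton =
  fixes n :: nat and S :: "nat set set"
  assumes complex: "simplicial_complex_on {1..n} S"
    and skel: "\<And>\<sigma>. \<sigma> \<subseteq> {1..n} \<Longrightarrow> card \<sigma> \<in> {1, 2} \<Longrightarrow> \<sigma> \<in> S"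
begin

lemma S_sub: "\<sigma> \<in> S \<Longrightarrow> finite \<sigma> \<and> \<sigma> \<subseteq> {1..n}"
  using complex by (auto simp: simplicial_complex_on_def)

lemma faces_0: "faces S 0 = (\<lambda>v. {v}) ` {1..n}"
proof -
  have "\<sigma> \<in> faces S 0 \<longleftrightarrow> \<sigma> \<in> (\<lambda>v. {v}) ` {1..n}" for \<sigma>
  proof
    assume "\<sigma> \<in> faces S 0"
    then have "\<sigma> \<subseteq> {1..n}" "card \<sigma> = 1" using S_sub by (auto simp: faces_def)
    then show "\<sigma> \<in> (\<lambda>v. {v}) ` {1..n}" using card_1_singletonE[of \<sigma>] by blast
  qed (use skel in \<open>auto simp: faces_def\<close>)
  then show ?thesis by blast
qed

lemma faces_1: "faces S 1 = {e. e \<subseteq> {1..n} \<and> card e = 2}"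
  using skel S_sub by (auto simp: faces_def intro: finite_subset[of _ "{1..n}"])

lemma faces_2: "faces S 2 = {t \<in> triangles n. t \<in> S}"
  using S_sub by (auto simp: faces_def triangles_def)

lemma finite_faces: "finite (faces S 0)" "finite (faces S 1)" "finite (faces S 2)"
  using finite_triangles[of n] by (auto simp: faces_0 faces_1 faces_2)

lemma faces_1_split:
  "faces S 1 = edges_off n \<union> (\<lambda>w. {1, w}) ` {2..n}" "edges_off n \<inter> (\<lambda>w. {1, w}) ` {2..n} = {}"
  "inj_on (\<lambda>w. {1 :: nat, w}) {2..n}"
proof -
  show "faces S 1 = edges_off n \<union> (\<lambda>w. {1, w}) ` {2..n}"
  proof (rule equalityI; rule subsetI)
    fix e assume e: "e \<in> faces S 1"
    then obtain a b where ab: "e = {a, b}" "a \<noteq> b" "a \<in> {1..n}" "b \<in> {1..n}" by (auto simp: faces_1 card_2_iff)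
    show "e \<in> edges_off n \<union> (\<lambda>w. {1, w}) ` {2..n}"
    proof (cases "a = 1 \<or> b = 1")
      case True
      define c where "c = (if a = 1 then b else a)"
      have "e = {1, c}" "c \<in> {2..n}" using True ab by (auto simp: c_def insert_commute)
      then show ?thesis by blast
    next
      case False
      then have "a \<in> {2..n}" "b \<in> {2..n}" using ab by auto
      then show ?thesis using ab by (simp add: edges_off_def)
    qed
  qed (auto simp: faces_1 edges_off_def)
  show "edges_off n \<inter> (\<lambda>w. {1, w}) ` {2..n} = {}" by (auto simp: edges_off_def)
  show "inj_on (\<lambda>w. {1 :: nat, w}) {2..n}" by (auto simp: inj_on_def doubleton_eq_iff)
qed

lemma sum_faces_1:
  fixes f :: "nat set \<Rightarrow> int"
  shows "(\<Sum>e\<in>faces S 1. f e) = (\<Sum>e\<in>edges_off n. f e) + (\<Sum>w=2..n. f {1, w})"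
  unfolding faces_1_split(1) using faces_1_split(2,3) finite_edges_off[of n]
  by (subst sum.union_disjoint) (auto simp: sum.reindex)

lemma root_edge_incidence:
  assumes "w \<in> {2..n}"
  shows "incidence {1, w} {v} = (if v = w then 1 else if v = 1 then - 1 else 0)"
proof -
  have "incidence {1, w} {v} = 0" if "v \<noteq> 1" "v \<noteq> w"
    using incidence_subset[of "{1, w}" "{v}"] that by auto
  then show ?thesis using assms incidence_vertex[of 1 w] incidence_vertex[of w 1] by (auto simp: insert_commute)
qed

lemma cycle_sum:
  fixes z :: "nat set \<Rightarrow> int"
  shows "v \<in> {2..n} \<Longrightarrow> (\<Sum>e\<in>faces S 1. incidence e {v} * z e) = (\<Sum>e\<in>edges_off n. incidence e {v} * z e) + z {1, v}"
    and "(\<Sum>e\<in>faces S 1. incidence e {1} * z e) = - (\<Sum>w=2..n. z {1, w})"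
proof -
  assume v: "v \<in> {2..n}"
  have "(\<Sum>w=2..n. incidence {1, w} {v} * z {1, w}) = (\<Sum>w=2..n. if w = v then z {1, v} else 0)"
    using v by (intro sum.cong) (auto simp: root_edge_incidence)
  then show "(\<Sum>e\<in>faces S 1. incidence e {v} * z e) = (\<Sum>e\<in>edges_off n. incidence e {v} * z e) + z {1, v}"
    unfolding sum_faces_1 using v by simp
next
  have "(\<Sum>e\<in>edges_off n. incidence e {1} * z e) = 0"
  proof (rule sum.neutral, rule ballI)
    fix e assume "e \<in> edges_off n"
    then have "1 \<notin> e" by (auto simp: edges_off_def)
    then have "incidence e {1} = 0" using incidence_subset[of e "{1}"] by blast
    then show "incidence e {1} * z e = 0" by simp
  qed
  moreover have "(\<Sum>w=2..n. incidence {1, w} {1} * z {1, w}) = (\<Sum>w=2..n. - z {1, w})"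
    by (intro sum.cong) (auto simp: root_edge_incidence)
  ultimately show "(\<Sum>e\<in>faces S 1. incidence e {1} * z e) = - (\<Sum>w=2..n. z {1, w})"
    unfolding sum_faces_1 by (simp add: sum_negf)
qed

lemma edge_vertex_sum: "e \<in> edges_off n \<Longrightarrow> (\<Sum>w=2..n. incidence e {w}) = 0"
proof -
  assume "e \<in> edges_off n"
  then obtain a b where ab: "e = {a, b}" "a \<noteq> b" "a \<in> {2..n}" "b \<in> {2..n}" by (rule edges_offE)
  have "(\<Sum>w=2..n. incidence e {w}) = (\<Sum>w\<in>{a, b}. incidence e {w})"
  proof (rule sum.mono_neutral_right)
    show "\<forall>v\<in>{2..n} - {a, b}. incidence e {v} = 0"
      using incidence_subset[of e] ab(1) by blast
  qed (use ab in auto)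
  then show ?thesis using incidence_vertex[OF ab(2)] incidence_vertex[OF ab(2)[symmetric]] ab(1,2)
    by (auto simp: insert_commute)
qed

lemma boundary_boundary_faces:
  assumes "\<tau> \<in> faces S 2" "\<sigma> \<in> faces S 0"
  shows "(\<Sum>\<rho>\<in>faces S 1. incidence \<rho> \<sigma> * incidence \<tau> \<rho>) = 0"
proof -
  obtain v where v: "\<sigma> = {v}" using assms(2) by (auto simp: faces_0)
  obtain a b c where abc: "\<tau> = {a, b, c}" "a \<noteq> b" "a \<noteq> c" "b \<noteq> c"
    using assms(1) by (auto simp: faces_2 triangles_def card_3_iff)
  have "\<tau> \<subseteq> {1..n}" using assms(1) by (auto simp: faces_2 triangles_def)
  then have "(\<Sum>e\<in>faces S 1. incidence {a, b, c} e * incidence e {v}) = 0"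
    using abc by (intro boundary_boundary finite_faces) (auto simp: faces_1)
  then show ?thesis unfolding v abc(1) by (simp add: mult.commute)
qed

end

locale skeleton_homology = skeleton n S + int_quotient_ring R m for n S R m
begin

abbreviation "Z \<equiv> carrier (cycles R S 1)"
abbreviation "B \<equiv> boundaries R S 1"
abbreviation "H \<equiv> homology R S 1"

definition cl :: "(nat set \<Rightarrow> int) \<Rightarrow> (nat set \<Rightarrow> int) set" where
  "cl z = B +>\<^bsub>cycles R S 1\<^esub> z"

lemmas B_submodule = boundaries_submodule[of S, OF boundary_boundary_faces]

lemma H_module: "module R H"
  and carrier_H: "carrier H = cl ` Z"
  and add_H: "\<And>x y. x \<in> Z \<Longrightarrow> y \<in> Z \<Longrightarrow> cl x \<oplus>\<^bsub>H\<^esub> cl y = cl (x \<oplus>\<^bsub>cycles R S 1\<^esub> y)"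
  and smult_H: "\<And>r x. r \<in> carrier R \<Longrightarrow> x \<in> Z \<Longrightarrow> r \<odot>\<^bsub>H\<^esub> cl x = cl (r \<odot>\<^bsub>cycles R S 1\<^esub> x)"
  and cl_eq_minus: "\<And>x y. x \<in> Z \<Longrightarrow> y \<in> Z \<Longrightarrow> cl x = cl y \<longleftrightarrow> x \<ominus>\<^bsub>cycles R S 1\<^esub> y \<in> B"
  unfolding homology_def cl_def by (rule quotient_module[OF cycles_module B_submodule]; assumption)+

lemma B_sub_Z: "B \<subseteq> Z"
  using B_submodule by (metis cycles_module module.submoduleE(1))

text \<open>The edges at 1 form a spanning tree, and \<open>{1, v}\<close> is the only one of them
  at \<open>v\<close>; the cycle condition at \<open>v\<close> can be solved for it. A cycle is thus
  determined by its values on \<open>edges_off n\<close>.\<close>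

lemma cycle_root:
  assumes z: "z \<in> Z" and v: "v \<in> {2..n}"
  shows "z {1, v} = (- (\<Sum>e\<in>edges_off n. incidence e {v} * z e)) mod m"
proof -
  have "{v} \<in> faces S 0" using v by (auto simp: faces_0)
  then have "(\<Sum>e\<in>faces S 1. incidence e {v} * z e) mod m = 0"
    using z unfolding carrier_cycles by blast
  then have 0: "((\<Sum>e\<in>edges_off n. incidence e {v} * z e) + z {1, v}) mod m = 0"
    unfolding cycle_sum(1)[OF v] .
  have "{1, v} \<in> faces S 1" using v by (auto simp: faces_1)
  then have "z {1, v} mod m = z {1, v}" using z unfolding carrier_cycles by (auto simp: carrier_R)
  moreover have "z {1, v} mod m = (- (\<Sum>e\<in>edges_off n. incidence e {v} * z e)) mod m"
    unfolding mod_eq_dvd_iff using 0 by (simp add: mod_eq_0_iff_dvd add.commute)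
  ultimately show ?thesis by simp
qed

lemma cycle_eqI:
  assumes z: "z \<in> Z" "z' \<in> Z" and eq: "\<And>e. e \<in> edges_off n \<Longrightarrow> z e = z' e"
  shows "z = z'"
proof
  fix e
  show "z e = z' e"
  proof (cases "e \<in> faces S 1")
    case True
    then consider "e \<in> edges_off n" | w where "e = {1, w}" "w \<in> {2..n}" using faces_1_split(1) by blast
    then show ?thesis
    proof cases
      case 2
      then show ?thesis using cycle_root[OF z(1)] cycle_root[OF z(2)] eq by (simp cong: sum.cong)
    qed (use eq in auto)
  next
    case False
    then show ?thesis using z unfolding carrier_cycles by (auto simp: PiE_def extensional_def)
  qed
qed

text \<open>The cycle with prescribed values on \<open>edges_off n\<close>. For an edge
  \<open>e = {1, w}\<close> the set \<open>e - {1}\<close> is the vertex \<open>{w}\<close> whose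
  cycle condition fixes the value.\<close>

definition cyc :: "(nat set \<Rightarrow> int) \<Rightarrow> nat set \<Rightarrow> int" where
  "cyc x = (\<lambda>e\<in>faces S 1. if e \<in> edges_off n then x e mod m
     else (- (\<Sum>e'\<in>edges_off n. incidence e' (e - {1}) * x e')) mod m)"

lemma cyc_off: "e \<in> edges_off n \<Longrightarrow> cyc x e = x e mod m"
  using faces_1_split(1) by (simp add: cyc_def)

lemma cyc_root: "w \<in> {2..n} \<Longrightarrow> cyc x {1, w} = (- (\<Sum>e\<in>edges_off n. incidence e {w} * x e)) mod m"
proof -
  assume w: "w \<in> {2..n}"
  then have "{1, w} - {1} = {w}" "{1, w} \<in> faces S 1" "{1, w} \<notin> edges_off n"
    using faces_1_split by auto
  then show ?thesis by (simp add: cyc_def)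
qed

text \<open>The condition at every vertex other than 1 holds by construction. The condition at 1
  follows from these, since the incidences of an edge avoiding 1 sum to 0 over the vertices
  \<open>{2..n}\<close>.\<close>

lemma cyc_in: "cyc x \<in> Z"
proof -
  have off: "(\<Sum>e\<in>edges_off n. incidence e \<sigma> * cyc x e) mod m = (\<Sum>e\<in>edges_off n. incidence e \<sigma> * x e) mod m" for \<sigma>
    by (simp add: cyc_off sum_mod_simps(3) cong: sum.cong)
  have "(\<Sum>e\<in>faces S 1. incidence e {v} * cyc x e) mod m = 0" if v: "v \<in> {1..n}" for v
  proof (cases "v = 1")
    case False
    then have v2: "v \<in> {2..n}" using v by auto
    show ?thesis unfolding cycle_sum(1)[OF v2] cyc_root[OF v2]
      by (subst mod_add_eq[symmetric], subst off) (simp add: mod_add_eq)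
  next
    case True
    have "(\<Sum>w=2..n. \<Sum>e\<in>edges_off n. incidence e {w} * x e) = (\<Sum>e\<in>edges_off n. (\<Sum>w=2..n. incidence e {w}) * x e)"
      unfolding sum_distrib_right by (rule sum.swap)
    then have 0: "(\<Sum>w=2..n. \<Sum>e\<in>edges_off n. incidence e {w} * x e) = 0" by (simp add: edge_vertex_sum)
    have "(\<Sum>w=2..n. cyc x {1, w}) mod m = (\<Sum>w=2..n. (- (\<Sum>e\<in>edges_off n. incidence e {w} * x e)) mod m) mod m"
      by (rule arg_cong[where f = "\<lambda>x. x mod m"], rule sum.cong[OF refl], rule cyc_root)
    also have "\<dots> = 0" unfolding mod_sum_eq using 0 by (simp add: sum_negf)
    finally have "m dvd (\<Sum>w=2..n. cyc x {1, w})" by (simp add: mod_eq_0_iff_dvd)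
    then show ?thesis unfolding True cycle_sum(2) by (simp add: mod_eq_0_iff_dvd)
  qed
  moreover have "cyc x \<in> faces S 1 \<rightarrow>\<^sub>E carrier R" by (auto simp: cyc_def)
  ultimately show ?thesis unfolding carrier_cycles faces_0 by auto
qed

lemma cyc_cycle: "z \<in> Z \<Longrightarrow> cyc z = z"
proof (rule cycle_eqI[OF cyc_in])
  fix e assume z: "z \<in> Z" and "e \<in> edges_off n"
  then show "cyc z e = z e" using faces_1_split(1) unfolding carrier_cycles by (auto simp: cyc_off carrier_R)
qed

text \<open>The difference of the cycles and a boundary are both cycles, so they need to be compared
  only on \<open>edges_off n\<close>. This presents the homology as the cokernel of the
  triangle-edge matrix with the root edges deleted.\<close>

lemma cl_eq:
  assumes z: "z \<in> Z" "z' \<in> Z"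
  shows "cl z = cl z' \<longleftrightarrow> (\<exists>g. \<forall>e\<in>edges_off n. (z e - z' e) mod m = (\<Sum>t\<in>faces S 2. incidence t e * g t) mod m)"
proof -
  interpret N: module R "cycles R S 1" by (rule cycles_module)
  define d where "d = (\<lambda>e\<in>faces S 1. (z e - z' e) mod m)"
  have "d = z \<oplus>\<^bsub>cycles R S 1\<^esub> (((- 1) mod m) \<odot>\<^bsub>cycles R S 1\<^esub> z')"
    unfolding cycles_ops d_def by (auto simp: fun_eq_iff mod_simps)
  then have d: "d \<in> Z" using z by simp
  have "z = d \<oplus>\<^bsub>cycles R S 1\<^esub> z'"
    using z unfolding cycles_ops d_def carrier_cycles
    by (auto simp: fun_eq_iff mod_simps carrier_R PiE_def extensional_def Pi_def)
  then have "z \<ominus>\<^bsub>cycles R S 1\<^esub> z' = d"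
    using z d by (simp add: N.minus_eq N.a_assoc N.r_neg)
  then have 1: "cl z = cl z' \<longleftrightarrow> d \<in> B" using cl_eq_minus[OF z] by simp
  have "d \<in> B \<longleftrightarrow> (\<exists>g. \<forall>e\<in>edges_off n. (z e - z' e) mod m = (\<Sum>t\<in>faces S 2. incidence t e * g t) mod m)"
  proof
    assume "d \<in> B"
    then obtain g where "d = (\<lambda>\<sigma>\<in>faces S 1. (\<Sum>\<tau>\<in>faces S 2. incidence \<tau> \<sigma> * g \<tau>) mod m)"
      unfolding boundaries_R by auto
    then have "(z e - z' e) mod m = (\<Sum>t\<in>faces S 2. incidence t e * g t) mod m" if "e \<in> edges_off n" for e
      using that faces_1_split(1) unfolding d_def by (auto simp: fun_eq_iff restrict_def split: if_splits)
    then show "\<exists>g. \<forall>e\<in>edges_off n. (z e - z' e) mod m = (\<Sum>t\<in>faces S 2. incidence t e * g t) mod m" by blast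
  next
    assume "\<exists>g. \<forall>e\<in>edges_off n. (z e - z' e) mod m = (\<Sum>t\<in>faces S 2. incidence t e * g t) mod m"
    then obtain g where g: "\<And>e. e \<in> edges_off n \<Longrightarrow> (z e - z' e) mod m = (\<Sum>t\<in>faces S 2. incidence t e * g t) mod m" by blast
    let ?b = "\<lambda>\<sigma>\<in>faces S 1. (\<Sum>\<tau>\<in>faces S 2. incidence \<tau> \<sigma> * g \<tau>) mod m"
    have b: "?b \<in> B" by (rule boundariesI)
    have "d = ?b"
    proof (rule cycle_eqI[OF d])
      show "?b \<in> Z" using b B_sub_Z by blast
      fix e assume "e \<in> edges_off n"
      then show "d e = ?b e" using g faces_1_split(1) by (simp add: d_def)
    qed
    then show "d \<in> B" using b by simp
  qed
  then show ?thesis using 1 by simp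
qed

end

context skeleton
begin

sublocale Zh: skeleton_homology n S \<Z> 0 by unfold_locales
sublocale Fh: skeleton_homology n S "residue_ring 2" 2 by unfold_locales

lemma Z_cl_eq:
  assumes "z \<in> Zh.Z" "z' \<in> Zh.Z"
  shows "Zh.cl z = Zh.cl z' \<longleftrightarrow> in_lattice (edges_off n) (faces S 2) (\<lambda>e t. incidence t e) (\<lambda>e. z e - z' e)"
  unfolding Zh.cl_eq[OF assms] in_lattice_def by simp

lemma card_H_transversal:
  assumes R: "transversal (edges_off n) (faces S 2) (\<lambda>e t. incidence t e) R"
  shows "bij_betw (\<lambda>r. Zh.cl (Zh.cyc r)) R (carrier Zh.H)"
proof -
  let ?L = "in_lattice (edges_off n) (faces S 2) (\<lambda>e t. incidence t e)"
  have eq: "Zh.cl (Zh.cyc x) = Zh.cl (Zh.cyc y) \<longleftrightarrow> ?L (\<lambda>e. x e - y e)" for x y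
    unfolding Z_cl_eq[OF Zh.cyc_in Zh.cyc_in] by (simp add: in_lattice_def Zh.cyc_off)
  show ?thesis
    unfolding bij_betw_def
  proof
    show "inj_on (\<lambda>r. Zh.cl (Zh.cyc r)) R"
    proof (rule inj_onI)
      fix r s assume rs: "r \<in> R" "s \<in> R" and e: "Zh.cl (Zh.cyc r) = Zh.cl (Zh.cyc s)"
      obtain q where q: "\<And>r'. r' \<in> R \<Longrightarrow> ?L (\<lambda>i. r i - r' i) \<Longrightarrow> r' = q"
        by (rule transversalE[OF R, of r]) blast
      have "?L (\<lambda>i. r i - r i)" by (auto simp: in_lattice_def intro!: exI[of _ "\<lambda>_. 0"])
      then show "r = s" using q[OF rs(1)] q[OF rs(2)] e[unfolded eq] by simp
    qed
    show "(\<lambda>r. Zh.cl (Zh.cyc r)) ` R = carrier Zh.H"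
    proof
      show "(\<lambda>r. Zh.cl (Zh.cyc r)) ` R \<subseteq> carrier Zh.H" using Zh.cyc_in by (auto simp: Zh.carrier_H)
      show "carrier Zh.H \<subseteq> (\<lambda>r. Zh.cl (Zh.cyc r)) ` R"
      proof
        fix X assume "X \<in> carrier Zh.H"
        then obtain z where z: "z \<in> Zh.Z" "X = Zh.cl z" by (auto simp: Zh.carrier_H)
        obtain r where r: "r \<in> R" "?L (\<lambda>i. z i - r i)" by (rule transversalE[OF R, of z]) blast
        then have "X = Zh.cl (Zh.cyc r)" using eq[of z r] Zh.cyc_cycle[OF z(1)] z(2) by simp
        then show "X \<in> (\<lambda>r. Zh.cl (Zh.cyc r)) ` R" using r(1) by blast
      qed
    qed
  qed
qed

text \<open>A nonzero determinant gives a finite transversal. If the determinant is zero, a left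
  kernel vector \<open>y\<close> is a nonzero functional that kills all boundaries, which makes the
  homology infinite.\<close>

lemma order_H:
  assumes c: "card (faces S 2) = card (edges_off n)"
  shows "finite (carrier Zh.H) \<longleftrightarrow> fdet (edges_off n) (faces S 2) (\<lambda>e t. incidence t e) \<noteq> 0"
    and "finite (carrier Zh.H) \<Longrightarrow> int (card (carrier Zh.H)) = \<bar>fdet (edges_off n) (faces S 2) (\<lambda>e t. incidence t e)\<bar>"
proof -
  let ?E = "edges_off n" and ?T = "faces S 2" and ?a = "\<lambda>e t. incidence t e :: int"
  note fE = finite_edges_off[of n] and fT = finite_faces(3)
  have nz: "finite (carrier Zh.H) \<and> int (card (carrier Zh.H)) = \<bar>fdet ?E ?T ?a\<bar>" if nz0: "fdet ?E ?T ?a \<noteq> 0"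
  proof -
    obtain R where R: "finite R" "int (card R) = \<bar>fdet ?E ?T ?a\<bar>" "transversal ?E ?T ?a R"
      by (rule lattice_transversal[OF fE fT c nz0])
    show ?thesis using card_H_transversal[OF R(3)] R(1,2) bij_betw_finite bij_betw_same_card by metis
  qed
  have z: "infinite (carrier Zh.H)" if 0: "fdet ?E ?T ?a = 0"
  proof
    assume fin: "finite (carrier Zh.H)"
    obtain y where y: "\<And>t. t \<in> ?T \<Longrightarrow> (\<Sum>i\<in>?E. y i * incidence t i) = 0" "\<exists>i\<in>?E. y i \<noteq> 0"
      by (rule fdet_zero_imp_left_kernel[OF fE fT c 0]) blast
    obtain e0 where e0: "e0 \<in> ?E" "y e0 \<noteq> 0" using y(2) by blast
    \<comment> \<open>Multiples of a unit vector at an edge where \<open>y\<close> is nonzero: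
      \<open>y\<close> separates their homology classes.\<close>
    define x where "x k e = (if e = e0 then k else 0)" for k :: int and e :: "nat set"
    have "inj (\<lambda>k. Zh.cl (Zh.cyc (x k)))"
    proof (rule injI)
      fix k l assume "Zh.cl (Zh.cyc (x k)) = Zh.cl (Zh.cyc (x l))"
      then obtain g where g: "\<And>e. e \<in> ?E \<Longrightarrow> x k e - x l e = (\<Sum>t\<in>?T. incidence t e * g t)"
        unfolding Zh.cl_eq[OF Zh.cyc_in Zh.cyc_in] by (auto simp: Zh.cyc_off)
      have "(\<Sum>e\<in>?E. y e * (x k e - x l e)) = (\<Sum>e\<in>?E. \<Sum>t\<in>?T. (y e * incidence t e) * g t)"
        using g by (simp add: sum_distrib_left mult.assoc cong: sum.cong)
      also have "\<dots> = (\<Sum>t\<in>?T. (\<Sum>e\<in>?E. y e * incidence t e) * g t)"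
        unfolding sum_distrib_right by (rule sum.swap)
      also have "\<dots> = 0" using y(1) by simp
      also have "(\<Sum>e\<in>?E. y e * (x k e - x l e)) = (\<Sum>e\<in>?E. if e = e0 then y e0 * (k - l) else 0)"
        by (intro sum.cong) (auto simp: x_def)
      finally show "k = l" using e0 fE by simp
    qed
    moreover have "range (\<lambda>k. Zh.cl (Zh.cyc (x k))) \<subseteq> carrier Zh.H"
      using Zh.cyc_in by (auto simp: Zh.carrier_H)
    then have "finite (range (\<lambda>k. Zh.cl (Zh.cyc (x k))))" using fin by (rule finite_subset)
    ultimately have "finite (UNIV :: int set)" by (rule finite_imageD[rotated])
    then show False using infinite_UNIV_int by contradiction
  qed
  show "finite (carrier Zh.H) \<longleftrightarrow> fdet ?E ?T ?a \<noteq> 0" using nz z by blast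
  show "finite (carrier Zh.H) \<Longrightarrow> int (card (carrier Zh.H)) = \<bar>fdet ?E ?T ?a\<bar>" using nz z by blast
qed

end

section \<open>Strips of triangles\<close>

text \<open>\<open>P\<close> indexes the vertices of all strips together and \<open>\<sigma>\<close>
  moves to the next index. Since 5 is prime, \<open>\<sigma>_5\<close> and
  \<open>\<sigma>_neq\<close> make every orbit a 5-cycle. An empty \<open>P\<close> is allowed and
  later gives the case without strips.\<close>

locale strips =
  fixes n :: nat and P :: "nat set" and \<sigma> :: "nat \<Rightarrow> nat" and u :: "nat \<Rightarrow> nat"
  assumes finite_P: "finite P" and \<sigma>_in: "\<And>p. p \<in> P \<Longrightarrow> \<sigma> p \<in> P"
    and \<sigma>_neq: "\<And>p. p \<in> P \<Longrightarrow> \<sigma> p \<noteq> p"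
    and \<sigma>_5: "\<And>p. p \<in> P \<Longrightarrow> \<sigma> (\<sigma> (\<sigma> (\<sigma> (\<sigma> p)))) = p"
    and inj_u: "inj_on u P" and u_in: "\<And>p. p \<in> P \<Longrightarrow> u p \<in> {2..n}"
begin

definition ed :: "nat \<Rightarrow> nat set" where "ed p = {u p, u (\<sigma> p)}"
definition tr :: "nat \<Rightarrow> nat set" where "tr p = {u p, u (\<sigma> p), u (\<sigma> (\<sigma> p))}"
definition E0 :: "nat set set" where "E0 = ed ` P"
definition strip :: "nat set set" where "strip = tr ` P"
definition touch :: "nat set set" where "touch = {t \<in> triangles n. \<exists>p\<in>P. ed p \<subseteq> t}"
definition bad :: "nat set set" where "bad = touch - strip"
definition free :: "nat set set" where "free = triangles n - touch"

abbreviation "E \<equiv> edges_off n"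

section \<open>Combinatorics of the strips\<close>

lemma \<sigma>_neqs:
  assumes "p \<in> P"
  shows "\<sigma> (\<sigma> p) \<noteq> p" "\<sigma> (\<sigma> (\<sigma> p)) \<noteq> p" "\<sigma> (\<sigma> p) \<noteq> \<sigma> p" "\<sigma> (\<sigma> (\<sigma> p)) \<noteq> \<sigma> p"
    "\<sigma> (\<sigma> (\<sigma> p)) \<noteq> \<sigma> (\<sigma> p)" "\<sigma> (\<sigma> (\<sigma> (\<sigma> p))) \<noteq> p"
proof -
  have two: "\<sigma> (\<sigma> q) \<noteq> q" if "q \<in> P" for q
  proof
    assume "\<sigma> (\<sigma> q) = q"
    then have "\<sigma> (\<sigma> (\<sigma> (\<sigma> (\<sigma> q)))) = \<sigma> q" by simp
    then show False using \<sigma>_5[OF that] \<sigma>_neq[OF that] by simp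
  qed
  show "\<sigma> (\<sigma> (\<sigma> p)) \<noteq> p"
  proof
    assume "\<sigma> (\<sigma> (\<sigma> p)) = p"
    then have "\<sigma> (\<sigma> (\<sigma> (\<sigma> (\<sigma> p)))) = \<sigma> (\<sigma> p)" by simp
    then show False using \<sigma>_5[OF assms] two[OF assms] by simp
  qed
  show "\<sigma> (\<sigma> (\<sigma> (\<sigma> p))) \<noteq> p"
  proof
    assume "\<sigma> (\<sigma> (\<sigma> (\<sigma> p))) = p"
    then have "\<sigma> (\<sigma> (\<sigma> (\<sigma> (\<sigma> p)))) = \<sigma> p" by simp
    then show False using \<sigma>_5[OF assms] \<sigma>_neq[OF assms] by simp
  qed
  show "\<sigma> (\<sigma> p) \<noteq> p" by (rule two[OF assms])
  show "\<sigma> (\<sigma> p) \<noteq> \<sigma> p" by (rule \<sigma>_neq[OF \<sigma>_in[OF assms]])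
  show "\<sigma> (\<sigma> (\<sigma> p)) \<noteq> \<sigma> p" by (rule two[OF \<sigma>_in[OF assms]])
  show "\<sigma> (\<sigma> (\<sigma> p)) \<noteq> \<sigma> (\<sigma> p)" by (rule \<sigma>_neq[OF \<sigma>_in[OF \<sigma>_in[OF assms]]])
qed

lemma u_eq: "p \<in> P \<Longrightarrow> q \<in> P \<Longrightarrow> u p = u q \<longleftrightarrow> p = q"
  using inj_u by (auto simp: inj_on_def)

lemma \<sigma>_inj: "p \<in> P \<Longrightarrow> q \<in> P \<Longrightarrow> \<sigma> p = \<sigma> q \<longleftrightarrow> p = q"
  by (metis \<sigma>_5)

lemma inj_ed: "inj_on ed P"
proof (rule inj_onI)
  fix p q assume p: "p \<in> P" and q: "q \<in> P" and "ed p = ed q"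
  then have "p = q \<or> p = \<sigma> q \<and> \<sigma> p = q"
    by (auto simp: ed_def doubleton_eq_iff u_eq \<sigma>_in)
  then show "p = q" using \<sigma>_neqs(1)[OF q] by auto
qed

text \<open>The third side of \<open>tr p\<close> joins indices two steps apart, which are never
  consecutive in a 5-cycle. So a strip triangle contains exactly two strip edges.\<close>

lemma ed_sub_tr:
  assumes "p \<in> P" "q \<in> P"
  shows "ed q \<subseteq> tr p \<longleftrightarrow> q = p \<or> q = \<sigma> p"
proof
  assume "ed q \<subseteq> tr p"
  then have "q \<in> {p, \<sigma> p, \<sigma> (\<sigma> p)}" "\<sigma> q \<in> {p, \<sigma> p, \<sigma> (\<sigma> p)}"
    using assms by (auto simp: ed_def tr_def u_eq \<sigma>_in)
  then show "q = p \<or> q = \<sigma> p" using \<sigma>_neqs[OF assms(1)] by auto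
qed (auto simp: ed_def tr_def)

lemma inj_tr: "inj_on tr P"
proof (rule inj_onI)
  fix p q assume p: "p \<in> P" and q: "q \<in> P" and e: "tr p = tr q"
  have "p = q \<or> p = \<sigma> q" using ed_sub_tr[OF q p] ed_sub_tr[OF p p] e by auto
  moreover have "q = p \<or> q = \<sigma> p" using ed_sub_tr[OF p q] ed_sub_tr[OF q q] e by auto
  ultimately show "p = q" using \<sigma>_neqs(1)[OF q] by auto
qed

lemma ed_in: "p \<in> P \<Longrightarrow> ed p \<in> E"
  using u_in[of p] u_in[of "\<sigma> p"] u_eq[of p "\<sigma> p"] \<sigma>_neq[of p] \<sigma>_in[of p]
  by (auto simp: ed_def edges_off_def)

lemma tr_in: "p \<in> P \<Longrightarrow> tr p \<in> triangles n"
  using u_in[of p] u_in[of "\<sigma> p"] u_in[of "\<sigma> (\<sigma> p)"] \<sigma>_neqs[of p] \<sigma>_neq[of p] \<sigma>_in[of p] \<sigma>_in[of "\<sigma> p"]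
  by (auto simp: tr_def triangles_def u_eq card_insert_if)

lemma strip_sub: "strip \<subseteq> touch"
  using tr_in ed_sub_tr by (auto simp: strip_def touch_def)

lemma touch_root: "1 \<notin> ed p" if "p \<in> P"
  using u_in[OF that] u_in[OF \<sigma>_in[OF that]] by (auto simp: ed_def)

lemma third_edge: "p \<in> P \<Longrightarrow> {u (\<sigma> (\<sigma> p)), u p} \<notin> E0"
  using \<sigma>_neqs[of p] \<sigma>_in[of p] \<sigma>_in[of "\<sigma> p"]
  by (auto simp: E0_def ed_def doubleton_eq_iff u_eq \<sigma>_in)

text \<open>Each strip triangle forces \<open>y p = - y (\<sigma> p)\<close>; five steps return to
  \<open>p\<close> with the opposite sign. Here the odd length makes the strip matrix nonsingular
  over the reals.\<close>

lemma strip_sum_zero: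
  fixes x :: "nat set \<Rightarrow> real"
  assumes x: "\<And>e. e \<in> E - E0 \<Longrightarrow> x e = 0"
    and z: "\<And>p. p \<in> P \<Longrightarrow> (\<Sum>e\<in>E. of_int (incidence (tr p) e) * x e) = 0"
    and e: "e \<in> E0"
  shows "x e = 0"
proof -
  define g where "g e = (if e \<in> E then x e else 0)" for e
  have g_fun: "g = (\<lambda>e. if e \<in> E then x e else 0)" by (simp add: g_def fun_eq_iff)
  define y where "y p = oriented g (u p) (u (\<sigma> p))" for p
  have step: "y p = - y (\<sigma> p)" if p: "p \<in> P" for p
  proof -
    have d: "u p \<noteq> u (\<sigma> p)" "u p \<noteq> u (\<sigma> (\<sigma> p))" "u (\<sigma> p) \<noteq> u (\<sigma> (\<sigma> p))"
      using p \<sigma>_neqs[OF p] \<sigma>_neq[OF p] by (auto simp: u_eq \<sigma>_in)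
    have "oriented g (u p) (u (\<sigma> p)) + oriented g (u (\<sigma> p)) (u (\<sigma> (\<sigma> p))) + oriented g (u (\<sigma> (\<sigma> p))) (u p) = 0"
      using z[OF p] unfolding tr_def sum_triangle_oriented[OF d finite_edges_off g_fun]
      by (auto split: if_splits)
    moreover have "oriented g (u (\<sigma> (\<sigma> p))) (u p) = 0"
      using third_edge[OF p] x by (auto simp: oriented_def g_def insert_commute)
    ultimately show ?thesis by (simp add: y_def)
  qed
  obtain p where p: "p \<in> P" "e = ed p" using e by (auto simp: E0_def)
  have "y p = - y p"
    using step[OF p(1)] step[OF \<sigma>_in[OF p(1)]] step[OF \<sigma>_in[OF \<sigma>_in[OF p(1)]]]
      step[OF \<sigma>_in[OF \<sigma>_in[OF \<sigma>_in[OF p(1)]]]] step[OF \<sigma>_in[OF \<sigma>_in[OF \<sigma>_in[OF \<sigma>_in[OF p(1)]]]]] \<sigma>_5[OF p(1)]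
    by simp
  then have "y p = 0" by simp
  then have "g (ed p) = 0" by (auto simp: y_def oriented_def ed_def split: if_splits)
  then show ?thesis using p ed_in by (simp add: g_def)
qed

section \<open>Change of basis along the strips\<close>

definition v :: "nat set \<Rightarrow> nat set \<Rightarrow> real" where
  "v t e = of_int (incidence t e)"

text \<open>Coordinates of the triangle vectors in the basis given by the columns of
  \<open>U\<close>: a strip triangle becomes the unit vector at its own edge, and a free triangle
  keeps its coordinates because it vanishes on \<open>E0\<close>.\<close>

definition w :: "nat set \<Rightarrow> nat set \<Rightarrow> real" where
  "w t e = (if t \<in> strip then (if e = ed (inv_into P tr t) then 1 else 0) else v t e)"

definition U :: "nat set \<Rightarrow> nat set \<Rightarrow> real" where
  "U i j = (if j \<in> E0 then v (tr (inv_into P ed j)) i else if i = j then 1 else 0)"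

text \<open>Vertex incidence with the rows of strip edges removed, since in the new basis the strip
  edges are decoupled from all others.\<close>

definition D :: "nat set \<Rightarrow> nat \<Rightarrow> real" where
  "D e x = (if e \<in> E0 then 0 else v e {x})"

lemma v_zero: "\<not> e \<subseteq> t \<Longrightarrow> v t e = 0"
  using incidence_nonzero[of t e] by (auto simp: v_def)

lemma v_free: "t \<in> free \<Longrightarrow> e \<in> E0 \<Longrightarrow> v t e = 0"
  by (rule v_zero) (auto simp: free_def touch_def E0_def)

lemma w_tr: "p \<in> P \<Longrightarrow> w (tr p) e = (if e = ed p then 1 else 0)"
  by (simp add: w_def strip_def inv_into_f_f[OF inj_tr])

lemma w_free: "t \<in> free \<Longrightarrow> w t e = v t e"
  using strip_sub by (auto simp: w_def free_def)

lemma U_ed: "p \<in> P \<Longrightarrow> U i (ed p) = v (tr p) i"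
  by (simp add: U_def E0_def inv_into_f_f[OF inj_ed])

lemma free_strip: "free \<inter> strip = {}" "free \<union> strip = triangles n - bad"
  using strip_sub by (auto simp: free_def bad_def touch_def)

lemma finite_sets: "finite free" "finite strip" "finite touch" "finite E0" "finite E"
  using finite_triangles[of n] finite_P finite_edges_off[of n] by (auto simp: free_def strip_def touch_def E0_def)

lemma U_w:
  assumes t: "t \<in> free \<union> strip" and i: "i \<in> E"
  shows "(\<Sum>l\<in>E. U i l * w t l) = v t i"
proof (cases "t \<in> strip")
  case True
  then obtain p where p: "p \<in> P" "t = tr p" by (auto simp: strip_def)
  have "(\<Sum>l\<in>E. U i l * w t l) = (\<Sum>l\<in>E. if l = ed p then U i (ed p) else 0)"
    unfolding p(2) w_tr[OF p(1)] by (intro sum.cong) auto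
  then show ?thesis using p ed_in[OF p(1)] finite_edges_off[of n] by (simp add: U_ed)
next
  case False
  then have f: "t \<in> free" using t by auto
  have "(\<Sum>l\<in>E. U i l * w t l) = (\<Sum>l\<in>E. if l = i then v t i else 0)"
    unfolding w_free[OF f] by (intro sum.cong refl) (auto simp: U_def v_free[OF f])
  then show ?thesis using i finite_edges_off[of n] by simp
qed

text \<open>A vector in the left kernel would vanish off \<open>E0\<close> by the unit columns and
  on \<open>E0\<close> by \<open>strip_sum_zero\<close>. The determinant is thus a nonzero
  integer.\<close>

lemma fdet_U: "1 \<le> (fdet E E U)\<^sup>2"
proof -
  define Ui where "Ui i j = (if j \<in> E0 then incidence (tr (inv_into P ed j)) i else if i = j then 1 else 0)" for i j :: "nat set"
  have eq: "U = (\<lambda>i j. of_int (Ui i j))" by (auto simp: U_def Ui_def v_def fun_eq_iff)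
  have "fdet E E U \<noteq> 0"
  proof
    assume "fdet E E U = 0"
    then have 0: "fdet E E (\<lambda>i j. U j i) = 0" by (simp only: fdet_transpose[of E U])
    obtain x where x: "\<And>i. i \<in> E \<Longrightarrow> (\<Sum>j\<in>E. U j i * x j) = 0" "\<exists>i\<in>E. x i \<noteq> 0"
      using fdet_zero_imp_kernel[OF finite_edges_off 0] by blast
    have off: "x e = 0" if "e \<in> E - E0" for e
    proof -
      have "(\<Sum>j\<in>E. U j e * x j) = (\<Sum>j\<in>E. if j = e then x e else 0)"
        using that by (intro sum.cong) (auto simp: U_def)
      then show ?thesis using x(1)[of e] that finite_edges_off[of n] by simp
    qed
    have "x e = 0" if "e \<in> E0" for e
    proof (rule strip_sum_zero[OF off _ that])
      fix p assume p: "p \<in> P"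
      show "(\<Sum>e\<in>E. of_int (incidence (tr p) e) * x e) = 0"
        using x(1)[OF ed_in[OF p]] by (simp add: U_ed[OF p] v_def)
    qed auto
    then show False using x(2) off by blast
  qed
  then have "fdet E E Ui \<noteq> 0" unfolding eq fdet_of_int by simp
  then have "1 \<le> (fdet E E Ui)\<^sup>2" by (simp add: int_one_le_iff_zero_less)
  then have "(1 :: real) \<le> of_int ((fdet E E Ui)\<^sup>2)" by linarith
  then show ?thesis unfolding eq fdet_of_int by simp
qed

definition wt :: "nat set set \<Rightarrow> real" where
  "wt S = (fdet E S (\<lambda>e t. v t e))\<^sup>2"

lemma wt_eq:
  assumes S: "S \<subseteq> free \<union> strip" "card S = card E"
  shows "wt S = (fdet E E U)\<^sup>2 * (fdet E S (\<lambda>e t. w t e))\<^sup>2"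
proof -
  have fS: "finite S" using S finite_sets finite_subset by blast
  have "fdet E S (\<lambda>e t. v t e) = fdet E S (\<lambda>e t. \<Sum>l\<in>E. U e l * w t l)"
    by (rule fdet_cong[OF _ finite_edges_off fS S(2)]) (use S U_w in auto)
  also have "\<dots> = fdet E E U * fdet E S (\<lambda>e t. w t e)"
    by (rule fdet_mult[OF finite_edges_off fS S(2)])
  finally show ?thesis by (simp add: wt_def power_mult_distrib)
qed

text \<open>In the coordinates \<open>w\<close>, among the allowed triangles only
  \<open>tr p\<close> is nonzero in the row of \<open>ed p\<close>. Without it the matrix has a zero
  row.\<close>

lemma wt_strip:
  assumes S: "S \<subseteq> free \<union> strip" "card S = card E" and nz: "wt S \<noteq> 0"
  shows "strip \<subseteq> S"
proof (rule ccontr)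
  assume "\<not> strip \<subseteq> S"
  then obtain p where p: "p \<in> P" "tr p \<notin> S" by (auto simp: strip_def)
  have fS: "finite S" using S finite_sets finite_subset by blast
  have "fdet E S (\<lambda>e t. w t e) = 0"
  proof (rule fdet_zero_row[OF finite_edges_off fS S(2) ed_in[OF p(1)]])
    fix t assume t: "t \<in> S"
    show "w t (ed p) = 0"
    proof (cases "t \<in> strip")
      case True
      then obtain q where q: "q \<in> P" "t = tr q" by (auto simp: strip_def)
      then have "ed p \<noteq> ed q" using p t inj_onD[OF inj_ed] by metis
      then show ?thesis using q by (simp add: w_tr)
    next
      case False
      then have "t \<in> free" using t S by auto
      then show ?thesis using p by (simp add: w_free v_free E0_def)
    qed
  qed
  then show False using nz wt_eq[OF S] by simp
qed

text \<open>Weight \<open>n\<close> gives the strip edges the diagonal entry required by the Gram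
  identity; all strip triangles lie in every contributing basis, so it only produces the constant
  \<open>n ^ card P\<close>. The weight \<open>1 + y\<close> marks the triangles of
  \<open>F\<close>.\<close>

definition cf :: "real \<Rightarrow> nat set set \<Rightarrow> nat set \<Rightarrow> real" where
  "cf y F t = (if t \<in> strip then real n else if t \<in> F then 1 + y else 1)"

definition M :: "real \<Rightarrow> nat set set \<Rightarrow> nat set \<Rightarrow> nat set \<Rightarrow> real" where
  "M y F i j = (\<Sum>t\<in>free \<union> strip. cf y F t * w t i * w t j)"

lemma weighted_sum:
  assumes F: "F \<subseteq> free"
  shows "(\<Sum>S | S \<subseteq> free \<union> strip \<and> card S = card E. (1 + y) ^ card (F \<inter> S) * wt S) * real n ^ card P
    = (fdet E E U)\<^sup>2 * fdet E E (M y F)"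
proof -
  have fK: "finite (free \<union> strip)" using finite_sets by auto
  have fF: "finite F" using F finite_sets finite_subset by blast
  have "fdet E E (M y F) = (\<Sum>S | S \<subseteq> free \<union> strip \<and> card S = card E. (\<Prod>t\<in>S. cf y F t) * (fdet E S (\<lambda>i t. w t i))\<^sup>2)"
    unfolding M_def by (rule fdet_gram[OF fK])
  then have "(fdet E E U)\<^sup>2 * fdet E E (M y F) = (\<Sum>S | S \<subseteq> free \<union> strip \<and> card S = card E. (fdet E E U)\<^sup>2 * ((\<Prod>t\<in>S. cf y F t) * (fdet E S (\<lambda>i t. w t i))\<^sup>2))"
    by (simp only: sum_distrib_left)
  also have "\<dots> = (\<Sum>S | S \<subseteq> free \<union> strip \<and> card S = card E. (\<Prod>t\<in>S. cf y F t) * wt S)"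
    by (rule sum.cong[OF refl]) (auto simp: wt_eq)
  also have "\<dots> = (\<Sum>S | S \<subseteq> free \<union> strip \<and> card S = card E. ((1 + y) ^ card (F \<inter> S) * wt S) * real n ^ card P)"
  proof (rule sum.cong[OF refl], clarify)
    fix S assume S: "S \<subseteq> free \<union> strip" "card S = card E"
    show "(\<Prod>t\<in>S. cf y F t) * wt S = ((1 + y) ^ card (F \<inter> S) * wt S) * real n ^ card P"
    proof (cases "wt S = 0")
      case False
      have st: "strip \<subseteq> S" by (rule wt_strip[OF S False])
      have fS: "finite S" using S fK finite_subset by blast
      have "(\<Prod>t\<in>S. cf y F t) = (\<Prod>t\<in>strip \<union> (S - strip). cf y F t)" using st by (simp add: Un_absorb1)
      also have "\<dots> = (\<Prod>t\<in>strip. cf y F t) * (\<Prod>t\<in>S - strip. cf y F t)"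
        using fS finite_sets by (intro prod.union_disjoint) auto
      also have "(\<Prod>t\<in>strip. cf y F t) = real n ^ card P"
        using card_image[OF inj_tr] by (simp add: cf_def strip_def)
      also have "(\<Prod>t\<in>S - strip. cf y F t) = (\<Prod>t\<in>F \<inter> S. 1 + y)"
        using fS F free_strip by (intro prod.mono_neutral_cong_right) (auto simp: cf_def)
      finally show ?thesis by simp
    qed simp
  qed
  finally show ?thesis by (simp add: sum_distrib_right)
qed

definition qv :: "nat set \<Rightarrow> nat set \<Rightarrow> real" where
  "qv t e = (if e \<in> E0 then 0 else v t e)"

text \<open>\<open>n\<close> times the identity minus the Gram matrix of the triangles in
  \<open>B\<close>, after deletion of their strip edges.\<close>

definition N :: "nat set set \<Rightarrow> nat set \<Rightarrow> nat set \<Rightarrow> real" where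
  "N B i j = (if i = j then real n else 0) - (\<Sum>t\<in>B. qv t i * qv t j)"

text \<open>As 1 is the smallest vertex, the sign is positive: the triangles through 1 form an
  identity matrix on \<open>E\<close>.\<close>

lemma v_root: "e \<in> E \<Longrightarrow> e' \<in> E \<Longrightarrow> v (insert 1 e) e' = (if e = e' then 1 else 0)"
proof -
  assume e: "e \<in> E" and e': "e' \<in> E"
  have fin: "finite e" "1 \<notin> e" "1 \<notin> e'" using e e' finite_subset[of e "{2..n}"] by (auto simp: edges_off_def)
  show ?thesis
  proof (cases "e = e'")
    case True
    have c: "card {x \<in> insert 1 e. x < 1} = 0" using e by (auto simp: edges_off_def)
    have "incidence (insert 1 e) (insert 1 e - {1}) = (- 1) ^ card {x \<in> insert 1 e. x < 1}"
      by (rule incidence_remove) (use fin in auto)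
    also have "\<dots> = 1" unfolding c by simp
    also have "insert 1 e - {1} = e" using fin by auto
    finally have "incidence (insert 1 e) e = 1" .
    then show ?thesis using True fin by (simp add: v_def)
  next
    case False
    have "\<not> e' \<subseteq> insert 1 e" using False fin e e' card_subset_eq[of e e'] by (auto simp: edges_off_def)
    then show ?thesis using False v_zero by simp
  qed
qed

text \<open>This is the vanishing of the double boundary. The rows missing in \<open>D\<close> do no
  harm, since a free triangle has coefficient 0 there.\<close>

lemma v_D:
  assumes t: "t \<in> free" "1 \<notin> t"
  shows "(\<Sum>l\<in>E. v t l * D l x) = 0"
proof -
  have ct: "card t = 3" and tn: "t \<subseteq> {1..n}" using t by (auto simp: free_def triangles_def)
  have "t \<subseteq> {2..n}"
  proof
    fix x assume "x \<in> t"
    then have "x \<in> {1..n}" "x \<noteq> 1" using t tn by auto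
    then show "x \<in> {2..n}" by auto
  qed
  obtain a b c where abc: "t = {a, b, c}" "a \<noteq> b" "a \<noteq> c" "b \<noteq> c" using ct by (auto simp: card_3_iff)
  have J: "{a, b} \<in> E" "{b, c} \<in> E" "{a, c} \<in> E" using abc \<open>t \<subseteq> {2..n}\<close> by (auto simp: edges_off_def)
  have "(\<Sum>l\<in>E. v t l * D l x) = (\<Sum>l\<in>E. v t l * v l {x})"
    using v_free[OF t(1)] by (intro sum.cong) (auto simp: D_def)
  also have "\<dots> = of_int (\<Sum>l\<in>E. incidence t l * incidence l {x})" by (simp add: v_def)
  also have "\<dots> = 0" unfolding abc(1) boundary_boundary[OF abc(2-4) finite_edges_off J] by simp
  finally show ?thesis .
qed

text \<open>Strip edges avoid 1, so the only one that a triangle \<open>insert 1 e\<close> could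
  contain is \<open>e\<close> itself.\<close>

lemma root_free:
  "{t \<in> free. 1 \<in> t} = insert 1 ` (E - E0)"
proof safe
  fix t assume t: "t \<in> free" "1 \<in> t"
  let ?e = "t - {1}"
  have "?e \<in> E" using t by (auto simp: free_def triangles_def edges_off_def card_Diff_singleton)
  moreover have "?e \<notin> E0" using t by (auto simp: free_def touch_def E0_def)
  moreover have "t = insert 1 ?e" using t by auto
  ultimately show "t \<in> insert 1 ` (E - E0)" by blast
next
  fix e assume e: "e \<in> E" "e \<notin> E0"
  have ff: "finite e" "1 \<notin> e" using e finite_subset[of e "{2..n}"] by (auto simp: edges_off_def)
  have n: "n \<ge> 1" using e(1) by (elim edges_offE) auto
  have "insert 1 e \<in> triangles n" using e(1) ff n by (auto simp: triangles_def edges_off_def)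
  moreover have "\<not> ed p \<subseteq> insert 1 e" if p: "p \<in> P" for p
  proof
    assume "ed p \<subseteq> insert 1 e"
    then have "ed p \<subseteq> e" using touch_root[OF p] by auto
    then have "ed p = e" using ed_in[OF p] e(1) ff by (auto simp: edges_off_def card_subset_eq)
    then show False using e(2) p by (auto simp: E0_def)
  qed
  ultimately show "insert 1 e \<in> free" by (auto simp: free_def touch_def)
qed

text \<open>Strip vectors annihilate \<open>D\<close> because \<open>D\<close> vanishes on
  \<open>E0\<close>, and free triangles off 1 do so by \<open>v_D\<close>. The triangles through 1
  carry weight 1, as \<open>F\<close> avoids them, and act as the identity on
  \<open>E - E0\<close>.\<close>

lemma M_D:
  assumes F: "F \<subseteq> free" "\<And>t. t \<in> F \<Longrightarrow> 1 \<notin> t" and i: "i \<in> E"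
  shows "(\<Sum>l\<in>E. M y F i l * D l x) = D i x"
proof -
  have fin: "finite (free \<union> strip)" using finite_sets by auto
  let ?s = "\<lambda>t. \<Sum>l\<in>E. w t l * D l x"
  have "(\<Sum>l\<in>E. M y F i l * D l x) = (\<Sum>t\<in>free \<union> strip. cf y F t * w t i * ?s t)"
    unfolding M_def sum_distrib_right sum_distrib_left by (subst sum.swap) (simp add: mult_ac)
  also have "\<dots> = (\<Sum>t\<in>{t \<in> free. 1 \<in> t}. cf y F t * w t i * ?s t)"
  proof (rule sum.mono_neutral_right[OF fin])
    show "\<forall>t\<in>free \<union> strip - {t \<in> free. 1 \<in> t}. cf y F t * w t i * ?s t = 0"
    proof
      fix t assume t: "t \<in> free \<union> strip - {t \<in> free. 1 \<in> t}"
      have "?s t = 0"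
      proof (cases "t \<in> strip")
        case True
        then obtain p where p: "p \<in> P" "t = tr p" by (auto simp: strip_def)
        show ?thesis by (rule sum.neutral) (use p in \<open>auto simp: w_tr D_def E0_def\<close>)
      next
        case False
        then have "t \<in> free" "1 \<notin> t" using t by auto
        then show ?thesis using v_D by (simp add: w_free)
      qed
      then show "cf y F t * w t i * ?s t = 0" by simp
    qed
  qed auto
  also have "\<dots> = (\<Sum>e\<in>E - E0. cf y F (insert 1 e) * w (insert 1 e) i * ?s (insert 1 e))"
  proof -
    have "inj_on (insert 1) (E - E0)"
    proof (rule inj_onI)
      fix x y assume "x \<in> E - E0" "y \<in> E - E0" and e: "insert 1 x = insert (1 :: nat) y"
      then have "1 \<notin> x" "1 \<notin> y" by (auto simp: edges_off_def)
      then show "x = y" using e insert_ident[of 1 x y] by blast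
    qed
    then show ?thesis unfolding root_free by (simp add: sum.reindex)
  qed
  also have "\<dots> = (\<Sum>e\<in>E - E0. if e = i then D e x else 0)"
  proof (rule sum.cong[OF refl])
    fix e assume e: "e \<in> E - E0"
    have f: "insert 1 e \<in> free" using root_free e by blast
    have ns: "insert 1 e \<notin> strip" using f free_strip by auto
    have nF: "insert 1 e \<notin> F" using F(2)[of "insert 1 e"] by auto
    have "?s (insert 1 e) = (\<Sum>l\<in>E. if l = e then D e x else 0)"
      using e by (intro sum.cong) (auto simp: w_free[OF f] v_root)
    then have s: "?s (insert 1 e) = D e x" using e finite_edges_off[of n] by simp
    have "w (insert 1 e) i = (if e = i then 1 else 0)" using e i by (simp add: w_free[OF f] v_root)
    then show "cf y F (insert 1 e) * w (insert 1 e) i * ?s (insert 1 e) = (if e = i then D e x else 0)"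
      unfolding s using ns nF by (simp add: cf_def)
  qed
  also have "\<dots> = D i x" using i finite_edges_off[of n] by (auto simp: D_def)
  finally show ?thesis .
qed

section \<open>Coercivity after removal of the touched triangles\<close>

lemma qv_cases:
  assumes "t \<in> touch"
  obtains J where "J \<subseteq> E - E0" "finite J" "card J \<le> 2" "\<And>e. e \<in> J \<Longrightarrow> e \<subseteq> t \<and> \<bar>qv t e\<bar> \<le> 1" "\<And>e. e \<in> E - J \<Longrightarrow> qv t e = 0"
proof -
  obtain p where p: "p \<in> P" "ed p \<subseteq> t" and t: "t \<in> triangles n" using assms by (auto simp: touch_def)
  have ft: "finite t" "card t = 3" using t finite_subset[of t "{1..n}"] by (auto simp: triangles_def)
  let ?A = "{e. e \<subseteq> t \<and> card e = 2}"
  have cA: "finite ?A" "card ?A = 3" using ft n_subsets[OF ft(1), of 2] by (auto simp: choose_two)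
  have "ed p \<in> ?A" using p ed_in[OF p(1)] by (auto simp: edges_off_def)
  then have cJ: "card (?A - {ed p}) \<le> 2" using cA by simp
  show thesis
  proof (rule that[of "(?A \<inter> E - E0)"])
    have "?A \<inter> E - E0 \<subseteq> ?A - {ed p}" using p by (auto simp: E0_def)
    then show "card (?A \<inter> E - E0) \<le> 2" using cJ cA card_mono[of "?A - {ed p}" "?A \<inter> E - E0"] by simp
    show "e \<subseteq> t \<and> \<bar>qv t e\<bar> \<le> 1" if "e \<in> ?A \<inter> E - E0" for e
    proof -
      have "(v t e)\<^sup>2 = 1" using incidence_square[of t e] that ft
        by (auto simp: v_def simp flip: of_int_power)
      then show ?thesis using that by (auto simp: qv_def power2_eq_1_iff)
    qed
    show "qv t e = 0" if "e \<in> E - (?A \<inter> E - E0)" for e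
      using that v_zero[of e t] by (auto simp: qv_def edges_off_def)
  qed (use cA in auto)
qed

lemma qv_norm: "t \<in> touch \<Longrightarrow> (\<Sum>e\<in>E. (qv t e)\<^sup>2) \<le> 2"
proof -
  assume "t \<in> touch"
  then obtain J where J: "J \<subseteq> E - E0" "finite J" "card J \<le> 2" "\<And>e. e \<in> J \<Longrightarrow> e \<subseteq> t \<and> \<bar>qv t e\<bar> \<le> 1" "\<And>e. e \<in> E - J \<Longrightarrow> qv t e = 0"
    by (rule qv_cases) (rule that)
  have "(\<Sum>e\<in>E. (qv t e)\<^sup>2) = (\<Sum>e\<in>J. (qv t e)\<^sup>2)"
    using J finite_edges_off[of n] by (intro sum.mono_neutral_right) auto
  also have "\<dots> \<le> (\<Sum>e\<in>J. 1)" using J(4) by (intro sum_mono) (auto simp: abs_square_le_1)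
  also have "\<dots> \<le> 2" using J(3) by simp
  finally show ?thesis .
qed

lemma qv_form:
  assumes "t \<in> touch"
  shows "(\<Sum>e\<in>E. qv t e * x e)\<^sup>2 \<le> 2 * (\<Sum>e\<in>{e \<in> E - E0. e \<subseteq> t}. (x e)\<^sup>2)"
proof -
  obtain J where J: "J \<subseteq> E - E0" "finite J" "card J \<le> 2" "\<And>e. e \<in> J \<Longrightarrow> e \<subseteq> t \<and> \<bar>qv t e\<bar> \<le> 1" "\<And>e. e \<in> E - J \<Longrightarrow> qv t e = 0"
    using assms by (rule qv_cases) (rule that)
  have "(\<Sum>e\<in>E. qv t e * x e) = (\<Sum>e\<in>J. qv t e * x e)"
    using J finite_edges_off[of n] by (intro sum.mono_neutral_right) auto
  then have "(\<Sum>e\<in>E. qv t e * x e)\<^sup>2 \<le> (\<Sum>e\<in>J. (qv t e)\<^sup>2) * (\<Sum>e\<in>J. (x e)\<^sup>2)"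
    by (simp add: Cauchy_Schwarz_ineq_sum)
  also have "(\<Sum>e\<in>J. (qv t e)\<^sup>2) \<le> (\<Sum>e\<in>J. 1)" using J(4) by (intro sum_mono) (auto simp: abs_square_le_1)
  also have "(\<Sum>e\<in>J. 1 :: real) \<le> 2" using J(3) by simp
  also have "(\<Sum>e\<in>J. (x e)\<^sup>2) \<le> (\<Sum>e\<in>{e \<in> E - E0. e \<subseteq> t}. (x e)\<^sup>2)"
    using J finite_edges_off[of n] by (intro sum_mono2) auto
  finally show ?thesis by (simp add: mult_right_mono mult_left_mono sum_nonneg)
qed

text \<open>The strip edge in a touched triangle over \<open>e = {a, b}\<close> joins the third
  vertex to \<open>a\<close> or to \<open>b\<close>. Each vertex lies on at most two strip edges,
  which leaves at most four third vertices.\<close>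

lemma touch_count:
  assumes e: "e \<in> E - E0"
  shows "card {t \<in> touch. e \<subseteq> t} \<le> 4"
proof -
  obtain a b where ab: "e = {a, b}" "a \<noteq> b" using e edges_offE by blast
  define nb where "nb x = {y. \<exists>p\<in>P. ed p = {x, y}}" for x
  have nb: "finite (nb x) \<and> card (nb x) \<le> 2" for x
  proof (cases "x \<in> u ` P")
    case True
    then obtain p where p: "p \<in> P" "x = u p" by auto
    define r where "r = \<sigma> (\<sigma> (\<sigma> (\<sigma> p)))"
    have r: "r \<in> P" "\<sigma> r = p" using p \<sigma>_in \<sigma>_5 by (auto simp: r_def)
    have "nb x \<subseteq> {u (\<sigma> p), u r}"
    proof
      fix y assume "y \<in> nb x"
      then obtain q where q: "q \<in> P" "ed q = {x, y}" by (auto simp: nb_def)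
      then have "x = u q \<and> y = u (\<sigma> q) \<or> x = u (\<sigma> q) \<and> y = u q" by (auto simp: ed_def doubleton_eq_iff)
      then have "q = p \<and> y = u (\<sigma> q) \<or> \<sigma> q = p \<and> y = u q" using p q by (auto simp: u_eq \<sigma>_in)
      then show "y \<in> {u (\<sigma> p), u r}" using r \<sigma>_inj[OF q(1) r(1)] by auto
    qed
    then show ?thesis using card_mono[of "{u (\<sigma> p), u r}" "nb x"] card_insert_le_m1[of 2 "{u r}" "u (\<sigma> p)"]
      by (auto intro: finite_subset)
  next
    case False
    then have "nb x = {}" using \<sigma>_in by (auto simp: nb_def ed_def doubleton_eq_iff)
    then show ?thesis by simp
  qed
  have "{t \<in> touch. e \<subseteq> t} \<subseteq> (\<lambda>y. insert y e) ` (nb a \<union> nb b)"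
  proof
    fix t assume "t \<in> {t \<in> touch. e \<subseteq> t}"
    then obtain p where p: "p \<in> P" "ed p \<subseteq> t" and t: "t \<in> triangles n" "e \<subseteq> t" by (auto simp: touch_def)
    have ft: "finite t" "card t = 3" using t finite_subset[of t "{1..n}"] by (auto simp: triangles_def)
    have "card (t - e) = 1" using ft t(2) ab by (simp add: card_Diff_subset)
    then obtain y where y: "t - e = {y}" using card_1_singletonE by blast
    then have ty: "t = {a, b, y}" "y \<noteq> a" "y \<noteq> b" using t(2) ab by auto
    have "ed p \<noteq> e" using e p by (auto simp: E0_def)
    moreover have "card (ed p) = 2" using ed_in[OF p(1)] by (simp add: edges_off_def)
    ultimately have "ed p = {a, y} \<or> ed p = {b, y}"
      using p(2) ty ab by (auto simp: card_2_iff doubleton_eq_iff)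
    then have "y \<in> nb a \<union> nb b" using p(1) by (auto simp: nb_def)
    then show "t \<in> (\<lambda>y. insert y e) ` (nb a \<union> nb b)" using ty ab by (auto simp: insert_commute)
  qed
  moreover have fnb: "finite (nb a \<union> nb b)" using nb by simp
  ultimately have "card {t \<in> touch. e \<subseteq> t} \<le> card ((\<lambda>y. insert y e) ` (nb a \<union> nb b))"
    by (intro card_mono) auto
  also have "\<dots> \<le> card (nb a \<union> nb b)" by (rule card_image_le[OF fnb])
  also have "\<dots> \<le> card (nb a) + card (nb b)" by (rule card_Un_le)
  also have "\<dots> \<le> 4" using nb[of a] nb[of b] by simp
  finally show ?thesis .
qed

text \<open>The constant 8 is 2 times 4. A touched triangle has at most two sides outside
  \<open>E0\<close>, so its squared term costs at most twice their squares; each edge occurs in at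
  most four touched triangles.\<close>

lemma N_coercive: "coercive_on E (real n - 8) (N touch)"
  unfolding coercive_on_def
proof
  fix x :: "nat set \<Rightarrow> real"
  let ?X = "\<Sum>e\<in>E. (x e)\<^sup>2"
  have "(\<Sum>i\<in>E. \<Sum>j\<in>E. x i * N touch i j * x j)
      = (\<Sum>i\<in>E. \<Sum>j\<in>E. if i = j then real n * (x i)\<^sup>2 else 0) - (\<Sum>i\<in>E. \<Sum>j\<in>E. \<Sum>t\<in>touch. x i * (1 * qv t i * qv t j) * x j)"
    unfolding sum_subtractf[symmetric]
    by (intro sum.cong refl) (simp add: N_def algebra_simps sum_distrib_left sum_distrib_right power2_eq_square)
  also have "(\<Sum>i\<in>E. \<Sum>j\<in>E. if i = j then real n * (x i)\<^sup>2 else 0) = real n * ?X"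
    using finite_edges_off[of n] by (simp add: sum_distrib_left)
  also have "(\<Sum>i\<in>E. \<Sum>j\<in>E. \<Sum>t\<in>touch. x i * (1 * qv t i * qv t j) * x j)
      = (\<Sum>t\<in>touch. \<Sum>i\<in>E. \<Sum>j\<in>E. x i * (1 * qv t i * qv t j) * x j)"
    by (subst sum.swap, subst (2) sum.swap) (rule refl)
  also have "\<dots> = (\<Sum>t\<in>touch. (\<Sum>e\<in>E. qv t e * x e)\<^sup>2)"
    unfolding rank_one_quadratic_form by simp
  finally have eq: "(\<Sum>i\<in>E. \<Sum>j\<in>E. x i * N touch i j * x j) = real n * ?X - (\<Sum>t\<in>touch. (\<Sum>e\<in>E. qv t e * x e)\<^sup>2)" .
  have "(\<Sum>t\<in>touch. (\<Sum>e\<in>E. qv t e * x e)\<^sup>2) \<le> (\<Sum>t\<in>touch. 2 * (\<Sum>e\<in>{e \<in> E - E0. e \<subseteq> t}. (x e)\<^sup>2))"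
    by (intro sum_mono qv_form)
  also have "\<dots> = 2 * (\<Sum>t\<in>touch. \<Sum>e\<in>E - E0. if e \<subseteq> t then (x e)\<^sup>2 else 0)"
  proof -
    have "(\<Sum>e\<in>{e \<in> E - E0. e \<subseteq> t}. (x e)\<^sup>2) = (\<Sum>e\<in>E - E0. if e \<subseteq> t then (x e)\<^sup>2 else 0)" for t
      by (rule sum.inter_filter) (simp add: finite_edges_off)
    then show ?thesis by (simp only: sum_distrib_left)
  qed
  also have "\<dots> = 2 * (\<Sum>e\<in>E - E0. \<Sum>t\<in>touch. if e \<subseteq> t then (x e)\<^sup>2 else 0)"
    by (subst sum.swap) (rule refl)
  also have "\<dots> = 2 * (\<Sum>e\<in>E - E0. real (card {t \<in> touch. e \<subseteq> t}) * (x e)\<^sup>2)"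
    using finite_sets by (simp add: sum.inter_filter[symmetric])
  also have "\<dots> \<le> 2 * (\<Sum>e\<in>E - E0. 4 * (x e)\<^sup>2)"
    using touch_count by (intro mult_left_mono sum_mono mult_right_mono) auto
  also have "\<dots> \<le> 2 * (\<Sum>e\<in>E. 4 * (x e)\<^sup>2)"
    using finite_edges_off[of n] by (intro mult_left_mono sum_mono2) auto
  finally have "(\<Sum>t\<in>touch. (\<Sum>e\<in>E. qv t e * x e)\<^sup>2) \<le> 8 * ?X" by (simp add: sum_distrib_left[symmetric])
  then show "(real n - 8) * ?X \<le> (\<Sum>i\<in>E. \<Sum>j\<in>E. x i * N touch i j * x j)"
    unfolding eq by (simp add: algebra_simps)
qed

section \<open>Comparison with \<open>n\<close> times the identity and weight bounds\<close>

abbreviation "V \<equiv> {2..n}"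

lemma edge_gram_real:
  assumes "i \<in> E" "j \<in> E"
  shows "(\<Sum>t\<in>triangles n. v t i * v t j) + (\<Sum>x\<in>V. v i {x} * v j {x}) = (if i = j then real n else 0)"
proof -
  have "(\<Sum>t\<in>triangles n. v t i * v t j) + (\<Sum>x\<in>V. v i {x} * v j {x})
     = of_int ((\<Sum>t\<in>triangles n. incidence t i * incidence t j) + (\<Sum>x\<in>V. incidence i {x} * incidence j {x}))"
    by (simp add: v_def)
  then show ?thesis unfolding edge_gram[OF assms] by simp
qed

text \<open>If neither index lies in \<open>E0\<close>, this is the Gram identity with the touched
  triangles moved to the right-hand side. Otherwise only the strip weight \<open>n\<close> survives,
  and only on the diagonal.\<close>

lemma M_plus_DD:
  assumes F: "F \<subseteq> free" and i: "i \<in> E" and j: "j \<in> E"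
  shows "M y F i j + (\<Sum>x\<in>V. D i x * D j x) = N touch i j + (\<Sum>t\<in>F. y * v t i * v t j)"
proof -
  have fF: "finite F" using F finite_sets finite_subset by blast
  have split: "M y F i j = (\<Sum>t\<in>free. cf y F t * v t i * v t j) + (\<Sum>t\<in>strip. real n * w t i * w t j)"
    unfolding M_def using finite_sets free_strip
    by (subst sum.union_disjoint) (auto simp: w_free cf_def intro!: sum.cong)
  have fr: "(\<Sum>t\<in>free. cf y F t * v t i * v t j) = (\<Sum>t\<in>free. v t i * v t j) + (\<Sum>t\<in>F. y * v t i * v t j)"
  proof -
    have "(\<Sum>t\<in>free. cf y F t * v t i * v t j) = (\<Sum>t\<in>free. v t i * v t j + (if t \<in> F then y * v t i * v t j else 0))"
      using free_strip by (intro sum.cong) (auto simp: cf_def algebra_simps)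
    also have "\<dots> = (\<Sum>t\<in>free. v t i * v t j) + (\<Sum>t\<in>free \<inter> F. y * v t i * v t j)"
      using finite_sets by (simp add: sum.distrib sum.inter_restrict)
    also have "free \<inter> F = F" using F by auto
    finally show ?thesis .
  qed
  show ?thesis
  proof (cases "i \<in> E0 \<or> j \<in> E0")
    case True
    have z: "v t i * v t j = 0" if "t \<in> free" for t using v_free[OF that] True by auto
    have "(\<Sum>t\<in>strip. real n * w t i * w t j) = (\<Sum>p\<in>P. real n * w (tr p) i * w (tr p) j)"
      unfolding strip_def by (rule sum.reindex_cong[OF inj_tr]) auto
    also have "\<dots> = (\<Sum>p\<in>P. if i = ed p \<and> j = ed p then real n else 0)"
      by (intro sum.cong refl) (auto simp: w_tr)
    also have "\<dots> = (if i = j then real n else 0)"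
    proof (cases "i = j")
      case eq: True
      then obtain p where p: "p \<in> P" "i = ed p" using True by (auto simp: E0_def)
      have "(\<Sum>q\<in>P. if i = ed q \<and> j = ed q then real n else 0) = (\<Sum>q\<in>P. if q = p then real n else 0)"
        using p eq inj_onD[OF inj_ed, of p] by (intro sum.cong) auto
      then show ?thesis using p finite_P eq by simp
    qed (auto intro: sum.neutral)
    finally have st: "(\<Sum>t\<in>strip. real n * w t i * w t j) = (if i = j then real n else 0)" .
    have "(\<Sum>t\<in>F. y * v t i * v t j) = 0" using z F by (intro sum.neutral) (auto simp: mult.assoc)
    moreover have "(\<Sum>t\<in>free. v t i * v t j) = 0" using z by (intro sum.neutral) auto
    moreover have "(\<Sum>x\<in>V. D i x * D j x) = 0" using True by (auto simp: D_def)
    moreover have "(\<Sum>t\<in>touch. qv t i * qv t j) = 0" using True by (auto simp: qv_def)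
    ultimately show ?thesis unfolding split fr st N_def by simp
  next
    case False
    have "(\<Sum>t\<in>strip. real n * w t i * w t j) = 0"
      using False by (intro sum.neutral) (auto simp: strip_def w_tr E0_def)
    moreover have "(\<Sum>x\<in>V. D i x * D j x) = (\<Sum>x\<in>V. v i {x} * v j {x})" using False by (simp add: D_def)
    moreover have "(\<Sum>t\<in>touch. qv t i * qv t j) = (\<Sum>t\<in>touch. v t i * v t j)" using False by (simp add: qv_def)
    moreover have "(\<Sum>t\<in>triangles n. v t i * v t j) = (\<Sum>t\<in>free. v t i * v t j) + (\<Sum>t\<in>touch. v t i * v t j)"
      unfolding free_def by (rule sum.subset_diff) (auto simp: touch_def finite_triangles)
    ultimately show ?thesis unfolding split fr N_def using edge_gram_real[OF i j] by simp
  qed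
qed

text \<open>Since \<open>A\<close> fixes the columns of \<open>d\<close>, multiplying
  \<open>A\<close> by the identity plus \<open>d\<close> times its transpose adds that product to
  \<open>A\<close>.\<close>

lemma fdet_product:
  fixes A :: "nat set \<Rightarrow> nat set \<Rightarrow> real"
  assumes MD: "\<And>i x. i \<in> E \<Longrightarrow> (\<Sum>l\<in>E. A i l * d l x) = d i x"
  shows "fdet E E A * fdet E E (\<lambda>i j. (if i = j then 1 else 0) + (\<Sum>x\<in>V. d i x * d j x))
    = fdet E E (\<lambda>i j. A i j + (\<Sum>x\<in>V. d i x * d j x))"
proof -
  note fE = finite_edges_off[of n]
  have "fdet E E A * fdet E E (\<lambda>i j. (if i = j then 1 else 0) + (\<Sum>x\<in>V. d i x * d j x))
    = fdet E E (\<lambda>i j. \<Sum>l\<in>E. A i l * ((if l = j then 1 else 0) + (\<Sum>x\<in>V. d l x * d j x)))"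
    by (rule fdet_mult[OF fE fE refl, symmetric])
  also have "\<dots> = fdet E E (\<lambda>i j. A i j + (\<Sum>x\<in>V. d i x * d j x))"
  proof (rule fdet_cong[OF _ fE fE refl])
    fix i j assume ij: "i \<in> E" "j \<in> E"
    have "(\<Sum>l\<in>E. A i l * ((if l = j then 1 else 0) + (\<Sum>x\<in>V. d l x * d j x)))
      = (\<Sum>l\<in>E. if l = j then A i j else 0) + (\<Sum>l\<in>E. \<Sum>x\<in>V. A i l * d l x * d j x)"
      unfolding sum.distrib[symmetric] by (intro sum.cong) (auto simp: distrib_left sum_distrib_left mult.assoc)
    also have "(\<Sum>l\<in>E. \<Sum>x\<in>V. A i l * d l x * d j x) = (\<Sum>x\<in>V. (\<Sum>l\<in>E. A i l * d l x) * d j x)"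
      unfolding sum_distrib_right by (rule sum.swap)
    finally show "(\<Sum>l\<in>E. A i l * ((if l = j then 1 else 0) + (\<Sum>x\<in>V. d l x * d j x))) = A i j + (\<Sum>x\<in>V. d i x * d j x)"
      using ij fE MD[OF ij(1)] by simp
  qed
  finally show ?thesis .
qed

text \<open>Sylvester's identity turns these into Gram determinants over the vertices, of the unit
  vectors together with edge vectors. They grow from 1 when edges are added: none, then
  \<open>E - E0\<close>, then all of \<open>E\<close>.\<close>

lemma fdet_DD_mono:
  "1 \<le> fdet E E (\<lambda>i j. (if i = j then 1 else 0) + (\<Sum>x\<in>V. D i x * D j x))"
  "fdet E E (\<lambda>i j. (if i = j then 1 else 0) + (\<Sum>x\<in>V. D i x * D j x))
    \<le> fdet E E (\<lambda>i j. (if i = j then 1 else 0) + (\<Sum>x\<in>V. v i {x} * v j {x}))"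
proof -
  \<comment> \<open>\<open>Inl\<close> indexes the unit vectors that produce the identity matrix,
    \<open>Inr\<close> the edge vectors; this brings the sum into the form required by
    \<open>fdet_gram_mono\<close>.\<close>
  define f where "f k x = (case k of Inl y \<Rightarrow> (if x = y then 1 else 0) | Inr e \<Rightarrow> v e {x})" for k :: "nat + nat set" and x :: nat
  note fE = finite_edges_off[of n]
  have g: "fdet V V (\<lambda>x y. (if x = y then 1 else 0) + (\<Sum>e\<in>X. v e {x} * v e {y}))
      = fdet V V (\<lambda>x y. \<Sum>k\<in>Inl ` V \<union> Inr ` X. f k x * f k y)" if "X \<subseteq> E" for X
  proof (rule fdet_cong)
    fix x y assume xy: "x \<in> V" "y \<in> V"
    have fX: "finite X" using that fE finite_subset by blast
    have "(\<Sum>k\<in>Inl ` V \<union> Inr ` X. f k x * f k y) = (\<Sum>k\<in>Inl ` V. f k x * f k y) + (\<Sum>k\<in>Inr ` X. f k x * f k y)"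
      using fX by (intro sum.union_disjoint) auto
    also have "(\<Sum>k\<in>Inr ` X. f k x * f k y) = (\<Sum>e\<in>X. v e {x} * v e {y})"
      by (subst sum.reindex) (auto simp: f_def)
    also have "(\<Sum>k\<in>Inl ` V. f k x * f k y) = (\<Sum>z\<in>V. f (Inl z) x * f (Inl z) y)"
      by (subst sum.reindex) auto
    also have "\<dots> = (\<Sum>z\<in>V. if z = x then (if x = y then 1 else 0) else 0)"
      by (intro sum.cong refl) (auto simp: f_def)
    also have "\<dots> = (if x = y then 1 else 0)" using xy by simp
    finally show "(if x = y then 1 else 0) + (\<Sum>e\<in>X. v e {x} * v e {y}) = (\<Sum>k\<in>Inl ` V \<union> Inr ` X. f k x * f k y)" ..
  qed auto
  have s1: "fdet E E (\<lambda>i j. (if i = j then 1 else 0) + (\<Sum>x\<in>V. D i x * D j x))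
     = fdet V V (\<lambda>x y. (if x = y then 1 else 0) + (\<Sum>e\<in>E - E0. v e {x} * v e {y}))"
  proof -
    have "fdet E E (\<lambda>i j. (if i = j then 1 else 0) + (\<Sum>x\<in>V. D i x * D j x))
      = fdet V V (\<lambda>x y. (if x = y then 1 else 0) + (\<Sum>e\<in>E. D e x * D e y))"
      by (rule fdet_sylvester[OF fE, of V D "\<lambda>x j. D j x"]) simp
    also have "(\<lambda>x y. \<Sum>e\<in>E. D e x * D e y) = (\<lambda>x y. \<Sum>e\<in>E - E0. v e {x} * v e {y})"
      using fE by (intro ext sum.mono_neutral_cong_right) (auto simp: D_def)
    then have "(\<lambda>x y. (if x = y then 1 else 0) + (\<Sum>e\<in>E. D e x * D e y)) = (\<lambda>x y. (if x = y then 1 else 0) + (\<Sum>e\<in>E - E0. v e {x} * v e {y}))"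
      by (simp add: fun_eq_iff)
    finally show ?thesis .
  qed
  have s2: "fdet E E (\<lambda>i j. (if i = j then 1 else 0) + (\<Sum>x\<in>V. v i {x} * v j {x}))
     = fdet V V (\<lambda>x y. (if x = y then 1 else 0) + (\<Sum>e\<in>E. v e {x} * v e {y}))"
    by (rule fdet_sylvester[OF fE, of V "\<lambda>i x. v i {x}" "\<lambda>x j. v j {x}"]) simp
  have s0: "fdet V V (\<lambda>x y. (if x = y then 1 else 0) + (\<Sum>e\<in>{}. v e {x} * v e {y})) = 1"
    using fdet_diagonal[of V "\<lambda>_. 1 :: real"] by simp
  show "fdet E E (\<lambda>i j. (if i = j then 1 else 0) + (\<Sum>x\<in>V. D i x * D j x))
    \<le> fdet E E (\<lambda>i j. (if i = j then 1 else 0) + (\<Sum>x\<in>V. v i {x} * v j {x}))"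
    unfolding s1 s2 g[OF Diff_subset] g[OF order_refl] by (rule fdet_gram_mono) (use fE in auto)
  have "fdet V V (\<lambda>x y. (if x = y then 1 else 0) + (\<Sum>e\<in>{}. v e {x} * v e {y}))
      \<le> fdet V V (\<lambda>x y. (if x = y then 1 else 0) + (\<Sum>e\<in>E - E0. v e {x} * v e {y}))"
    unfolding g[OF Diff_subset] g[OF empty_subsetI] by (rule fdet_gram_mono) (use fE in auto)
  then show "1 \<le> fdet E E (\<lambda>i j. (if i = j then 1 else 0) + (\<Sum>x\<in>V. D i x * D j x))"
    unfolding s0 s1 .
qed

text \<open>The case without strips. The determinant of the vertex part is left unevaluated: only
  its comparison with the one for \<open>D\<close> matters.\<close>

lemma total_weight:
  "(\<Sum>S | S \<subseteq> triangles n \<and> card S = card E. wt S) * fdet E E (\<lambda>i j. (if i = j then 1 else 0) + (\<Sum>x\<in>V. v i {x} * v j {x})) = real n ^ card E"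
proof -
  note fE = finite_edges_off[of n]
  define A where "A i j = (\<Sum>t\<in>triangles n. v t i * v t j)" for i j
  have "fdet E E A = (\<Sum>S | S \<subseteq> triangles n \<and> card S = card E. wt S)"
    unfolding A_def wt_def using fdet_gram[OF finite_triangles[of n], of E "\<lambda>_. 1" v] by simp
  moreover have "fdet E E A * fdet E E (\<lambda>i j. (if i = j then 1 else 0) + (\<Sum>x\<in>V. v i {x} * v j {x}))
    = fdet E E (\<lambda>i j. A i j + (\<Sum>x\<in>V. v i {x} * v j {x}))"
  proof (rule fdet_product)
    fix i x assume i: "i \<in> E"
    \<comment> \<open>With no strips, \<open>M 0 {}\<close> is the Gram matrix of all triangles and
      \<open>D\<close> the whole vertex incidence, so \<open>M_D\<close> applies.\<close>
    interpret empty: strips n "{}" \<sigma> u by unfold_locales auto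
    have ef: "empty.free = triangles n" by (auto simp: empty.free_def empty.touch_def)
    have "(\<Sum>l\<in>E. empty.M 0 {} i l * empty.D l x) = empty.D i x"
      by (rule empty.M_D) (use i in auto)
    moreover have "empty.M 0 {} = A"
      by (auto simp: fun_eq_iff empty.M_def A_def ef empty.strip_def empty.cf_def empty.w_def empty.v_def v_def)
    moreover have "empty.D l x = v l {x}" for l by (simp add: empty.D_def empty.E0_def empty.v_def v_def)
    ultimately show "(\<Sum>l\<in>E. A i l * v l {x}) = v i {x}" by simp
  qed
  moreover have "fdet E E (\<lambda>i j. A i j + (\<Sum>x\<in>V. v i {x} * v j {x})) = fdet E E (\<lambda>i j. if i = j then real n else 0)"
    by (rule fdet_cong[OF _ fE fE refl]) (simp add: A_def edge_gram_real)
  moreover have "\<dots> = real n ^ card E" by (simp add: fdet_diagonal[OF fE, of "\<lambda>_. real n"])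
  ultimately show ?thesis by simp
qed

definition Wt :: "nat set set \<Rightarrow> real" where
  "Wt F = (\<Sum>S | S \<subseteq> triangles n - bad \<and> card S = card E \<and> F \<subseteq> S. wt S)"

lemma M_N:
  assumes F: "F \<subseteq> free" "\<And>t. t \<in> F \<Longrightarrow> 1 \<notin> t"
  shows "fdet E E (M y F) * fdet E E (\<lambda>i j. (if i = j then 1 else 0) + (\<Sum>x\<in>V. D i x * D j x))
    = fdet E E (\<lambda>i j. N touch i j + (\<Sum>t\<in>F. y * v t i * v t j))"
proof -
  note fE = finite_edges_off[of n]
  have "fdet E E (M y F) * fdet E E (\<lambda>i j. (if i = j then 1 else 0) + (\<Sum>x\<in>V. D i x * D j x))
    = fdet E E (\<lambda>i j. M y F i j + (\<Sum>x\<in>V. D i x * D j x))"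
    by (rule fdet_product[OF M_D[OF F]])
  also have "\<dots> = fdet E E (\<lambda>i j. N touch i j + (\<Sum>t\<in>F. y * v t i * v t j))"
    by (rule fdet_cong[OF _ fE fE refl]) (rule M_plus_DD[OF F(1)])
  finally show ?thesis .
qed

text \<open>Adding the truncated vectors back, one for each touched triangle, restores
  \<open>n\<close> times the identity; each has squared norm at most 2.\<close>

lemma N_lower:
  assumes n: "n > 8"
  obtains r where "1 \<le> r" "r \<le> (1 + 2 / (real n - 8)) ^ card touch" "real n ^ card E = fdet E E (N touch) * r"
proof -
  note fE = finite_edges_off[of n]
  have "\<exists>r. 1 \<le> r \<and> r \<le> (1 + 1 * 2 / (real n - 8)) ^ card touch \<and>
    fdet E E (\<lambda>i j. N touch i j + (\<Sum>t\<in>touch. 1 * qv t i * qv t j)) = fdet E E (N touch) * r"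
    using n finite_sets by (intro fdet_rank_one_updates[OF fE N_coercive] qv_norm) auto
  moreover have "(\<lambda>i j. N touch i j + (\<Sum>t\<in>touch. 1 * qv t i * qv t j)) = (\<lambda>i j. if i = j then real n else 0)"
    by (auto simp: N_def fun_eq_iff)
  ultimately show thesis using that fdet_diagonal[OF fE, of "\<lambda>_. real n"] by auto
qed

text \<open>\<open>?Z * ?k\<close> is \<open>?M * ?d * r\<close>, by the total weight and
  \<open>N_lower\<close>. Since \<open>?d \<le> ?k\<close>, this gives
  \<open>?Z \<le> ?M * r\<close>; the factor \<open>(fdet E E U)\<^sup>2\<close>, at least 1, and
  the strip weights turn \<open>?M\<close> into \<open>Wt {}\<close>.\<close>

lemma Wt_empty_lower:
  assumes n: "n > 8"
  shows "(\<Sum>S | S \<subseteq> triangles n \<and> card S = card E. wt S) \<le> Wt {} * (real n ^ card P * (1 + 2 / (real n - 8)) ^ card touch)"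
proof -
  let ?d = "fdet E E (\<lambda>i j. (if i = j then 1 else 0) + (\<Sum>x\<in>V. D i x * D j x))"
  let ?k = "fdet E E (\<lambda>i j. (if i = j then 1 else 0) + (\<Sum>x\<in>V. v i {x} * v j {x}))"
  let ?Z = "\<Sum>S | S \<subseteq> triangles n \<and> card S = card E. wt S"
  let ?M = "fdet E E (M 0 {})"
  obtain r where r: "1 \<le> r" "r \<le> (1 + 2 / (real n - 8)) ^ card touch" "real n ^ card E = fdet E E (N touch) * r"
    using N_lower[OF n] .
  have d: "1 \<le> ?d" "?d \<le> ?k" by (rule fdet_DD_mono)+
  have Z: "0 \<le> ?Z" by (intro sum_nonneg) (simp add: wt_def)
  have "?M * ?d = fdet E E (N touch)" using M_N[of "{}" 0] by simp
  then have e: "?Z * ?k = ?M * ?d * r" using total_weight r(3) by simp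
  have "?Z * ?k \<ge> 0" using Z d by simp
  then have M0: "0 \<le> ?M" using e d r(1) by (simp add: zero_le_mult_iff)
  have "?Z * ?d \<le> ?Z * ?k" using d Z by (intro mult_left_mono) auto
  then have "?Z * ?d \<le> (?M * r) * ?d" unfolding e by (simp add: mult_ac)
  then have "?Z \<le> ?M * r" using d by simp
  also have "\<dots> \<le> (fdet E E U)\<^sup>2 * ?M * r"
    using fdet_U M0 r(1) mult_right_mono[of 1 "(fdet E E U)\<^sup>2" "?M * r"] by (simp add: mult.assoc)
  also have "(fdet E E U)\<^sup>2 * ?M = Wt {} * real n ^ card P"
    using weighted_sum[of "{}" 0] unfolding Wt_def by (simp add: free_strip)
  also have "Wt {} * real n ^ card P * r \<le> Wt {} * real n ^ card P * (1 + 2 / (real n - 8)) ^ card touch"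
    using r(2) by (intro mult_left_mono) (auto simp: Wt_def wt_def intro!: mult_nonneg_nonneg sum_nonneg)
  finally show ?thesis by (simp only: mult.assoc)
qed

lemma v_norm:
  assumes "t \<in> triangles n"
  shows "(\<Sum>e\<in>E. (v t e)\<^sup>2) \<le> 3"
proof -
  have ft: "finite t" "card t = 3" using assms finite_subset[of t "{1..n}"] by (auto simp: triangles_def)
  let ?A = "{e. e \<subseteq> t \<and> card e = 2}"
  have cA: "finite ?A" "card ?A = 3" using ft n_subsets[OF ft(1), of 2] by (auto simp: choose_two)
  have "(\<Sum>e\<in>E. (v t e)\<^sup>2) = (\<Sum>e\<in>E \<inter> ?A. (v t e)\<^sup>2)"
    using finite_edges_off[of n] v_zero[of _ t] by (intro sum.mono_neutral_right) (auto simp: edges_off_def)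
  also have "\<dots> \<le> (\<Sum>e\<in>E \<inter> ?A. 1)"
  proof (rule sum_mono)
    fix e assume "e \<in> E \<inter> ?A"
    then have "(incidence t e)\<^sup>2 = 1" using incidence_square[of t e] ft by auto
    then show "(v t e)\<^sup>2 \<le> 1" by (simp add: v_def flip: of_int_power)
  qed
  also have "\<dots> \<le> 3" using cA card_mono[of ?A "E \<inter> ?A"] by simp
  finally show ?thesis .
qed

text \<open>Exponential tilting with \<open>y = n - 8\<close>. A basis containing \<open>F\<close>
  gains the factor \<open>(n - 7) ^ card F\<close>, while the determinant grows by at most 4 for
  each triangle of \<open>F\<close>, whose squared norm is at most 3.\<close>

lemma Wt_upper:
  assumes n: "n > 8" and F: "F \<subseteq> free" "\<And>t. t \<in> F \<Longrightarrow> 1 \<notin> t"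
  shows "Wt F \<le> (4 / (real n - 7)) ^ card F * Wt {}"
proof -
  note fE = finite_edges_off[of n]
  let ?d = "fdet E E (\<lambda>i j. (if i = j then 1 else 0) + (\<Sum>x\<in>V. D i x * D j x))"
  let ?y = "real n - 8"
  have fF: "finite F" using F finite_sets finite_subset by blast
  have "\<exists>r. 1 \<le> r \<and> r \<le> (1 + ?y * 3 / (real n - 8)) ^ card F \<and>
    fdet E E (\<lambda>i j. N touch i j + (\<Sum>t\<in>F. ?y * v t i * v t j)) = fdet E E (N touch) * r"
    using n F by (intro fdet_rank_one_updates[OF fE N_coercive _ fF] v_norm) (auto simp: free_def)
  moreover have "1 + ?y * 3 / (real n - 8) = 4" using n by (simp add: field_simps)
  ultimately obtain r where r: "1 \<le> r" "r \<le> 4 ^ card F"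
    "fdet E E (\<lambda>i j. N touch i j + (\<Sum>t\<in>F. ?y * v t i * v t j)) = fdet E E (N touch) * r"
    by (simp only:) blast
  have d: "1 \<le> ?d" by (rule fdet_DD_mono)
  have "fdet E E (M ?y F) * ?d = (fdet E E (M 0 {}) * r) * ?d"
    using M_N[OF F, of ?y] M_N[of "{}" 0] r(3) by simp
  then have e: "fdet E E (M ?y F) = fdet E E (M 0 {}) * r" using d by simp
  let ?S = "{S. S \<subseteq> free \<union> strip \<and> card S = card E}"
  have finS: "finite ?S" using finite_sets by (auto intro: finite_subset[of _ "Pow (free \<union> strip)"])
  have W0: "(\<Sum>S\<in>?S. wt S) = Wt {}" unfolding Wt_def by (simp add: free_strip)
  have nP: "real n ^ card P > 0" using n by simp
  have "(\<Sum>S\<in>?S. (1 + ?y) ^ card (F \<inter> S) * wt S) * real n ^ card P = (fdet E E U)\<^sup>2 * fdet E E (M ?y F)"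
    by (rule weighted_sum[OF F(1)])
  also have "\<dots> = ((fdet E E U)\<^sup>2 * fdet E E (M 0 {})) * r" unfolding e by simp
  also have "(fdet E E U)\<^sup>2 * fdet E E (M 0 {}) = Wt {} * real n ^ card P"
    using weighted_sum[of "{}" 0] W0 by simp
  finally have "(\<Sum>S\<in>?S. (1 + ?y) ^ card (F \<inter> S) * wt S) * real n ^ card P = (Wt {} * r) * real n ^ card P"
    by (simp only: mult.assoc mult.commute[of r])
  then have eq: "(\<Sum>S\<in>?S. (1 + ?y) ^ card (F \<inter> S) * wt S) = Wt {} * r"
    using nP by (simp only: mult_cancel_right) auto
  have "(1 + ?y) ^ card F * Wt F = (\<Sum>S | S \<in> ?S \<and> F \<subseteq> S. (1 + ?y) ^ card (F \<inter> S) * wt S)"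
    unfolding Wt_def sum_distrib_left free_strip(2)[symmetric]
    by (intro sum.cong) (auto simp: Int_absorb2)
  also have "\<dots> \<le> (\<Sum>S\<in>?S. (1 + ?y) ^ card (F \<inter> S) * wt S)"
    using n by (intro sum_mono2[OF finS]) (auto simp: wt_def)
  also have "\<dots> \<le> Wt {} * 4 ^ card F"
    unfolding eq using r(2) by (intro mult_left_mono) (auto simp: Wt_def wt_def intro!: sum_nonneg)
  finally have "(real n - 7) ^ card F * Wt F \<le> 4 ^ card F * Wt {}" by (simp add: algebra_simps)
  moreover have "(real n - 7) ^ card F > 0" using n by simp
  ultimately show ?thesis by (simp add: power_divide pos_le_divide_eq mult_ac)
qed

end

section \<open>Homology modulo 2\<close>

lemma F2_field: "field (residue_ring 2)"
proof -
  have "residues_prime 2" by unfold_locales auto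
  then show ?thesis using residues_prime.is_field[of 2] by simp
qed

lemma F2_carrier: "carrier (residue_ring 2) = {0, 1}"
  by (auto simp: residue_ring_def)

text \<open>A smallest generating set has \<open>dim\<close> elements, so there are at most
  \<open>2 ^ dim\<close> linear combinations.\<close>

lemma F2_dim_lower:
  assumes V: "vectorspace (residue_ring 2) V" and finV: "finite (carrier V)" and c: "2 ^ h \<le> card (carrier V)"
  shows "h \<le> vectorspace.dim (residue_ring 2) V"
proof -
  interpret vectorspace "residue_ring 2" V by fact
  let ?P = "\<lambda>n. \<exists>A. finite A \<and> card A = n \<and> A \<subseteq> carrier V \<and> gen_set A"
  have "gen_set (carrier V)"
  proof
    show "span (carrier V) \<subseteq> carrier V" by (rule span_is_subset2) simp
    show "carrier V \<subseteq> span (carrier V)" by (rule in_own_span) simp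
  qed
  then have "finite (carrier V) \<and> card (carrier V) = card (carrier V) \<and> carrier V \<subseteq> carrier V \<and> gen_set (carrier V)"
    using finV by simp
  then have "?P (card (carrier V))" by (rule exI)
  then have "?P dim" unfolding dim_def by (rule LeastI)
  then obtain A where A: "finite A" "card A = dim" "A \<subseteq> carrier V" "gen_set A" by blast
  have "carrier V \<subseteq> (\<lambda>a. lincomb a A) ` (A \<rightarrow>\<^sub>E {0, 1})"
  proof
    fix x assume "x \<in> carrier V"
    then have "x \<in> span A" using A(4) by simp
    then obtain a where a: "a \<in> A \<rightarrow> carrier (residue_ring 2)" "x = lincomb a A"
      using finite_span[OF A(1,3)] by blast
    have "lincomb (restrict a A) A = lincomb a A"
      unfolding lincomb_def using a(1) A(3) by (intro finsum_cong') (auto simp: Pi_iff)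
    then show "x \<in> (\<lambda>a. lincomb a A) ` (A \<rightarrow>\<^sub>E {0, 1})"
      using a by (intro image_eqI[of _ _ "restrict a A"]) (auto simp: F2_carrier)
  qed
  then have "card (carrier V) \<le> card (A \<rightarrow>\<^sub>E {0 :: int, 1})"
    using surj_card_le[of "A \<rightarrow>\<^sub>E {0 :: int, 1}"] A(1) by (simp add: finite_PiE)
  also have "\<dots> = 2 ^ dim" using A by (simp add: card_PiE numeral_2_eq_2)
  finally have "(2 :: nat) ^ h \<le> 2 ^ dim" using c by linarith
  then show ?thesis by (simp add: power_le_imp_le_exp)
qed

lemma (in comm_group) p_torsion_subgroup: "subgroup (carrier (p_torsion p G)) G"
proof (rule subgroupI)
  show "carrier (p_torsion p G) \<noteq> {}" using one_closed by (auto simp: p_torsion_def intro!: exI[of _ \<one>])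
  show "inv x \<in> carrier (p_torsion p G)" if "x \<in> carrier (p_torsion p G)" for x
    using that by (auto simp: p_torsion_def nat_pow_inv)
  show "x \<otimes> y \<in> carrier (p_torsion p G)" if xy: "x \<in> carrier (p_torsion p G)" "y \<in> carrier (p_torsion p G)" for x y
  proof -
    obtain a b where ab: "x [^] (p ^ a :: nat) = \<one>" "y [^] (p ^ b :: nat) = \<one>" and c: "x \<in> carrier G" "y \<in> carrier G"
      using xy by (auto simp: p_torsion_def)
    have "x [^] (p ^ (a + b) :: nat) = \<one>"
      using ab(1) c(1) nat_pow_pow[of x "p ^ a" "p ^ b"] by (simp add: power_add)
    moreover have "y [^] (p ^ (a + b) :: nat) = \<one>"
      using ab(2) c(2) nat_pow_pow[of y "p ^ b" "p ^ a"] by (simp add: power_add mult.commute)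
    ultimately have "(x \<otimes> y) [^] (p ^ (a + b) :: nat) = \<one>" using c by (simp add: nat_pow_distrib)
    then show ?thesis using c by (auto simp: p_torsion_def)
  qed
qed (auto simp: p_torsion_def)

context skeleton
begin

lemma F2_vectorspace: "vectorspace (residue_ring 2) Fh.H"
  unfolding vectorspace_def using Fh.H_module F2_field by simp

lemma F2_finite: "finite (carrier Fh.H)"
proof -
  have "Fh.Z \<subseteq> faces S 1 \<rightarrow>\<^sub>E {0, 1}" unfolding Fh.carrier_cycles F2_carrier by blast
  moreover have "finite (faces S 1 \<rightarrow>\<^sub>E {0, 1 :: int})" using finite_faces(2) by (rule finite_PiE) simp
  ultimately have "finite Fh.Z" by (rule finite_subset)
  then show ?thesis unfolding Fh.carrier_H by simp
qed

lemma dim_lower: "2 ^ h \<le> card (carrier Fh.H) \<Longrightarrow> h \<le> dim_H1_F2 S"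
  unfolding dim_H1_F2_def by (rule F2_dim_lower[OF F2_vectorspace F2_finite])

text \<open>\<gamma> names the strip of an index. For each label below \<open>h\<close>, the parity
  of the sum over its strip edges kills boundaries: a free triangle meets no strip edge, a strip
  triangle two with the same label. These functionals separate \<open>2 ^ h\<close> classes.\<close>

lemma dim_strips:
  assumes st: "strips n P \<sigma> u" and avoid: "faces S 2 \<inter> strips.bad n P \<sigma> u = {}"
    and \<gamma>: "\<And>p. p \<in> P \<Longrightarrow> \<gamma> (\<sigma> p) = \<gamma> p" and odd: "\<And>j. j < h \<Longrightarrow> odd (card {p \<in> P. \<gamma> p = (j :: nat)})"
  shows "h \<le> dim_H1_F2 S"
proof -
  interpret st: strips n P \<sigma> u by fact
  \<comment> \<open>Indicator of the strip edges with label in \<open>J\<close>. As every label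
    below \<open>h\<close> has an odd number of edges, its parity functional detects whether the
    label lies in \<open>J\<close>.\<close>
  define x where "x J e = (if e \<in> st.ed ` {p \<in> P. \<gamma> p \<in> J} then 1 else 0 :: int)" for J :: "nat set" and e
  have xe: "x J (st.ed p) = (if \<gamma> p \<in> J then 1 else 0)" if "p \<in> P" for J p
    using that inj_onD[OF st.inj_ed] by (auto simp: x_def)
  have ev: "even (\<Sum>p | p \<in> P \<and> \<gamma> p = j. incidence t (st.ed p))" if t: "t \<in> faces S 2" for t j
  proof -
    have "t \<in> st.free \<union> st.strip" using t avoid st.free_strip(2) faces_2 by blast
    then consider "t \<in> st.free" | q where "q \<in> P" "t = st.tr q" by (auto simp: st.strip_def)
    then show ?thesis
    proof cases
      case 1
      have "incidence t (st.ed p) = 0" if "p \<in> P" for p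
        using st.v_free[OF 1, of "st.ed p"] that by (auto simp: st.v_def st.E0_def)
      then show ?thesis by (simp add: sum.neutral)
    next
      case 2
      have odd1: "odd (incidence t (st.ed p))" if "p \<in> {q, \<sigma> q}" for p
      proof -
        have p: "p \<in> P" using that 2 st.\<sigma>_in by auto
        have "st.ed p \<subseteq> t" using that st.ed_sub_tr[OF 2(1) p] 2(2) by auto
        moreover have "finite t" "card t = 3" using st.tr_in[OF 2(1)] 2(2) finite_subset[of t "{1..n}"] by (auto simp: triangles_def)
        moreover have "card (st.ed p) = 2" using st.ed_in[OF p] by (simp add: edges_off_def)
        ultimately have "(incidence t (st.ed p))\<^sup>2 = 1" by (intro incidence_square) auto
        then have "odd ((incidence t (st.ed p))\<^sup>2)" by simp
        then show ?thesis by simp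
      qed
      have z: "incidence t (st.ed p) = 0" if "p \<in> P" "p \<notin> {q, \<sigma> q}" for p
        using incidence_subset[of t "st.ed p"] st.ed_sub_tr[OF 2(1) that(1)] that(2) 2(2) by auto
      show ?thesis
      proof (cases "\<gamma> q = j")
        case True
        have "(\<Sum>p | p \<in> P \<and> \<gamma> p = j. incidence t (st.ed p)) = (\<Sum>p\<in>{q, \<sigma> q}. incidence t (st.ed p))"
          using True 2(1) \<gamma> st.\<sigma>_in z st.finite_P by (intro sum.mono_neutral_right) auto
        also have "\<dots> = incidence t (st.ed q) + incidence t (st.ed (\<sigma> q))"
          using st.\<sigma>_neq[OF 2(1)] by simp
        finally show ?thesis using odd1 by simp
      next
        case False
        have "(\<Sum>p | p \<in> P \<and> \<gamma> p = j. incidence t (st.ed p)) = 0"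
        proof (intro sum.neutral ballI)
          fix p assume "p \<in> {p \<in> P. \<gamma> p = j}"
          then have "p \<in> P" "p \<notin> {q, \<sigma> q}" using False \<gamma>[OF 2(1)] by auto
          then show "incidence t (st.ed p) = 0" by (rule z)
        qed
        then show ?thesis by simp
      qed
    qed
  qed
  have "inj_on (\<lambda>J. Fh.cl (Fh.cyc (x J))) (Pow {..<h})"
  proof (rule inj_onI, rule ccontr)
    fix J J' assume J: "J \<in> Pow {..<h}" "J' \<in> Pow {..<h}" and e: "Fh.cl (Fh.cyc (x J)) = Fh.cl (Fh.cyc (x J'))" and "J \<noteq> J'"
    then obtain j where j: "j < h" "j \<in> J \<longleftrightarrow> j \<notin> J'" by auto
    obtain g where g: "\<And>e. e \<in> edges_off n \<Longrightarrow> (Fh.cyc (x J) e - Fh.cyc (x J') e) mod 2 = (\<Sum>t\<in>faces S 2. incidence t e * g t) mod 2"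
      using e unfolding Fh.cl_eq[OF Fh.cyc_in Fh.cyc_in] by blast
    let ?Pj = "{p \<in> P. \<gamma> p = j}"
    have "even ((x J (st.ed p) - x J' (st.ed p)) - (\<Sum>t\<in>faces S 2. incidence t (st.ed p) * g t))" if "p \<in> P" for p
    proof -
      have "(x J (st.ed p) - x J' (st.ed p)) mod 2 = (\<Sum>t\<in>faces S 2. incidence t (st.ed p) * g t) mod 2"
        using g[OF st.ed_in[OF that]] by (simp add: Fh.cyc_off[OF st.ed_in[OF that]] mod_diff_eq)
      then show ?thesis by (simp add: mod_eq_dvd_iff)
    qed
    then have "even (\<Sum>p\<in>?Pj. (x J (st.ed p) - x J' (st.ed p)) - (\<Sum>t\<in>faces S 2. incidence t (st.ed p) * g t))"
      by (intro dvd_sum) auto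
    moreover have "(\<Sum>p\<in>?Pj. \<Sum>t\<in>faces S 2. incidence t (st.ed p) * g t) = (\<Sum>t\<in>faces S 2. (\<Sum>p\<in>?Pj. incidence t (st.ed p)) * g t)"
      unfolding sum_distrib_right by (rule sum.swap)
    moreover have "even (\<Sum>t\<in>faces S 2. (\<Sum>p\<in>?Pj. incidence t (st.ed p)) * g t)"
      using ev by (intro dvd_sum) auto
    ultimately have "even (\<Sum>p\<in>?Pj. x J (st.ed p) - x J' (st.ed p))" by (simp add: sum_subtractf)
    also have "(\<Sum>p\<in>?Pj. x J (st.ed p) - x J' (st.ed p)) = (\<Sum>p\<in>?Pj. if j \<in> J then 1 else - 1)"
      using j by (intro sum.cong) (auto simp: xe)
    finally show False using odd[OF j(1)] by (auto split: if_splits)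
  qed
  then have "card (Pow {..<h}) \<le> card (carrier Fh.H)"
    using Fh.cyc_in by (intro card_inj_on_le[OF _ _ F2_finite]) (auto simp: Fh.carrier_H)
  then show ?thesis by (intro dim_lower) (simp add: card_Pow)
qed

section \<open>Reduction of integral homology modulo 2\<close>

definition reduce_cycle :: "(nat set \<Rightarrow> int) \<Rightarrow> nat set \<Rightarrow> int" where
  "reduce_cycle z = (\<lambda>e\<in>faces S 1. z e mod 2)"

definition reduce_class :: "(nat set \<Rightarrow> int) set \<Rightarrow> (nat set \<Rightarrow> int) set" where
  "reduce_class X = Fh.cl (reduce_cycle (SOME z. z \<in> Zh.Z \<and> Zh.cl z = X))"

lemma reduce_cycle_in: "z \<in> Zh.Z \<Longrightarrow> reduce_cycle z \<in> Fh.Z"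
proof -
  assume z: "z \<in> Zh.Z"
  have "(\<Sum>\<tau>\<in>faces S 1. incidence \<tau> \<sigma> * reduce_cycle z \<tau>) mod 2 = 0" if "\<sigma> \<in> faces S 0" for \<sigma>
  proof -
    have "(\<Sum>\<tau>\<in>faces S 1. incidence \<tau> \<sigma> * reduce_cycle z \<tau>) mod 2 = (\<Sum>\<tau>\<in>faces S 1. incidence \<tau> \<sigma> * (z \<tau> mod 2)) mod 2"
      by (simp add: reduce_cycle_def cong: sum.cong)
    also have "\<dots> = (\<Sum>\<tau>\<in>faces S 1. incidence \<tau> \<sigma> * z \<tau>) mod 2" by (rule Fh.sum_mod_simps(3))
    also have "(\<Sum>\<tau>\<in>faces S 1. incidence \<tau> \<sigma> * z \<tau>) = 0" using z that unfolding Zh.carrier_cycles by simp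
    finally show ?thesis by simp
  qed
  then show ?thesis unfolding Fh.carrier_cycles by (auto simp: reduce_cycle_def)
qed

lemma reduce_class_cl: "z \<in> Zh.Z \<Longrightarrow> reduce_class (Zh.cl z) = Fh.cl (reduce_cycle z)"
proof -
  assume z: "z \<in> Zh.Z"
  define z' where "z' = (SOME z'. z' \<in> Zh.Z \<and> Zh.cl z' = Zh.cl z)"
  have z': "z' \<in> Zh.Z" "Zh.cl z' = Zh.cl z" using someI[of "\<lambda>z'. z' \<in> Zh.Z \<and> Zh.cl z' = Zh.cl z" z] z unfolding z'_def by auto
  then obtain g where g: "\<And>e. e \<in> edges_off n \<Longrightarrow> z' e - z e = (\<Sum>t\<in>faces S 2. incidence t e * g t)"
    using Zh.cl_eq[OF z'(1) z] by auto
  have "(reduce_cycle z' e - reduce_cycle z e) mod 2 = (\<Sum>t\<in>faces S 2. incidence t e * g t) mod 2" if "e \<in> edges_off n" for e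
  proof -
    have "e \<in> faces S 1" using that faces_1_split(1) by blast
    then show ?thesis using g[OF that] by (simp add: reduce_cycle_def mod_diff_eq)
  qed
  then have "Fh.cl (reduce_cycle z') = Fh.cl (reduce_cycle z)"
    using Fh.cl_eq[OF reduce_cycle_in[OF z'(1)] reduce_cycle_in[OF z]] by blast
  then show ?thesis unfolding reduce_class_def z'_def .
qed

lemma reduce_class_add:
  assumes "X \<in> carrier Zh.H" "Y \<in> carrier Zh.H"
  shows "reduce_class (X \<oplus>\<^bsub>Zh.H\<^esub> Y) = reduce_class X \<oplus>\<^bsub>Fh.H\<^esub> reduce_class Y"
proof -
  interpret Zc: module \<Z> "cycles \<Z> S 1" by (rule Zh.cycles_module)
  obtain x y where xy: "x \<in> Zh.Z" "X = Zh.cl x" "y \<in> Zh.Z" "Y = Zh.cl y" using assms by (auto simp: Zh.carrier_H)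
  have "reduce_cycle (x \<oplus>\<^bsub>cycles \<Z> S 1\<^esub> y) = reduce_cycle x \<oplus>\<^bsub>cycles (residue_ring 2) S 1\<^esub> reduce_cycle y"
    unfolding Zh.cycles_ops Fh.cycles_ops by (auto simp: reduce_cycle_def fun_eq_iff mod_add_eq)
  then show ?thesis using xy
    by (simp add: Zh.add_H reduce_class_cl Fh.add_H reduce_cycle_in)
qed

lemma reduce_class_in: "X \<in> carrier Zh.H \<Longrightarrow> reduce_class X \<in> carrier Fh.H"
  using reduce_cycle_in by (auto simp: Zh.carrier_H Fh.carrier_H reduce_class_cl)

text \<open>A mod 2 cycle is determined by its values on \<open>edges_off n\<close>, and
  \<open>cyc\<close> extends the same values to an integral cycle.\<close>

lemma reduce_class_surj: "Y \<in> carrier Fh.H \<Longrightarrow> \<exists>X\<in>carrier Zh.H. reduce_class X = Y"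
proof -
  assume "Y \<in> carrier Fh.H"
  then obtain f where f: "f \<in> Fh.Z" "Y = Fh.cl f" by (auto simp: Fh.carrier_H)
  have "reduce_cycle (Zh.cyc f) = f"
  proof (rule Fh.cycle_eqI[OF reduce_cycle_in[OF Zh.cyc_in] f(1)])
    fix e assume e: "e \<in> edges_off n"
    then have e1: "e \<in> faces S 1" using faces_1_split(1) by blast
    then have "f e mod 2 = f e" using f(1) unfolding Fh.carrier_cycles Fh.carrier_R by auto
    then show "reduce_cycle (Zh.cyc f) e = f e" using e e1 by (simp add: reduce_cycle_def Zh.cyc_off)
  qed
  then have "reduce_class (Zh.cl (Zh.cyc f)) = Y" using f(2) reduce_class_cl[OF Zh.cyc_in] by simp
  then show ?thesis using Zh.cyc_in by (auto simp: Zh.carrier_H)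
qed

lemma H1_comm_group: "comm_group (H1_int S)"
proof -
  interpret module \<Z> Zh.H by (rule Zh.H_module)
  show ?thesis by (rule a_comm_group)
qed

text \<open>The reductions of generators of the 2-torsion span the homology modulo 2: every class
  has an odd multiple in the 2-torsion, and passing to an odd multiple does not change the
  reduction.\<close>

lemma dim_upper:
  assumes fin: "finite (carrier (H1_int S))"
    and A: "A \<subseteq> carrier (p_torsion 2 (H1_int S))" "finite A" "card A \<le> k"
    and gen: "generate (p_torsion 2 (H1_int S)) A = carrier (p_torsion 2 (H1_int S))"
  shows "dim_H1_F2 S \<le> k"
proof -
  interpret G: comm_group "H1_int S" by (rule H1_comm_group)
  interpret V: vectorspace "residue_ring 2" Fh.H by (rule F2_vectorspace)
  let ?G = "H1_int S" and ?\<Gamma> = "p_torsion 2 (H1_int S)" and ?r = reduce_class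
  have sub: "subgroup (carrier ?\<Gamma>) ?G" by (rule G.p_torsion_subgroup)
  have \<Gamma>_eq: "?\<Gamma> = ?G\<lparr>carrier := carrier ?\<Gamma>\<rparr>" by (simp add: p_torsion_def)
  have grp: "group ?\<Gamma>" using subgroup.subgroup_is_group[OF sub G.group_axioms] \<Gamma>_eq by simp
  have \<Gamma>_sub: "carrier ?\<Gamma> \<subseteq> carrier Zh.H" by (auto simp: p_torsion_def)
  have two: "Y \<oplus>\<^bsub>Fh.H\<^esub> Y = \<zero>\<^bsub>Fh.H\<^esub>" if "Y \<in> carrier Fh.H" for Y
  proof -
    have "(1 \<oplus>\<^bsub>residue_ring 2\<^esub> 1) \<odot>\<^bsub>Fh.H\<^esub> Y = Y \<oplus>\<^bsub>Fh.H\<^esub> Y"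
      using V.smult_l_distr[of 1 1 Y] V.smult_one[of Y] that by (simp add: Fh.one_R F2_carrier)
    moreover have "1 \<oplus>\<^bsub>residue_ring 2\<^esub> 1 = \<zero>\<^bsub>residue_ring 2\<^esub>" by (simp add: Fh.add_R Fh.zero_R)
    ultimately show ?thesis using V.smult_l_null[OF that] by simp
  qed
  have ab: "abelian_group Fh.H" using Fh.H_module by (simp add: module_def)
  have cancel: "Y = Y'" if "Y \<oplus>\<^bsub>Fh.H\<^esub> Y' = \<zero>\<^bsub>Fh.H\<^esub>" "Y \<in> carrier Fh.H" "Y' \<in> carrier Fh.H" for Y Y'
  proof -
    have "Y \<oplus>\<^bsub>Fh.H\<^esub> Y' = Y \<oplus>\<^bsub>Fh.H\<^esub> Y" using that two by simp
    then show ?thesis using that abelian_group.minus_equality[OF ab, of Y Y'] abelian_group.minus_equality[OF ab, of Y' Y'] two[of Y'] by (simp add: abelian_groupE(4)[OF ab])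
  qed
  have r1: "?r \<one>\<^bsub>?G\<^esub> = \<zero>\<^bsub>Fh.H\<^esub>"
  proof -
    have o: "\<one>\<^bsub>?G\<^esub> \<in> carrier Zh.H" using G.one_closed by simp
    have "?r \<one>\<^bsub>?G\<^esub> = ?r \<one>\<^bsub>?G\<^esub> \<oplus>\<^bsub>Fh.H\<^esub> ?r \<one>\<^bsub>?G\<^esub>"
      using reduce_class_add[OF o o] G.l_one[of "\<one>\<^bsub>?G\<^esub>"] o by simp
    then show ?thesis using two[OF reduce_class_in[OF o]] by simp
  qed
  have rpow: "?r (X [^]\<^bsub>?G\<^esub> (k :: nat)) = (if odd k then ?r X else \<zero>\<^bsub>Fh.H\<^esub>)" if X: "X \<in> carrier Zh.H" for X k
  proof (induction k)
    case (Suc k)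
    have "X [^]\<^bsub>?G\<^esub> k \<in> carrier Zh.H" using G.nat_pow_closed[of X k] X by simp
    then have "?r (X [^]\<^bsub>?G\<^esub> Suc k) = ?r (X [^]\<^bsub>?G\<^esub> k) \<oplus>\<^bsub>Fh.H\<^esub> ?r X"
      using reduce_class_add X by simp
    then show ?case using Suc two reduce_class_in[OF X] by simp
  qed (use r1 in simp)
  have rA: "?r ` A \<subseteq> carrier Fh.H" using A(1) \<Gamma>_sub reduce_class_in by blast
  have spanA: "?r X \<in> V.span (?r ` A)" if "X \<in> generate ?\<Gamma> A" for X
    using that
  proof (induction rule: generate.induct)
    case one
    have "\<zero>\<^bsub>Fh.H\<^esub> \<in> V.span (?r ` A)" using V.span_is_submodule[OF rA] V.span_zero by blast
    then show ?case using r1 by (simp add: p_torsion_def)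
  next
    case (incl h)
    show ?case by (rule subsetD[OF V.in_own_span[OF rA] imageI[OF incl]])
  next
    case (inv h)
    have h: "h \<in> carrier ?\<Gamma>" using inv A(1) by blast
    have hi: "inv\<^bsub>?\<Gamma>\<^esub> h \<in> carrier ?\<Gamma>" by (rule group.inv_closed[OF grp h])
    have "h \<otimes>\<^bsub>?\<Gamma>\<^esub> inv\<^bsub>?\<Gamma>\<^esub> h = \<one>\<^bsub>?\<Gamma>\<^esub>" by (rule group.r_inv[OF grp h])
    then have "h \<oplus>\<^bsub>Zh.H\<^esub> inv\<^bsub>?\<Gamma>\<^esub> h = \<one>\<^bsub>?G\<^esub>" by (simp add: p_torsion_def)
    then have "?r h \<oplus>\<^bsub>Fh.H\<^esub> ?r (inv\<^bsub>?\<Gamma>\<^esub> h) = \<zero>\<^bsub>Fh.H\<^esub>"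
      using reduce_class_add[of h "inv\<^bsub>?\<Gamma>\<^esub> h"] h hi \<Gamma>_sub r1 by auto
    then have e: "?r h = ?r (inv\<^bsub>?\<Gamma>\<^esub> h)"
      by (rule cancel[OF _ reduce_class_in[OF subsetD[OF \<Gamma>_sub h]] reduce_class_in[OF subsetD[OF \<Gamma>_sub hi]]])
    have "?r h \<in> V.span (?r ` A)" by (rule subsetD[OF V.in_own_span[OF rA] imageI[OF inv]])
    then show ?case unfolding e .
  next
    case (eng h1 h2)
    have "h1 \<in> carrier Zh.H" "h2 \<in> carrier Zh.H"
      using eng.hyps group.generate_in_carrier[OF grp A(1)] \<Gamma>_sub by blast+
    then have "?r (h1 \<otimes>\<^bsub>?\<Gamma>\<^esub> h2) = ?r h1 \<oplus>\<^bsub>Fh.H\<^esub> ?r h2" using reduce_class_add by (simp add: p_torsion_def)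
    then show ?case using submodule.m_closed[OF V.span_is_submodule[OF rA] eng.IH] by simp
  qed
  have "V.gen_set (?r ` A)"
  proof
    show "V.span (?r ` A) \<subseteq> carrier Fh.H" by (rule V.span_is_subset2[OF rA])
    show "carrier Fh.H \<subseteq> V.span (?r ` A)"
    proof
      fix Y assume "Y \<in> carrier Fh.H"
      then obtain X where X: "X \<in> carrier Zh.H" "?r X = Y" using reduce_class_surj by blast
      have N: "order ?G > 0" using fin X(1) by (auto simp: order_def card_gt_0_iff)
      \<comment> \<open>\<open>m\<close> is the odd part of the group order, so the
        \<open>m\<close>-th power of \<open>X\<close> has 2-power order.\<close>
      obtain a m where m: "\<not> 2 dvd m" "order ?G = m * 2 ^ a"
        using prime_power_canonical[OF two_is_prime_nat N] by blast
      have "(X [^]\<^bsub>?G\<^esub> m) [^]\<^bsub>?G\<^esub> (2 ^ a :: nat) = X [^]\<^bsub>?G\<^esub> order ?G"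
        using G.nat_pow_pow[of X m "2 ^ a"] X(1) m(2) by simp
      also have "\<dots> = \<one>\<^bsub>?G\<^esub>" using G.pow_order_eq_1[of X] X(1) by simp
      finally have "X [^]\<^bsub>?G\<^esub> m \<in> carrier ?\<Gamma>" using G.nat_pow_closed[of X m] X(1) by (auto simp: p_torsion_def)
      then have "?r (X [^]\<^bsub>?G\<^esub> m) \<in> V.span (?r ` A)" using spanA gen by blast
      then show "Y \<in> V.span (?r ` A)" using rpow[OF X(1), of m] m(1) X(2) by simp
    qed
  qed
  then have "V.dim \<le> card (?r ` A)" using A(2) rA by (intro V.gen_ge_dim) auto
  also have "\<dots> \<le> k" using card_image_le[OF A(2), of ?r] A(3) by linarith
  finally show ?thesis unfolding dim_H1_F2_def .
qed

end

section \<open>The law of the random hypertree\<close>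

definition tree_weight :: "nat \<Rightarrow> nat set set \<Rightarrow> real" where
  "tree_weight n F = (real_of_int (fdet (edges_off n) F (\<lambda>e t. incidence t e)))\<^sup>2"

definition tree_complex :: "nat \<Rightarrow> nat set set \<Rightarrow> nat set set" where
  "tree_complex n F = {\<sigma>. \<sigma> \<subseteq> {1..n} \<and> card \<sigma> \<in> {1, 2}} \<union> F"

text \<open>Only the number of triangles is prescribed. Dependent sets are included, with weight 0,
  so that Cauchy-Binet sums range over exactly this set.\<close>

definition bases :: "nat \<Rightarrow> nat set set set" where
  "bases n = {F. F \<subseteq> triangles n \<and> card F = card (edges_off n)}"

lemma finite_bases: "finite (bases n)"
  unfolding bases_def by (rule finite_subset[of _ "Pow (triangles n)"]) (auto simp: finite_triangles)

lemma card_edges_off: "card (edges_off n) = (n - 1) choose 2"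
  unfolding edges_off_def using n_subsets[of "{2..n}" 2] by simp

lemma hypertree_skeleton: "S \<in> hypertrees n \<Longrightarrow> skeleton n S"
  unfolding hypertrees_def skeleton_def by auto

lemma tree_complex_skeleton:
  assumes "F \<subseteq> triangles n"
  shows "skeleton n (tree_complex n F)"
proof
  have c3: "card \<sigma> = 3" "\<sigma> \<subseteq> {1..n}" if "\<sigma> \<in> F" for \<sigma> using assms that by (auto simp: triangles_def)
  have "\<tau> \<in> tree_complex n F" if "\<sigma> \<in> tree_complex n F" "\<tau> \<subseteq> \<sigma>" "\<tau> \<noteq> {}" for \<sigma> \<tau>
  proof (cases "\<tau> = \<sigma>")
    case False
    have s: "\<sigma> \<subseteq> {1..n}" "card \<sigma> \<le> 3" using that(1) c3 by (auto simp: tree_complex_def)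
    have fin: "finite \<sigma>" using finite_subset[OF s(1)] by simp
    have "card \<tau> < card \<sigma>" using psubset_card_mono[OF fin] that(2) False by blast
    moreover have "card \<tau> > 0" using that(3) finite_subset[OF that(2) fin] by (simp add: card_gt_0_iff)
    ultimately have "card \<tau> \<in> {1, 2}" using s(2) by auto
    then show ?thesis using that(2) s(1) by (auto simp: tree_complex_def)
  qed (use that in simp)
  moreover have "\<sigma> \<subseteq> {1..n} \<and> \<sigma> \<noteq> {}" if "\<sigma> \<in> tree_complex n F" for \<sigma>
    using that c3[of \<sigma>] by (cases "\<sigma> \<in> F") (auto simp: tree_complex_def)
  moreover from this have "finite \<sigma>" if "\<sigma> \<in> tree_complex n F" for \<sigma>
    using that finite_subset[of \<sigma> "{1..n}"] by blast
  moreover have "{v} \<in> tree_complex n F" if "v \<in> {1..n}" for v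
    using that by (simp add: tree_complex_def)
  ultimately show "simplicial_complex_on {1..n} (tree_complex n F)"
    unfolding simplicial_complex_on_def by blast
qed (auto simp: tree_complex_def)

lemma faces_tree_complex:
  assumes "F \<subseteq> triangles n"
  shows "faces (tree_complex n F) 2 = F"
proof -
  have "finite t \<and> card t = 3" if "t \<in> F" for t
    using assms that finite_subset[of t "{1..n}"] by (auto simp: triangles_def)
  then show ?thesis by (auto simp: faces_def tree_complex_def)
qed

lemma hypertree_order:
  assumes S: "S \<in> hypertrees n"
  shows "faces S 2 \<in> bases n" "tree_complex n (faces S 2) = S"
    and "(real (order (H1_int S)))\<^sup>2 = tree_weight n (faces S 2)" "tree_weight n (faces S 2) \<noteq> 0"
proof -
  interpret skeleton n S by (rule hypertree_skeleton[OF S])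
  have c: "card (faces S 2) = card (edges_off n)" using S by (simp add: hypertrees_def card_edges_off)
  have fin: "finite (carrier Zh.H)" using S by (simp add: hypertrees_def)
  show "faces S 2 \<in> bases n" using c faces_2 by (auto simp: bases_def)
  show "tree_complex n (faces S 2) = S"
  proof (intro equalityI subsetI)
    fix \<sigma> assume "\<sigma> \<in> S"
    moreover from this have f: "finite \<sigma>" "\<sigma> \<subseteq> {1..n}" using S_sub by blast+
    moreover have "\<sigma> \<noteq> {}" using \<open>\<sigma> \<in> S\<close> complex unfolding simplicial_complex_on_def by blast
    moreover have "card \<sigma> \<le> 3" using \<open>\<sigma> \<in> S\<close> S unfolding hypertrees_def by blast
    moreover from calculation have "card \<sigma> = 1 \<or> card \<sigma> = 2 \<or> card \<sigma> = 3"
      using card_gt_0_iff[of \<sigma>] by linarith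
    ultimately show "\<sigma> \<in> tree_complex n (faces S 2)" by (auto simp: tree_complex_def faces_def)
  next
    fix \<sigma> assume "\<sigma> \<in> tree_complex n (faces S 2)"
    then show "\<sigma> \<in> S" unfolding tree_complex_def using skel[of \<sigma>] faces_2 by auto
  qed
  have "real_of_int (int (order (H1_int S))) = \<bar>real_of_int (fdet (edges_off n) (faces S 2) (\<lambda>e t. incidence t e))\<bar>"
    using order_H(2)[OF c fin] by (simp add: order_def)
  then show "(real (order (H1_int S)))\<^sup>2 = tree_weight n (faces S 2)"
    by (simp add: tree_weight_def)
  show "tree_weight n (faces S 2) \<noteq> 0"
    using order_H(1)[OF c] fin by (simp add: tree_weight_def)
qed

lemma tree_complex_hypertree:
  assumes F: "F \<in> bases n" "tree_weight n F \<noteq> 0"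
  shows "tree_complex n F \<in> hypertrees n"
proof -
  have F1: "F \<subseteq> triangles n" "card F = card (edges_off n)" using F by (auto simp: bases_def)
  interpret skeleton n "tree_complex n F" by (rule tree_complex_skeleton[OF F1(1)])
  have f2: "faces (tree_complex n F) 2 = F" by (rule faces_tree_complex[OF F1(1)])
  have "finite (carrier Zh.H)"
    using order_H(1) F F1(2) unfolding f2 by (simp add: tree_weight_def)
  moreover have "\<forall>\<sigma>\<in>tree_complex n F. card \<sigma> \<le> 3" using F1(1) by (auto simp: tree_complex_def triangles_def)
  ultimately show ?thesis unfolding hypertrees_def
    using complex skel f2 F1(2) by (simp add: card_edges_off)
qed

text \<open>A hypertree is determined by its triangles, and finiteness of its homology means nonzero
  weight. Sums over hypertrees thus become sums over \<open>bases n\<close>.\<close>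

lemma hypertrees_bij: "bij_betw (tree_complex n) {F \<in> bases n. tree_weight n F \<noteq> 0} (hypertrees n)"
proof (rule bij_betwI[where g = "\<lambda>S. faces S 2"])
  show "tree_complex n \<in> {F \<in> bases n. tree_weight n F \<noteq> 0} \<rightarrow> hypertrees n"
    using tree_complex_hypertree by blast
  show "(\<lambda>S. faces S 2) \<in> hypertrees n \<rightarrow> {F \<in> bases n. tree_weight n F \<noteq> 0}"
    using hypertree_order by blast
  show "faces (tree_complex n F) 2 = F" if "F \<in> {F \<in> bases n. tree_weight n F \<noteq> 0}" for F
    using that faces_tree_complex by (auto simp: bases_def)
qed (rule hypertree_order(2))

locale hypertree_law = prob_space M for M :: "'a measure" +
  fixes n :: nat and T :: "'a \<Rightarrow> nat set set"
  assumes law: "determinantal_hypertree M n T"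
begin

lemma T_in: "\<omega> \<in> space M \<Longrightarrow> T \<omega> \<in> hypertrees n"
  using law measurable_space[of T M "count_space (hypertrees n)"] by (auto simp: determinantal_hypertree_def)

lemma finite_hypertrees: "finite (hypertrees n)"
  using bij_betw_finite[OF hypertrees_bij[of n]] finite_bases[of n] by simp

lemma event: "{\<omega> \<in> space M. Q (T \<omega>)} \<in> events"
proof -
  have "T -` {S \<in> hypertrees n. Q S} \<inter> space M \<in> sets M"
    using law by (intro measurable_sets[of T M "count_space (hypertrees n)"]) (auto simp: determinantal_hypertree_def)
  moreover have "T -` {S \<in> hypertrees n. Q S} \<inter> space M = {\<omega> \<in> space M. Q (T \<omega>)}" using T_in by auto
  ultimately show ?thesis by simp
qed

lemma prob_eq:
  "prob {\<omega> \<in> space M. Q (T \<omega>)} =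
    (\<Sum>F | F \<in> bases n \<and> Q (tree_complex n F). tree_weight n F) / real n ^ ((n - 2) choose 2)"
proof -
  let ?N = "real n ^ ((n - 2) choose 2)" and ?B = "{F \<in> bases n. tree_weight n F \<noteq> 0}"
  let ?f = "\<lambda>S. if Q S then (real (order (H1_int S)))\<^sup>2 / ?N else 0"
  have "prob {\<omega> \<in> space M. Q (T \<omega>)} = prob (\<Union>S\<in>{S \<in> hypertrees n. Q S}. {\<omega> \<in> space M. T \<omega> = S})"
    using T_in by (intro arg_cong[where f = prob]) auto
  also have "\<dots> = (\<Sum>S\<in>{S \<in> hypertrees n. Q S}. prob {\<omega> \<in> space M. T \<omega> = S})"
    using finite_hypertrees event by (intro finite_measure_finite_Union) (auto simp: disjoint_family_on_def)
  also have "\<dots> = (\<Sum>S\<in>{S \<in> hypertrees n. Q S}. (real (order (H1_int S)))\<^sup>2 / ?N)"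
    using law by (intro sum.cong) (auto simp: determinantal_hypertree_def)
  also have "\<dots> = (\<Sum>S\<in>hypertrees n. ?f S)"
    using finite_hypertrees by (intro sum.mono_neutral_cong_left) auto
  also have "\<dots> = (\<Sum>F\<in>?B. ?f (tree_complex n F))" by (rule sum.reindex_bij_betw[OF hypertrees_bij, symmetric])
  also have "\<dots> = (\<Sum>F | F \<in> bases n \<and> Q (tree_complex n F). tree_weight n F / ?N)"
  proof (rule sum.mono_neutral_cong)
    fix F assume "F \<in> ?B \<inter> {F \<in> bases n. Q (tree_complex n F)}"
    then have F: "F \<in> bases n" "tree_weight n F \<noteq> 0" "Q (tree_complex n F)" by auto
    have "(real (order (H1_int (tree_complex n F))))\<^sup>2 = tree_weight n F"
      using hypertree_order(3)[OF tree_complex_hypertree[OF F(1,2)]] faces_tree_complex[of F n] F(1) by (simp add: bases_def)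
    then show "?f (tree_complex n F) = tree_weight n F / ?N" using F by simp
  qed (use finite_bases[of n] in auto)
  finally show ?thesis by (simp add: sum_divide_distrib)
qed

text \<open>Kalai's formula is read off from the total probability being 1, given that
  \<open>T\<close> has the prescribed law.\<close>

lemma total: "(\<Sum>F\<in>bases n. tree_weight n F) = real n ^ ((n - 2) choose 2)" "(\<Sum>F\<in>bases n. tree_weight n F) > 0"
proof -
  define N where "N = real n ^ ((n - 2) choose 2)"
  have 1: "(\<Sum>F\<in>bases n. tree_weight n F) / N = 1"
    using prob_eq[of "\<lambda>_. True", folded N_def] prob_space by simp
  then have "N \<noteq> 0" by auto
  then have "(\<Sum>F\<in>bases n. tree_weight n F) = N" using 1 by simp
  then show "(\<Sum>F\<in>bases n. tree_weight n F) = real n ^ ((n - 2) choose 2)"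
    by (simp only: N_def)
  moreover have "(\<Sum>F\<in>bases n. tree_weight n F) \<ge> 0" by (intro sum_nonneg) (simp add: tree_weight_def)
  ultimately show "(\<Sum>F\<in>bases n. tree_weight n F) > 0"
    using 1 by (cases "(\<Sum>F\<in>bases n. tree_weight n F) = 0") auto
qed

end

section \<open>The second moment argument\<close>

text \<open>A point lying in \<open>k\<close> of the sets is counted \<open>k - k * (k - 1)\<close>
  times, as the pairs are ordered, and \<open>k * (2 - k)\<close> is at most 1.\<close>

lemma bonferroni:
  fixes f :: "'b \<Rightarrow> real"
  assumes X: "finite X" and U: "finite U" and A: "\<And>x. x \<in> X \<Longrightarrow> A x \<subseteq> U" and f: "\<And>F. F \<in> U \<Longrightarrow> 0 \<le> f F"
  shows "(\<Sum>x\<in>X. (\<Sum>F\<in>A x. f F) - (\<Sum>y\<in>X - {x}. \<Sum>F\<in>A x \<inter> A y. f F)) \<le> (\<Sum>F\<in>U. f F)"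
proof -
  let ?i = "\<lambda>x F. if F \<in> A x then 1 else 0 :: real"
  define k where "k F = (\<Sum>x\<in>X. ?i x F)" for F
  have kc: "k F = real (card {x \<in> X. F \<in> A x})" for F unfolding k_def using X by (simp add: sum.If_cases Collect_conj_eq)
  have "(\<Sum>F\<in>A x. f F) - (\<Sum>y\<in>X - {x}. \<Sum>F\<in>A x \<inter> A y. f F)
      = (\<Sum>F\<in>U. f F * (?i x F * (2 - k F)))" if x: "x \<in> X" for x
  proof -
    have a: "(\<Sum>F\<in>A x. f F) = (\<Sum>F\<in>U. f F * ?i x F)"
      using A[OF x] U by (intro sum.mono_neutral_cong_left) auto
    have b: "(\<Sum>F\<in>A x \<inter> A y. f F) = (\<Sum>F\<in>U. f F * (?i x F * ?i y F))" for y
      using A[OF x] U by (intro sum.mono_neutral_cong_left) auto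
    have "(\<Sum>y\<in>X - {x}. \<Sum>F\<in>A x \<inter> A y. f F) = (\<Sum>F\<in>U. \<Sum>y\<in>X - {x}. f F * (?i x F * ?i y F))"
      unfolding b by (rule sum.swap)
    also have "\<dots> = (\<Sum>F\<in>U. f F * (?i x F * (k F - ?i x F)))"
    proof (rule sum.cong[OF refl])
      fix F
      have "k F - ?i x F = (\<Sum>y\<in>X - {x}. ?i y F)" unfolding k_def using X x by (simp add: sum_diff1)
      then show "(\<Sum>y\<in>X - {x}. f F * (?i x F * ?i y F)) = f F * (?i x F * (k F - ?i x F))"
        by (simp add: sum_distrib_left)
    qed
    finally have "(\<Sum>F\<in>A x. f F) - (\<Sum>y\<in>X - {x}. \<Sum>F\<in>A x \<inter> A y. f F)
      = (\<Sum>F\<in>U. f F * ?i x F - f F * (?i x F * (k F - ?i x F)))" by (simp only: a sum_subtractf)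
    also have "\<dots> = (\<Sum>F\<in>U. f F * (?i x F * (2 - k F)))"
      by (intro sum.cong refl) (simp add: algebra_simps)
    finally show ?thesis .
  qed
  then have "(\<Sum>x\<in>X. (\<Sum>F\<in>A x. f F) - (\<Sum>y\<in>X - {x}. \<Sum>F\<in>A x \<inter> A y. f F))
      = (\<Sum>x\<in>X. \<Sum>F\<in>U. f F * (?i x F * (2 - k F)))" by (intro sum.cong) auto
  also have "\<dots> = (\<Sum>F\<in>U. f F * (k F * (2 - k F)))"
    unfolding k_def by (subst sum.swap) (simp add: sum_distrib_left sum_distrib_right)
  also have "\<dots> \<le> (\<Sum>F\<in>U. f F * 1)"
  proof (intro sum_mono mult_left_mono)
    show "k F * (2 - k F) \<le> 1" for F
      using zero_le_power2[of "k F - 1"] by (simp add: power2_eq_square algebra_simps)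
  qed (use f in auto)
  finally show ?thesis by simp
qed

lemma (in strips) card_touch: "card touch \<le> card P * n"
proof -
  have "touch \<subseteq> (\<Union>p\<in>P. (\<lambda>z. insert z (ed p)) ` {1..n})"
  proof (rule subsetI)
    fix t assume "t \<in> touch"
    then have tt: "t \<in> triangles n" "\<exists>p\<in>P. ed p \<subseteq> t" unfolding touch_def by simp_all
    from tt(2) obtain p where p: "p \<in> P" "ed p \<subseteq> t" by (elim bexE)
    have t: "t \<subseteq> {1..n}" "card t = 3" using tt(1) by (simp_all add: triangles_def)
    have fin: "finite t" using finite_subset[OF t(1)] by simp
    have "card (ed p) = 2" using ed_in[OF p(1)] by (simp add: edges_off_def)
    then have "card (t - ed p) = 1" using t(2) card_Diff_subset[of "ed p" t] p(2) finite_subset[OF p(2) fin] by simp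
    then obtain z where z: "t - ed p = {z}" by (rule card_1_singletonE)
    then have "t = insert z (ed p)" "z \<in> {1..n}" using p(2) t(1) by auto
    then have "t \<in> (\<lambda>z. insert z (ed p)) ` {1..n}" by (rule image_eqI)
    then show "t \<in> (\<Union>p\<in>P. (\<lambda>z. insert z (ed p)) ` {1..n})" using p(1) by (rule UN_I[rotated])
  qed
  then have "card touch \<le> card (\<Union>p\<in>P. (\<lambda>z. insert z (ed p)) ` {1..n})"
    using finite_P by (intro card_mono finite_UN_I finite_imageI) auto
  also have "\<dots> \<le> (\<Sum>p\<in>P. card ((\<lambda>z. insert z (ed p)) ` {1..n}))" by (rule card_UN_le[OF finite_P])
  also have "\<dots> \<le> (\<Sum>p\<in>P. n)"
  proof (rule sum_mono)
    show "card ((\<lambda>z. insert z (ed p)) ` {1..n}) \<le> n" for p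
      using card_image_le[of "{1..n}" "\<lambda>z. insert z (ed p)"] by simp
  qed
  finally show ?thesis by simp
qed

text \<open>Five consecutive indices form one strip, traversed cyclically by \<open>next5\<close>.\<close>

definition next5 :: "nat \<Rightarrow> nat" where
  "next5 p = 5 * (p div 5) + Suc p mod 5"

lemma next5_eq: "b < 5 \<Longrightarrow> next5 (5 * a + b) = 5 * a + Suc b mod 5"
  unfolding next5_def by (simp add: mod_Suc)

locale strip_positions = hypertree_law M n T for M :: "'a measure" and n T +
  fixes h w :: nat
  assumes h: "h > 0" and n_large: "n \<ge> 700" and w_def: "w = n div (100 * h)"
begin

abbreviation "P \<equiv> {..<5 * h}"
abbreviation "X \<equiv> P \<rightarrow>\<^sub>E {..<w}"

text \<open>Index \<open>p\<close> has its own block of \<open>w\<close> consecutive vertices,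
  starting after the root 1. The blocks are disjoint, so a vertex reveals both \<open>p\<close> and
  \<open>x p\<close>.\<close>

definition pos :: "(nat \<Rightarrow> nat) \<Rightarrow> nat \<Rightarrow> nat" where
  "pos x p = 2 + p * w + x p"

lemma next5_P: "p \<in> P \<Longrightarrow> next5 p \<in> P"
proof -
  assume "p \<in> P"
  moreover have "p div 5 < h" using calculation by auto
  moreover have "next5 p < 5 * (p div 5) + 5" unfolding next5_def by simp
  ultimately show ?thesis by auto
qed

lemma pos_eq:
  assumes "x \<in> X" "y \<in> X" "p \<in> P" "q \<in> P" "pos x p = pos y q"
  shows "p = q" "x p = y q"
proof -
  have w: "x p < w" "y q < w" using assms by (auto simp: PiE_iff)
  have e: "p * w + x p = q * w + y q" using assms(5) by (simp add: pos_def)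
  have "(p * w + x p) div w = p" "(q * w + y q) div w = q" using w by (simp_all add: div_mult_self3)
  then show "p = q" using e by simp
  then show "x p = y q" using e by simp
qed

lemma w_bound: "100 * (h * w) \<le> n"
  unfolding w_def using div_times_less_eq_dividend[of n "100 * h"] by (simp add: mult.commute mult.assoc mult.left_commute)

lemma strips: "x \<in> X \<Longrightarrow> strips n P next5 (pos x)"
proof
  assume x: "x \<in> X"
  show "next5 p \<noteq> p" for p unfolding next5_def by presburger
  show "next5 (next5 (next5 (next5 (next5 p)))) = p" for p
  proof -
    obtain a b where p: "p = 5 * a + b" "b < 5" using mod_less_divisor[of 5 p] mult_div_mod_eq[of 5 p] by (metis zero_less_numeral)
    have e: "next5 (5 * a + 0) = 5 * a + 1" "next5 (5 * a + 1) = 5 * a + 2" "next5 (5 * a + 2) = 5 * a + 3"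
      "next5 (5 * a + 3) = 5 * a + 4" "next5 (5 * a + 4) = 5 * a + 0"
      by (simp_all only: next5_eq) simp_all
    from p(2) consider "b = 0" | "b = 1" | "b = 2" | "b = 3" | "b = 4" by linarith
    then show ?thesis unfolding p(1) by cases (simp_all only: e)
  qed
  show "inj_on (pos x) P" using pos_eq[OF x x] by (auto intro: inj_onI)
  show "pos x p \<in> {2..n}" if p: "p \<in> P" for p
  proof -
    have "x p < w" using x p by (auto simp: PiE_iff)
    then have "p * w + x p < Suc p * w" by simp
    also have "\<dots> \<le> 5 * h * w" using p by (intro mult_right_mono) auto
    finally show ?thesis using w_bound n_large by (auto simp: pos_def)
  qed
  show "next5 p \<in> P" if "p \<in> P" for p using that by (rule next5_P)
qed (rule finite_lessThan)

abbreviation "avoid x \<equiv> {F \<in> bases n. F \<inter> strips.bad n P next5 (pos x) = {}}"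
abbreviation "q \<equiv> 4 / (real n - 7)"

lemma wt_eq_tree_weight: "x \<in> X \<Longrightarrow> strips.wt n F = tree_weight n F"
  using strips.wt_def[OF strips] strips.v_def[OF strips] by (simp add: tree_weight_def fdet_of_int)

lemma avoid_eq:
  assumes "x \<in> X"
  shows "avoid x = {F. F \<subseteq> triangles n - strips.bad n P next5 (pos x) \<and> card F = card (edges_off n)}"
  by (auto simp: bases_def)

lemma avoid_weight: "x \<in> X \<Longrightarrow> (\<Sum>F\<in>avoid x. tree_weight n F) = strips.Wt n P next5 (pos x) {}"
  unfolding avoid_eq strips.Wt_def[OF strips] by (simp add: wt_eq_tree_weight)

text \<open>Consider the triangles of the second placement at the indices where the placements
  differ; all of them lie in every basis of nonzero weight that avoids the bad triangles of
  \<open>y\<close>. If they are free for \<open>x\<close>, \<open>Wt_upper\<close> gives a factor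
  \<open>q\<close> for each of them; otherwise the joint weight is 0.\<close>

lemma avoid_pair:
  assumes x: "x \<in> X" and y: "y \<in> X"
  shows "(\<Sum>F\<in>avoid x \<inter> avoid y. tree_weight n F)
    \<le> q ^ card {p \<in> P. y p \<noteq> x p} * (\<Sum>F\<in>avoid x. tree_weight n F)"
proof -
  interpret sx: strips n P next5 "pos x" by (rule strips[OF x])
  interpret sy: strips n P next5 "pos y" by (rule strips[OF y])
  let ?D = "{p \<in> P. y p \<noteq> x p}"
  let ?F = "sy.tr ` ?D"
  have cF: "card ?F = card ?D" using sy.inj_tr by (intro card_image) (auto intro: inj_on_subset)
  have sub: "?F \<subseteq> F" if F: "F \<in> avoid y" "tree_weight n F \<noteq> 0" for F
  proof -
    have "F \<subseteq> sy.free \<union> sy.strip" "card F = card (edges_off n)" using F(1) by (auto simp: bases_def sy.free_strip(2))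
    then have "sy.strip \<subseteq> F" using sy.wt_strip[of F] F(2) wt_eq_tree_weight[OF y] by simp
    then show ?thesis unfolding sy.strip_def by blast
  qed
  have nonneg: "tree_weight n F \<ge> 0" for F by (simp add: tree_weight_def)
  have q0: "q \<ge> 0" using n_large by simp
  have fin: "finite (avoid x)" using finite_bases[of n] by simp
  show ?thesis
  proof (cases "?F \<subseteq> sx.free")
    case True
    have no1: "1 \<notin> t" if "t \<in> ?F" for t
    proof -
      from that obtain p where "t = sy.tr p" "p \<in> ?D" by (rule imageE)
      then have p: "p \<in> P" "t = {pos y p, pos y (next5 p), pos y (next5 (next5 p))}"
        by (simp_all add: sy.tr_def)
      then have "t \<subseteq> {2..n}" using sy.u_in next5_P by simp
      then show ?thesis by auto
    qed
    have "(\<Sum>F\<in>avoid x \<inter> avoid y. tree_weight n F) \<le> (\<Sum>F | F \<in> avoid x \<and> ?F \<subseteq> F. tree_weight n F)"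
    proof -
      have "(\<Sum>F\<in>avoid x \<inter> avoid y. tree_weight n F) = (\<Sum>F | F \<in> avoid x \<inter> avoid y \<and> ?F \<subseteq> F. tree_weight n F)"
        using fin sub by (intro sum.mono_neutral_right) auto
      also have "\<dots> \<le> (\<Sum>F | F \<in> avoid x \<and> ?F \<subseteq> F. tree_weight n F)"
        using nonneg by (intro sum_mono2 finite_subset[OF _ fin]) auto
      finally show ?thesis .
    qed
    also have "\<dots> = sx.Wt ?F" unfolding sx.Wt_def
      by (intro sum.cong) (auto simp: bases_def wt_eq_tree_weight[OF x])
    also have "\<dots> \<le> q ^ card ?F * sx.Wt {}" using n_large no1 by (intro sx.Wt_upper[OF _ True]) auto
    finally show ?thesis unfolding cF avoid_weight[OF x] .
  next
    case False
    then obtain p where p: "p \<in> P" "y p \<noteq> x p" "sy.tr p \<notin> sx.free" by auto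
    \<comment> \<open>\<open>pos y p\<close> lies in block \<open>p\<close> but differs from
      \<open>pos x p\<close>, so it is no vertex of the first placement. A triangle that is neither
      free nor in a strip is bad.\<close>
    have "sy.tr p \<notin> sx.strip"
    proof
      assume "sy.tr p \<in> sx.strip"
      then obtain p' where p': "p' \<in> P" "sy.tr p = sx.tr p'" by (auto simp: sx.strip_def)
      have "pos y p \<in> sx.tr p'" unfolding p'(2)[symmetric] by (simp add: sy.tr_def)
      then obtain r where r: "r \<in> P" "pos y p = pos x r" unfolding sx.tr_def using p'(1) next5_P by blast
      then show False using pos_eq[OF y x p(1) r] p(2) by simp
    qed
    then have bad: "sy.tr p \<in> sx.bad" using p(3) sx.free_strip(2) sy.tr_in[OF p(1)] by blast
    have "tree_weight n F = 0" if "F \<in> avoid x \<inter> avoid y" for F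
    proof (rule ccontr)
      assume "tree_weight n F \<noteq> 0"
      then have "sy.tr p \<in> F" using sub[of F] that p by auto
      then show False using bad that by auto
    qed
    then have "(\<Sum>F\<in>avoid x \<inter> avoid y. tree_weight n F) = 0" by (intro sum.neutral) blast
    then show ?thesis using q0 nonneg by (simp add: sum_nonneg)
  qed
qed

text \<open>Summed over all \<open>y\<close> the expression factors over the indices, each with one
  agreeing choice and fewer than \<open>w\<close> others; the term \<open>y = x\<close> accounts for
  the 1 that is subtracted.\<close>

lemma pair_sum:
  assumes x: "x \<in> X"
  shows "(\<Sum>y\<in>X - {x}. q ^ card {p \<in> P. y p \<noteq> x p}) \<le> 1 / 4"
proof -
  have q0: "q \<ge> 0" using n_large by simp
  have fX: "finite X" by (simp add: finite_PiE)
  have "q ^ card {p \<in> P. y p \<noteq> x p} = (\<Prod>p\<in>P. if y p \<noteq> x p then q else 1)" for y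
  proof -
    have "{p \<in> P. y p \<noteq> x p} = P \<inter> {p. y p \<noteq> x p}" by auto
    then show ?thesis by (simp only: prod.If_cases[OF finite_lessThan] prod_constant prod.neutral_const power_one mult_1_right)
  qed
  then have "(\<Sum>y\<in>X. q ^ card {p \<in> P. y p \<noteq> x p}) = (\<Prod>p\<in>P. \<Sum>k<w. if k \<noteq> x p then q else 1)"
    by (subst prod_sum_PiE) auto
  also have "\<dots> \<le> (\<Prod>p\<in>P. 1 + real w * q)"
  proof (intro prod_mono conjI)
    fix p assume p: "p \<in> P"
    have xp: "x p \<in> {..<w}" using x p by (auto simp: PiE_iff)
    define f where "f k = (if k \<noteq> x p then q else 1)" for k
    have "(\<Sum>k<w. f k) = f (x p) + (\<Sum>k\<in>{..<w} - {x p}. f k)"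
      by (rule sum.remove[OF finite_lessThan xp])
    also have "(\<Sum>k\<in>{..<w} - {x p}. f k) = (\<Sum>k\<in>{..<w} - {x p}. q)"
      by (intro sum.cong) (auto simp: f_def)
    also have "\<dots> = real (w - 1) * q"
      using xp by (simp only: sum_constant card_Diff_singleton card_lessThan)
    also have "\<dots> \<le> real w * q" using q0 by (intro mult_right_mono) auto
    finally show "(\<Sum>k<w. if k \<noteq> x p then q else 1) \<le> 1 + real w * q" unfolding f_def by simp
    show "0 \<le> (\<Sum>k<w. if k \<noteq> x p then q else 1)" using q0 by (intro sum_nonneg) auto
  qed
  also have "\<dots> = (1 + real w * q) ^ (5 * h)" by simp
  also have "\<dots> \<le> exp (real w * q) ^ (5 * h)" using q0 by (intro power_mono exp_ge_add_one_self) auto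
  also have "\<dots> = exp (real (5 * h) * (real w * q))" by (rule exp_of_nat_mult[symmetric])
  \<comment> \<open>By the choice of \<open>w\<close>, \<open>5 * h * w\<close> is at most
    \<open>n / 20\<close>, so the exponent is at most \<open>n / (5 * (n - 7))\<close>; for
    \<open>n \<ge> 700\<close> this is just above \<open>1 / 5\<close>.\<close>
  also have "\<dots> \<le> exp (203 / 1000)"
  proof -
    have "100 * (real h * real w) \<le> real n" using w_bound by (metis of_nat_le_iff of_nat_mult of_nat_numeral)
    moreover have "real n * 990 \<le> (real n - 7) * 1000" using n_large by simp
    ultimately have "real h * real w * 20 * 1000 \<le> 203 * (real n - 7)" using n_large by linarith
    then have "real (5 * h) * (real w * q) \<le> 203 / 1000" using n_large by (simp add: field_simps)
    then show ?thesis by simp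
  qed
  also have "\<dots> \<le> 1 + 203 / 1000 + (203 / 1000 :: real)\<^sup>2" by (rule exp_bound) auto
  also have "\<dots> \<le> 5 / 4" by (simp add: power2_eq_square)
  finally have "(\<Sum>y\<in>X. q ^ card {p \<in> P. y p \<noteq> x p}) \<le> 5 / 4" .
  moreover have "(\<Sum>y\<in>X. q ^ card {p \<in> P. y p \<noteq> x p}) = 1 + (\<Sum>y\<in>X - {x}. q ^ card {p \<in> P. y p \<noteq> x p})"
    using sum.remove[OF fX x, of "\<lambda>y. q ^ card {p \<in> P. y p \<noteq> x p}"] by simp
  ultimately show ?thesis by linarith
qed

lemma dim_avoid:
  assumes x: "x \<in> X" and F: "F \<in> avoid x"
  shows "h \<le> dim_H1_F2 (tree_complex n F)"
proof -
  have F1: "F \<subseteq> triangles n" using F by (auto simp: bases_def)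
  interpret skeleton n "tree_complex n F" by (rule tree_complex_skeleton[OF F1])
  show ?thesis
  proof (rule dim_strips[OF strips[OF x], of "\<lambda>p. p div 5"])
    show "faces (tree_complex n F) 2 \<inter> strips.bad n P next5 (pos x) = {}"
      using F faces_tree_complex[OF F1] by simp
    show "next5 p div 5 = p div 5" for p unfolding next5_def by simp
    fix j assume "j < h"
    then have "{p \<in> P. p div 5 = j} = {5 * j..<5 * j + 5}" by auto
    then show "odd (card {p \<in> P. p div 5 = j})" by simp
  qed
qed

lemma touch_bound: "x \<in> X \<Longrightarrow> card (strips.touch n P next5 (pos x)) \<le> 5 * h * n"
  using strips.card_touch[OF strips] by simp

text \<open>Each of the \<open>w ^ (5 * h)\<close> placements has probability at least
  \<open>1 / c\<close>, and by \<open>pair_sum\<close> the joint events take away at most a quarter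
  of it.\<close>

lemma prob_dim_lower:
  "prob {\<omega> \<in> space M. dim_H1_F2 (T \<omega>) \<ge> h}
    \<ge> 3 / 4 * real w ^ (5 * h) / (real n ^ (5 * h) * (1 + 2 / (real n - 8)) ^ (5 * h * n))"
proof -
  let ?U = "{F. F \<in> bases n \<and> dim_H1_F2 (tree_complex n F) \<ge> h}"
  let ?A = "\<lambda>x. \<Sum>F\<in>avoid x. tree_weight n F"
  define N where "N = (\<Sum>F\<in>bases n. tree_weight n F)"
  define c where "c = real n ^ (5 * h) * (1 + 2 / (real n - 8)) ^ (5 * h * n)"
  have N: "N > 0" "N = real n ^ ((n - 2) choose 2)" using total by (auto simp: N_def)
  have "2 / (real n - 8) > 0" "real n > 0" using n_large by auto
  then have c: "c > 0" unfolding c_def by (intro mult_pos_pos zero_less_power) linarith+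
  have nonneg: "tree_weight n F \<ge> 0" for F by (simp add: tree_weight_def)
  have fX: "finite X" by (simp add: finite_PiE)
  have lower: "N / c \<le> ?A x" if x: "x \<in> X" for x
  proof -
    interpret sx: strips n P next5 "pos x" by (rule strips[OF x])
    have "N = (\<Sum>S | S \<subseteq> triangles n \<and> card S = card (edges_off n). sx.wt S)"
      by (simp add: N_def bases_def wt_eq_tree_weight[OF x])
    also have "\<dots> \<le> sx.Wt {} * (real n ^ card P * (1 + 2 / (real n - 8)) ^ card sx.touch)"
      using n_large by (intro sx.Wt_empty_lower) simp
    also have "\<dots> \<le> sx.Wt {} * c"
    proof (rule mult_left_mono)
      have "(1 + 2 / (real n - 8)) ^ card sx.touch \<le> (1 + 2 / (real n - 8)) ^ (5 * h * n)"
        using n_large touch_bound[OF x] by (intro power_increasing) auto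
      then show "real n ^ card P * (1 + 2 / (real n - 8)) ^ card sx.touch \<le> c"
        unfolding c_def by (simp add: mult_left_mono)
      show "0 \<le> sx.Wt {}" unfolding avoid_weight[OF x, symmetric] by (intro sum_nonneg nonneg)
    qed
    finally show ?thesis using c unfolding avoid_weight[OF x] by (simp add: field_simps)
  qed
  have "3 / 4 * real w ^ (5 * h) * (N / c) = (\<Sum>x\<in>X. 3 / 4 * (N / c))"
    by (simp add: card_PiE)
  also have "\<dots> \<le> (\<Sum>x\<in>X. ?A x - (\<Sum>y\<in>X - {x}. \<Sum>F\<in>avoid x \<inter> avoid y. tree_weight n F))"
  proof (rule sum_mono)
    fix x assume x: "x \<in> X"
    have A0: "?A x \<ge> 0" by (intro sum_nonneg nonneg)
    have "(\<Sum>y\<in>X - {x}. \<Sum>F\<in>avoid x \<inter> avoid y. tree_weight n F) \<le> (\<Sum>y\<in>X - {x}. q ^ card {p \<in> P. y p \<noteq> x p} * ?A x)"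
      using avoid_pair[OF x] by (intro sum_mono) blast
    also have "\<dots> \<le> 1 / 4 * ?A x"
      unfolding sum_distrib_right[symmetric] by (rule mult_right_mono[OF pair_sum[OF x] A0])
    finally show "3 / 4 * (N / c) \<le> ?A x - (\<Sum>y\<in>X - {x}. \<Sum>F\<in>avoid x \<inter> avoid y. tree_weight n F)"
      using lower[OF x] by linarith
  qed
  also have "\<dots> \<le> (\<Sum>F\<in>?U. tree_weight n F)"
    using finite_bases[of n] dim_avoid nonneg by (intro bonferroni[OF fX]) auto
  finally have "3 / 4 * real w ^ (5 * h) * (N / c) / N \<le> (\<Sum>F\<in>?U. tree_weight n F) / N"
    using N(1) by (intro divide_right_mono) auto
  moreover have "prob {\<omega> \<in> space M. dim_H1_F2 (T \<omega>) \<ge> h} = (\<Sum>F\<in>?U. tree_weight n F) / N"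
    unfolding N(2) by (rule prob_eq)
  ultimately show ?thesis using N(1) unfolding c_def by simp
qed

end

lemma dim_tail_lower:
  assumes law: "determinantal_hypertree M n T" and h: "h > 0" and n: "n \<ge> 700 * h"
  shows "measure M {\<omega> \<in> space M. dim_H1_F2 (T \<omega>) \<ge> h} \<ge> exp (- 200 * real h) / (100 * real h) ^ (5 * h)"
proof -
  have n7: "n \<ge> 700" "n \<ge> 200 * h" using n h by auto
  interpret strip_positions M n T h "n div (100 * h)"
    using law h n7 by (intro strip_positions.intro hypertree_law.intro hypertree_law_axioms.intro strip_positions_axioms.intro)
      (auto simp: determinantal_hypertree_def)
  show ?thesis using prob_dim_lower parameter_bound[OF h n7(2)] n7(1) by linarith
qed

section \<open>Conclusion\<close>

lemma iso_generate:
  assumes \<Gamma>: "group \<Gamma>" and G: "group G" and iso: "\<Gamma> \<cong> G" and B: "B \<subseteq> carrier G" "finite B" "generate G B = carrier G"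
  obtains A where "A \<subseteq> carrier \<Gamma>" "finite A" "card A \<le> card B" "generate \<Gamma> A = carrier \<Gamma>"
proof -
  obtain f where f: "f \<in> iso G \<Gamma>" using group.iso_sym[OF \<Gamma> iso] unfolding is_iso_def by blast
  have im: "f ` carrier G = carrier \<Gamma>" using f by (simp add: iso_iff)
  interpret group_hom G \<Gamma> f
    using \<Gamma> G f by (simp add: group_hom_def group_hom_axioms_def iso_iff)
  have "generate \<Gamma> (f ` B) = carrier \<Gamma>" unfolding generate_img[OF B(1)] B(3) im ..
  moreover have "f ` B \<subseteq> carrier \<Gamma>" using image_mono[OF B(1), of f] unfolding im .
  ultimately show ?thesis using that[of "f ` B"] B(2) card_image_le[OF B(2), of f] by simp
qed

text \<open>The isomorphism carries fewer than \<open>h\<close> generators of the Hermite quotient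
  to the 2-torsion, where \<open>dim_upper\<close> applies.\<close>

lemma cokernel_dim:
  assumes S: "S \<in> hypertrees n" and H: "H \<in> hermite_data m A h" and iso: "p_torsion 2 (H1_int S) \<cong> hgroup m H"
  shows "dim_H1_F2 S < h"
proof -
  interpret skeleton n S by (rule hypertree_skeleton[OF S])
  interpret G: comm_group "H1_int S" by (rule H1_comm_group)
  have p: "p_torsion 2 (H1_int S) = (H1_int S)\<lparr>carrier := carrier (p_torsion 2 (H1_int S))\<rparr>" by (simp add: p_torsion_def)
  have \<Gamma>: "group (p_torsion 2 (H1_int S))"
    by (subst p, rule subgroup.subgroup_is_group[OF G.p_torsion_subgroup G.group_axioms])
  have fin: "finite (carrier (H1_int S))" using S by (simp add: hypertrees_def)
  obtain B where B: "B \<subseteq> carrier (hgroup m H)" "finite B" "card B < h" "generate (hgroup m H) B = carrier (hgroup m H)"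
    by (rule hgroup_generated[OF H])
  have grp: "group (hgroup m H)" using hgroup_comm_group[of m H] by (simp add: comm_group_def)
  obtain C where C: "C \<subseteq> carrier (p_torsion 2 (H1_int S))" "finite C" "card C \<le> card B"
    "generate (p_torsion 2 (H1_int S)) C = carrier (p_torsion 2 (H1_int S))"
    by (rule iso_generate[OF \<Gamma> grp iso B(1,2,4)])
  have "dim_H1_F2 S \<le> card B" by (rule dim_upper[OF fin C])
  then show ?thesis using B(3) by simp
qed

lemma hypertree_lawI: "determinantal_hypertree M n T \<Longrightarrow> hypertree_law M n T"
  by (simp add: hypertree_law_def hypertree_law_axioms_def determinantal_hypertree_def)

context hypertree_law
begin

lemma prob_dim_compl: "prob {\<omega> \<in> space M. dim_H1_F2 (T \<omega>) < h} = 1 - prob {\<omega> \<in> space M. dim_H1_F2 (T \<omega>) \<ge> h}"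
proof -
  have "{\<omega> \<in> space M. dim_H1_F2 (T \<omega>) < h} = space M - {\<omega> \<in> space M. dim_H1_F2 (T \<omega>) \<ge> h}" by auto
  then show ?thesis using prob_compl[OF event[of "\<lambda>S. dim_H1_F2 S \<ge> h"]] by simp
qed

lemma prob_dim_sum: "(\<Sum>k<h. prob {\<omega> \<in> space M. dim_H1_F2 (T \<omega>) = k}) = prob {\<omega> \<in> space M. dim_H1_F2 (T \<omega>) < h}"
proof -
  have "(\<Sum>k<h. prob {\<omega> \<in> space M. dim_H1_F2 (T \<omega>) = k}) = prob (\<Union>k\<in>{..<h}. {\<omega> \<in> space M. dim_H1_F2 (T \<omega>) = k})"
    using event by (intro finite_measure_finite_Union[symmetric]) (auto simp: disjoint_family_on_def)
  then show ?thesis by (simp add: UNION_eq Collect_conj_eq[symmetric] conj_ac cong: conj_cong)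
qed

text \<open>The events are disjoint because the representatives are pairwise nonisomorphic, and each
  of them forces dimension below \<open>h\<close>.\<close>

lemma prob_cokernels:
  fixes \<R> :: "nat monoid set"
  assumes R: "finite \<R>" "\<And>G. G \<in> \<R> \<Longrightarrow> \<exists>H\<in>hermite_data m A h. G = hgroup m H"
    "\<And>G G'. G \<in> \<R> \<Longrightarrow> G' \<in> \<R> \<Longrightarrow> G \<cong> G' \<Longrightarrow> G = G'"
  shows "(\<Sum>G\<in>\<R>. prob {\<omega> \<in> space M. p_torsion 2 (H1_int (T \<omega>)) \<cong> G}) \<le> prob {\<omega> \<in> space M. dim_H1_F2 (T \<omega>) < h}"
proof -
  let ?E = "\<lambda>G. {\<omega> \<in> space M. p_torsion 2 (H1_int (T \<omega>)) \<cong> G}"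
  have "disjoint_family_on ?E \<R>"
    unfolding disjoint_family_on_def
  proof (intro ballI impI)
    fix G G' assume G: "G \<in> \<R>" "G' \<in> \<R>" "G \<noteq> G'"
    have False if \<omega>: "\<omega> \<in> space M" "p_torsion 2 (H1_int (T \<omega>)) \<cong> G" "p_torsion 2 (H1_int (T \<omega>)) \<cong> G'" for \<omega>
    proof -
      interpret S: skeleton n "T \<omega>" by (rule hypertree_skeleton[OF T_in[OF \<omega>(1)]])
      interpret H1: comm_group "H1_int (T \<omega>)" by (rule S.H1_comm_group)
      let ?\<Gamma> = "p_torsion 2 (H1_int (T \<omega>))"
      have p: "?\<Gamma> = (H1_int (T \<omega>))\<lparr>carrier := carrier ?\<Gamma>\<rparr>" by (simp add: p_torsion_def)
      have "group ?\<Gamma>"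
        by (subst p, rule subgroup.subgroup_is_group[OF H1.p_torsion_subgroup H1.group_axioms])
      then have "G \<cong> G'" using iso_trans[OF group.iso_sym[OF _ \<omega>(2)] \<omega>(3)] by simp
      then show False using R(3)[OF G(1,2)] G(3) by simp
    qed
    then show "?E G \<inter> ?E G' = {}" by blast
  qed
  then have "(\<Sum>G\<in>\<R>. prob (?E G)) = prob (\<Union>G\<in>\<R>. ?E G)"
    using event R(1) by (intro finite_measure_finite_Union[symmetric]) auto
  also have "\<dots> \<le> prob {\<omega> \<in> space M. dim_H1_F2 (T \<omega>) < h}"
  proof (rule finite_measure_mono)
    show "(\<Union>G\<in>\<R>. ?E G) \<subseteq> {\<omega> \<in> space M. dim_H1_F2 (T \<omega>) < h}"
    proof (rule subsetI)
      fix \<omega> assume "\<omega> \<in> (\<Union>G\<in>\<R>. ?E G)"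
      then obtain G where G: "G \<in> \<R>" "\<omega> \<in> space M" "p_torsion 2 (H1_int (T \<omega>)) \<cong> G" by auto
      obtain H where H: "H \<in> hermite_data m A h" "G = hgroup m H" using R(2)[OF G(1)] by blast
      show "\<omega> \<in> {\<omega> \<in> space M. dim_H1_F2 (T \<omega>) < h}"
        using cokernel_dim[OF T_in[OF G(2)] H(1) G(3)[unfolded H(2)]] G(2) by simp
    qed
  qed (rule event)
  finally show ?thesis .
qed

end

theorem theorem2:
  fixes M :: "nat \<Rightarrow> 'a measure" and T :: "nat \<Rightarrow> 'a \<Rightarrow> nat set set"
  assumes "\<And>n. n \<ge> 3 \<Longrightarrow> determinantal_hypertree (M n) n (T n)"
  shows "(\<forall>h::nat. h > 0 \<longrightarrow>
            (\<forall>\<^sub>F n in sequentially.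
               measure (M n) {\<omega> \<in> space (M n). dim_H1_F2 (T n \<omega>) \<ge> h}
                 \<ge> exp (- 200 * real h) / (100 * real h) ^ (5 * h))) \<and>
         \<not> (\<forall>k::nat.
              (\<lambda>n. measure (M n) {\<omega> \<in> space (M n). dim_H1_F2 (T n \<omega>) = k})
                \<longlonglongrightarrow> 1 / 2 ^ (k ^ 2) * (\<Prod>j=1..k. 1 / (1 - 1 / 2 ^ j) ^ 2)
                      * prodinf (\<lambda>j. 1 - 1 / 2 ^ Suc j)) \<and>
         \<not> cohen_lenstra_limit M T 2 \<and>
         \<not> (\<forall>p. prime p \<longrightarrow> cohen_lenstra_limit M T p)"
proof -
  let ?\<beta> = "\<lambda>h. exp (- 200 * real h) / (100 * real h) ^ (5 * h)"
  let ?P = "\<lambda>n Q. measure (M n) {\<omega> \<in> space (M n). Q (T n \<omega>)}"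
  have law: "hypertree_law (M n) n (T n)" if "n \<ge> 3" for n using assms[OF that] by (rule hypertree_lawI)
  have lower: "?\<beta> h \<le> ?P n (\<lambda>S. dim_H1_F2 S \<ge> h)" if "h > 0" "n \<ge> 700 * h" for h n
    using that assms[of n] by (intro dim_tail_lower) auto
  have upper: "?P n (\<lambda>S. dim_H1_F2 S < h) \<le> 1 - ?\<beta> h" if "h > 0" "n \<ge> 700 * h" for h n
  proof -
    interpret hypertree_law "M n" n "T n" using that by (intro law) auto
    show ?thesis using prob_dim_compl[of h] lower[OF that] by linarith
  qed
  \<comment> \<open>One \<open>h\<close> refutes both limit laws: the proven tail exceeds what
    either law allows.\<close>
  obtain h :: nat where h: "h > 0" "4 * 2 ^ (Suc h * Suc (Suc h) div 2) / 2 ^ (h * h) < ?\<beta> h" "32 / 2 ^ (h * h) < ?\<beta> h"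
    using superexponential_beats by blast
  have 1: "\<forall>h::nat. h > 0 \<longrightarrow> (\<forall>\<^sub>F n in sequentially. ?P n (\<lambda>S. dim_H1_F2 S \<ge> h) \<ge> ?\<beta> h)"
    using lower by (intro allI impI eventually_sequentiallyI) blast
  have 2: "\<not> (\<forall>k::nat. (\<lambda>n. ?P n (\<lambda>S. dim_H1_F2 S = k))
      \<longlonglongrightarrow> 1 / 2 ^ (k ^ 2) * (\<Prod>j=1..k. 1 / (1 - 1 / 2 ^ j) ^ 2) * prodinf (\<lambda>j. 1 - 1 / 2 ^ Suc j))"
    unfolding corank_law_def[symmetric]
  proof
    assume "\<forall>k::nat. (\<lambda>n. ?P n (\<lambda>S. dim_H1_F2 S = k)) \<longlonglongrightarrow> corank_law k"
    \<comment> \<open>Convergence is used only for the finitely many values below \<open>h\<close>,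
      so no mass escaping to infinity has to be excluded; the bound on the finite sum passes to the
      limit.\<close>
    then have lim: "(\<lambda>n. \<Sum>k<h. ?P n (\<lambda>S. dim_H1_F2 S = k)) \<longlonglongrightarrow> (\<Sum>k<h. corank_law k)"
      by (intro tendsto_sum) blast
    have "(\<Sum>k<h. corank_law k) \<le> 1 - ?\<beta> h"
    proof (rule LIMSEQ_le_const2[OF lim], intro exI[of _ "700 * h"] allI impI)
      fix n assume n: "700 * h \<le> n"
      interpret hypertree_law "M n" n "T n" using n h(1) by (intro law) auto
      show "(\<Sum>k<h. ?P n (\<lambda>S. dim_H1_F2 S = k)) \<le> 1 - ?\<beta> h"
        unfolding prob_dim_sum by (rule upper[OF h(1) n])
    qed
    then show False using corank_law_tail[of h] h(3) by linarith
  qed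
  have 3: "\<not> cohen_lenstra_limit M T 2"
  proof
    assume CL: "cohen_lenstra_limit M T 2"
    \<comment> \<open>For each truncation only finitely many groups occur, so the bound again passes
      to the limit; the truncations are removed afterwards by
      \<open>hermite_weight_limit\<close>.\<close>
    have "qpoch_inf * hermite_weight m A h \<le> 1 - ?\<beta> h" for m A
    proof -
      obtain \<R> :: "nat monoid set" where R: "finite \<R>" "\<And>G. G \<in> \<R> \<Longrightarrow> \<exists>H\<in>hermite_data m A h. G = hgroup m H"
        "\<And>G G'. G \<in> \<R> \<Longrightarrow> G' \<in> \<R> \<Longrightarrow> G \<cong> G' \<Longrightarrow> G = G'"
        "hermite_weight m A h \<le> (\<Sum>G\<in>\<R>. 1 / real (card (auto G)))"
        using hermite_weight_reps[of m A h] by metis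
      have "(\<lambda>n. ?P n (\<lambda>S. p_torsion 2 (H1_int S) \<cong> G)) \<longlonglongrightarrow> 1 / real (card (auto G)) * qpoch_inf" if "G \<in> \<R>" for G
      proof -
        have "finite_abelian_p_group 2 G" using R(2)[OF that] hgroup_p_group by blast
        then show ?thesis using CL unfolding cohen_lenstra_limit_def qpoch_inf_def by simp
      qed
      then have lim: "(\<lambda>n. \<Sum>G\<in>\<R>. ?P n (\<lambda>S. p_torsion 2 (H1_int S) \<cong> G))
          \<longlonglongrightarrow> (\<Sum>G\<in>\<R>. 1 / real (card (auto G)) * qpoch_inf)"
        by (intro tendsto_sum) blast
      have "(\<Sum>G\<in>\<R>. 1 / real (card (auto G)) * qpoch_inf) \<le> 1 - ?\<beta> h"
      proof (rule LIMSEQ_le_const2[OF lim], intro exI[of _ "700 * h"] allI impI)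
        fix n assume n: "700 * h \<le> n"
        interpret hypertree_law "M n" n "T n" using n h(1) by (intro law) auto
        show "(\<Sum>G\<in>\<R>. ?P n (\<lambda>S. p_torsion 2 (H1_int S) \<cong> G)) \<le> 1 - ?\<beta> h"
          using prob_cokernels[OF R(1-3)] upper[OF h(1) n] by linarith
      qed
      moreover have "hermite_weight m A h * qpoch_inf \<le> (\<Sum>G\<in>\<R>. 1 / real (card (auto G))) * qpoch_inf"
        using R(4) qpoch_inf_bounds(1) by (intro mult_right_mono) auto
      ultimately show ?thesis unfolding sum_distrib_right[symmetric] by (simp add: mult.commute)
    qed
    then have "?\<beta> h \<le> 4 * 2 ^ (Suc h * Suc (Suc h) div 2) / 2 ^ (h * h)" by (rule hermite_weight_limit)
    then show False using h(2) by linarith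
  qed
  then have "\<not> (\<forall>p. prime p \<longrightarrow> cohen_lenstra_limit M T p)" using two_is_prime_nat by blast
  then show ?thesis using 1 2 3 by blast
qed

end
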